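(* Let $G_0$ be an infinite, connected, quasi-transitive, cubic graph, let $\phi$ be a local transformation and $G_1=\phi(G_0)$ (assumed connected). Let $W_0$ be a minimal fundamental domain of $G_0$ and $W_1$ the set of all vertices of the gadgets $\phi(v)$, $v\in W_0$ (a fundamental domain of $G_1$), with $X_k$ the set of edges of $G_k$ incident to vertices in $W_k$. Assume $|\gamma(G_0)|<\infty$. Then $\gamma(G_1)=\gamma(G_0)$. Moreover, if $\eta(G_1)$ exists, then $\eta(G_0)$ exists and $\eta(G_0)=\eta(G_1)$.
   Context: All graphs are simple (no loops, no multiple edges). A graph $G=(V,E)$ is quasi-transitive if there is a finite $W\subseteq V$ such that every vertex is mapped into $W$ by some automorphism of $G$ (such $W$ is a fundamental domain); it is cubic if every vertex has degree $3$. Local transformation: a local transformation $\phi$ acts at a degree-$3$ vertex $v$ of a simple graph by replacing $v$ with a finite connected graph (the gadget) $\phi(v)$ having three distinct distinguished outer vertices (ports) $w_1,w_2,w_3$, each port being attached to exactly one of the three edges formerly incident to $v$ (one port per edge). It is required that (i) all gadgets $\phi(v)$ are isomorphic via isomorphisms sending ports to ports, and (ii) some subgroup of the automorphism group of $\phi(v)$ preserves the set $\{w_1,w_2,w_3\}$ and acts transitively on it. $\phi(G)$ denotes the graph obtained by applying $\phi$ at every degree-$3$ vertex of $G$. Automorphisms of $G_0$ induce automorphisms of $G_1$. Mid-edge convention: each edge $e$ is identified with a point at its middle (also denoted $e$). Walks may start and end at mid-edges; such a walk is self-avoiding (a SAW) if it visits no vertex and no mid-edge more than once, and its length $|\pi|$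 is the number of vertices it visits. For quasi-transitive $G$, $\mu(G)$ denotes the connective constant $\lim_n \sigma_n(v)^{1/n}$ ($\sigma_n(v)$ the number of $n$-step SAWs from a vertex $v$). Exponents: for an infinite, connected, quasi-transitive graph $G$ with connective constant $\mu$, fundamental domain $W$, and $X$ the set of edges incident to vertices in $W$, let $\Sigma$ be the set of SAWs on $G$ starting at mid-edges in $X$. Set $Y(x,y)=\sum_{\pi\in\Sigma}x^{|\pi|}/|\pi|^{y}$ ($x>0$, $y\in\mathbb R$; denominator $1$ if $|\pi|=0$), and let $\gamma(G)\in[-\infty,\infty]$ be such that $Y(\mu^{-1},y)=\infty$ for $y<\gamma$ and $Y(\mu^{-1},y)<\infty$ for $y>\gamma$. For an automorphism $\alpha$ of $G$ let $Z_\alpha(x)=\sum_{\pi\in\Sigma(\alpha)}x^{|\pi|}$, where $\Sigma(\alpha)\subseteq\Sigma$ consists of SAWs ending at mid-edges in $\alpha X$. We say $\eta=\eta(G)\in[-\infty,\infty]$ exists if for every sequence of automorphisms $\alpha$ with $d_G(W,\alpha W)\to\infty$, $Z_\alpha(\mu^{-1})\,d_G(W,\alpha W)^{w}\to0$ for $w<\eta$ and $\to\infty$ for $w>\eta$. Here $d_G$ is graph distance. These exponents do not depend on the choice of $W$. *)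

theory Defs
  imports "HOL-Analysis.Analysis"
begin

section \<open>Simple graphs\<close>

text \<open>A simple graph is given by a vertex set V and a symmetric irreflexive
  adjacency relation E supported on V.\<close>

definition simple_graph :: "'v set \<Rightarrow> ('v \<Rightarrow> 'v \<Rightarrow> bool) \<Rightarrow> bool" where
  "simple_graph V E \<longleftrightarrow>
     (\<forall>u v. E u v \<longrightarrow> u \<in> V \<and> v \<in> V) \<and> (\<forall>u v. E u v \<longrightarrow> E v u) \<and> (\<forall>u. \<not> E u u)"

definition connected_graph :: "'v set \<Rightarrow> ('v \<Rightarrow> 'v \<Rightarrow> bool) \<Rightarrow> bool" where
  "connected_graph V E \<longleftrightarrow> (\<forall>u\<in>V. \<forall>v\<in>V. (u, v) \<in> {(a, b). E a b}\<^sup>*)"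

definition cubic :: "'v set \<Rightarrow> ('v \<Rightarrow> 'v \<Rightarrow> bool) \<Rightarrow> bool" where
  "cubic V E \<longleftrightarrow> (\<forall>v\<in>V. finite {u. E v u} \<and> card {u. E v u} = 3)"

definition aut :: "'v set \<Rightarrow> ('v \<Rightarrow> 'v \<Rightarrow> bool) \<Rightarrow> ('v \<Rightarrow> 'v) \<Rightarrow> bool" where
  "aut V E f \<longleftrightarrow> bij_betw f V V \<and> (\<forall>u\<in>V. \<forall>v\<in>V. E (f u) (f v) \<longleftrightarrow> E u v)"

definition fund_domain :: "'v set \<Rightarrow> ('v \<Rightarrow> 'v \<Rightarrow> bool) \<Rightarrow> 'v set \<Rightarrow> bool" where
  "fund_domain V E W \<longleftrightarrow> finite W \<and> W \<subseteq> V \<and> (\<forall>v\<in>V. \<exists>f. aut V E f \<and> f v \<in> W)"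

definition quasi_transitive :: "'v set \<Rightarrow> ('v \<Rightarrow> 'v \<Rightarrow> bool) \<Rightarrow> bool" where
  "quasi_transitive V E \<longleftrightarrow> (\<exists>W. fund_domain V E W)"

text \<open>Minimal fundamental domain: minimal with respect to inclusion.\<close>
definition min_fund_domain :: "'v set \<Rightarrow> ('v \<Rightarrow> 'v \<Rightarrow> bool) \<Rightarrow> 'v set \<Rightarrow> bool" where
  "min_fund_domain V E W \<longleftrightarrow> fund_domain V E W \<and> (\<forall>W'. W' \<subset> W \<longrightarrow> \<not> fund_domain V E W')"

text \<open>Edges are two-element sets; the edges incident to vertices of W.\<close>
definition edge_set :: "('v \<Rightarrow> 'v \<Rightarrow> bool) \<Rightarrow> 'v set set" where
  "edge_set E = {{u, v} | u v. E u v}"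

definition inc_edges :: "('v \<Rightarrow> 'v \<Rightarrow> bool) \<Rightarrow> 'v set \<Rightarrow> 'v set set" where
  "inc_edges E W = {e \<in> edge_set E. \<exists>w\<in>W. w \<in> e}"

text \<open>Graph distance and distance between vertex sets.\<close>
definition gdist :: "('v \<Rightarrow> 'v \<Rightarrow> bool) \<Rightarrow> 'v \<Rightarrow> 'v \<Rightarrow> nat" where
  "gdist E u v = (LEAST n. (u, v) \<in> {(a, b). E a b} ^^ n)"

definition setdist :: "('v \<Rightarrow> 'v \<Rightarrow> bool) \<Rightarrow> 'v set \<Rightarrow> 'v set \<Rightarrow> nat" where
  "setdist E A B = Inf {gdist E u v | u v. u \<in> A \<and> v \<in> B}"

section \<open>Self-avoiding walks and the connective constant\<close>

text \<open>Number of n-step SAWs from vertex v (lists of n+1 distinct vertices,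
  consecutive ones adjacent).\<close>
definition saw_count :: "('v \<Rightarrow> 'v \<Rightarrow> bool) \<Rightarrow> 'v \<Rightarrow> nat \<Rightarrow> nat" where
  "saw_count E v n = card {p. length p = Suc n \<and> hd p = v \<and> distinct p \<and> successively E p}"

definition conn_const :: "'v set \<Rightarrow> ('v \<Rightarrow> 'v \<Rightarrow> bool) \<Rightarrow> real" where
  "conn_const V E = (THE m. \<forall>v\<in>V. (\<lambda>n. root n (real (saw_count E v n))) \<longlonglongrightarrow> m)"

text \<open>Mid-edge convention: positions are vertices or (middles of) edges.\<close>
datatype 'v pos = Vx 'v | Md "'v set"

fun is_Vx :: "'v pos \<Rightarrow> bool" where
  "is_Vx (Vx _) = True"
| "is_Vx (Md _) = False"

fun step_ok :: "('v \<Rightarrow> 'v \<Rightarrow> bool) \<Rightarrow> 'v pos \<Rightarrow> 'v pos \<Rightarrow> bool" where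
  "step_ok E (Md e) (Vx v) = (e \<in> edge_set E \<and> v \<in> e)"
| "step_ok E (Vx v) (Md e) = (e \<in> edge_set E \<and> v \<in> e)"
| "step_ok E _ _ = False"

text \<open>A walk (possibly starting/ending at mid-edges) that is self-avoiding:
  it visits no vertex and no mid-edge twice.\<close>
definition mid_saw :: "('v \<Rightarrow> 'v \<Rightarrow> bool) \<Rightarrow> 'v pos list \<Rightarrow> bool" where
  "mid_saw E p \<longleftrightarrow> p \<noteq> [] \<and> distinct p \<and> successively (step_ok E) p"

text \<open>Length = number of vertices visited.\<close>
definition wlen :: "'v pos list \<Rightarrow> nat" where
  "wlen p = length (filter is_Vx p)"

text \<open>Sigma: SAWs starting at mid-edges in X (edges incident to W).\<close>
definition Sig :: "('v \<Rightarrow> 'v \<Rightarrow> bool) \<Rightarrow> 'v set \<Rightarrow> 'v pos list set" where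
  "Sig E W = {p. mid_saw E p \<and> (\<exists>e\<in>inc_edges E W. hd p = Md e)}"

definition Yfun :: "('v \<Rightarrow> 'v \<Rightarrow> bool) \<Rightarrow> 'v set \<Rightarrow> real \<Rightarrow> real \<Rightarrow> ennreal" where
  "Yfun E W x y = (\<Sum>\<^sub>\<infinity>p\<in>Sig E W.
      ennreal (x ^ wlen p / (if wlen p = 0 then 1 else real (wlen p) powr y)))"

definition gamma_exp :: "'v set \<Rightarrow> ('v \<Rightarrow> 'v \<Rightarrow> bool) \<Rightarrow> 'v set \<Rightarrow> ereal \<Rightarrow> bool" where
  "gamma_exp V E W g \<longleftrightarrow>
     (\<forall>y::real. ereal y < g \<longrightarrow> Yfun E W (1 / conn_const V E) y = \<infinity>) \<and>
     (\<forall>y::real. g < ereal y \<longrightarrow> Yfun E W (1 / conn_const V E) y < \<infinity>)"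

text \<open>Sigma(alpha): SAWs in Sigma ending at mid-edges in alpha X.\<close>
definition Zfun :: "('v \<Rightarrow> 'v \<Rightarrow> bool) \<Rightarrow> 'v set \<Rightarrow> ('v \<Rightarrow> 'v) \<Rightarrow> real \<Rightarrow> ennreal" where
  "Zfun E W \<alpha> x = (\<Sum>\<^sub>\<infinity>p\<in>{p \<in> Sig E W. \<exists>e\<in>inc_edges E W. last p = Md (\<alpha> ` e)}.
      ennreal (x ^ wlen p))"

definition eta_exp :: "'v set \<Rightarrow> ('v \<Rightarrow> 'v \<Rightarrow> bool) \<Rightarrow> 'v set \<Rightarrow> ereal \<Rightarrow> bool" where
  "eta_exp V E W \<eta> \<longleftrightarrow>
     (\<forall>\<alpha> :: nat \<Rightarrow> 'v \<Rightarrow> 'v.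
        (\<forall>k. aut V E (\<alpha> k)) \<and>
        filterlim (\<lambda>k. real (setdist E W (\<alpha> k ` W))) at_top sequentially \<longrightarrow>
        (\<forall>w::real. ereal w < \<eta> \<longrightarrow>
           ((\<lambda>k. Zfun E W (\<alpha> k) (1 / conn_const V E) *
                  ennreal (real (setdist E W (\<alpha> k ` W)) powr w)) \<longlongrightarrow> 0) sequentially) \<and>
        (\<forall>w::real. \<eta> < ereal w \<longrightarrow>
           ((\<lambda>k. Zfun E W (\<alpha> k) (1 / conn_const V E) *
                  ennreal (real (setdist E W (\<alpha> k ` W)) powr w)) \<longlongrightarrow> \<infinity>) sequentially))"

section \<open>Local transformations\<close>

text \<open>The gadget: a finite connected simple graph with three distinct ports
  w1 w2 w3, such that the automorphisms of the gadget preserving the port set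
  act transitively on it (equivalently: some subgroup of the automorphism group
  preserves the port set and acts transitively on it).\<close>
definition gadget :: "'g set \<Rightarrow> ('g \<Rightarrow> 'g \<Rightarrow> bool) \<Rightarrow> 'g \<Rightarrow> 'g \<Rightarrow> 'g \<Rightarrow> bool" where
  "gadget Gv Ge w1 w2 w3 \<longleftrightarrow>
     finite Gv \<and> simple_graph Gv Ge \<and> connected_graph Gv Ge \<and>
     {w1, w2, w3} \<subseteq> Gv \<and> w1 \<noteq> w2 \<and> w1 \<noteq> w3 \<and> w2 \<noteq> w3 \<and>
     (\<forall>a\<in>{w1, w2, w3}. \<forall>b\<in>{w1, w2, w3}.
        \<exists>f. aut Gv Ge f \<and> f ` {w1, w2, w3} = {w1, w2, w3} \<and> f a = b)"

text \<open>phi(G): each vertex v of G0 is replaced by a copy {v} x Gv of the gadget;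
  the edge {v,u} of G0 becomes the edge between port sigma v u of the copy at v
  and port sigma u v of the copy at u.\<close>
definition phi_V :: "'v set \<Rightarrow> 'g set \<Rightarrow> ('v \<times> 'g) set" where
  "phi_V V0 Gv = V0 \<times> Gv"

definition phi_E :: "'v set \<Rightarrow> ('v \<Rightarrow> 'v \<Rightarrow> bool) \<Rightarrow> ('g \<Rightarrow> 'g \<Rightarrow> bool) \<Rightarrow> ('v \<Rightarrow> 'v \<Rightarrow> 'g)
                     \<Rightarrow> 'v \<times> 'g \<Rightarrow> 'v \<times> 'g \<Rightarrow> bool" where
  "phi_E V0 E0 Ge \<sigma> x y \<longleftrightarrow>
     (fst x = fst y \<and> fst x \<in> V0 \<and> Ge (snd x) (snd y)) \<or>
     (E0 (fst x) (fst y) \<and> snd x = \<sigma> (fst x) (fst y) \<and> snd y = \<sigma> (fst y) (fst x))"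

end

theory Submission
  imports Defs
begin

text \<open>
  Let \<open>g x\<close> be the sum of \<open>x ^ length\<close> over the self-avoiding paths of the gadget between two distinct
  ports; by the symmetry of the gadget it does not depend on the ports. Since a gadget is attached by
  only three edges, a self-avoiding walk of \<open>G1\<close> that starts and ends at edges inherited from \<open>G0\<close>
  crosses each gadget at most once, so it is a walk of \<open>G0\<close> with a gadget path substituted for each vertex.
  Hence the walk generating functions satisfy \<open>Z1(x) = Z0(g x)\<close> on such walks, and every other walk
  differs from one of them by boundedly many choices of pieces of bounded length. Comparing the
  radii of convergence gives \<open>g (1 / \<mu>1) = 1 / \<mu>0\<close>, and at the critical point the two families of
  sums agree up to constant factors, as do walk lengths and graph distances.
\<close>

section \<open>Nonnegative infinite sums\<close>

text \<open>The connective constant is a limit required at every single vertex, so existence of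
  these limits comes before everything else; its delicate half is a lower bound for the walk count
  at a prescribed vertex. The bridge between the two graphs is an equivalence for every
  \<open>x > 0\<close> and every real \<open>y\<close>: the series \<open>Y\<close> of
  \<open>G1\<close> at \<open>x\<close> is finite iff that of \<open>G0\<close> at
  \<open>g x\<close> is. With \<open>y = 0\<close> it is used on both sides of
  \<open>1 / \<mu>1\<close>, where continuity of the polynomial \<open>g\<close> locates the
  critical point; there it is used again with arbitrary \<open>y\<close> and gives
  \<open>\<gamma>\<close>. The power of the length does no harm, since a gadget path visits between
  1 and \<open>card Gv\<close> vertices. For \<open>\<eta>\<close> every constant has to be
  independent of the automorphism. The transfer runs from \<open>G1\<close> to \<open>G0\<close>
  because automorphisms of \<open>G0\<close> lift, while automorphisms of \<open>G1\<close> are not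
  assumed to respect the gadgets.\<close>

lemma infsum_ennreal_le:
  fixes f :: "'a \<Rightarrow> ennreal"
  assumes "\<And>F. finite F \<Longrightarrow> F \<subseteq> A \<Longrightarrow> sum f F \<le> b"
  shows "infsum f A \<le> b"
  using assms by (subst nonneg_infsum_complete) (auto intro!: SUP_least)

lemma sum_le_infsum_ennreal:
  fixes f :: "'a \<Rightarrow> ennreal"
  assumes "finite F" "F \<subseteq> A"
  shows "sum f F \<le> infsum f A"
  using assms by (subst nonneg_infsum_complete) (auto intro!: SUP_upper)

lemma infsum_ennreal_mono_set:
  fixes f :: "'a \<Rightarrow> ennreal"
  assumes "A \<subseteq> B"
  shows "infsum f A \<le> infsum f B"
  using assms by (intro infsum_ennreal_le sum_le_infsum_ennreal) auto

lemma infsum_ennreal_cmult: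
  fixes f :: "'a \<Rightarrow> ennreal"
  shows "infsum (\<lambda>x. c * f x) A = c * infsum f A"
  by (subst (1 2) nonneg_infsum_complete)
     (auto simp: SUP_mult_left_ennreal sum_distrib_left)

lemma infsum_ennreal_Un_le:
  fixes f :: "'a \<Rightarrow> ennreal"
  shows "infsum f (A \<union> B) \<le> infsum f A + infsum f B"
proof (rule infsum_ennreal_le)
  fix F assume F: "finite F" "F \<subseteq> A \<union> B"
  have "sum f F \<le> sum f (F \<inter> A) + sum f (F - A)"
    using F by (subst sum.union_disjoint[symmetric]) (auto intro!: sum_mono2)
  also have "\<dots> \<le> infsum f A + infsum f B"
    using F by (intro add_mono sum_le_infsum_ennreal) auto
  finally show "sum f F \<le> infsum f A + infsum f B" .
qed

text \<open>Tool for maps that simplify a walk (collapsing gadgets, recording the length): grouping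
  a finite partial sum by the image leaves only finite pieces of fibres to bound.\<close>

lemma infsum_ennreal_fibres_le:
  fixes f :: "'a \<Rightarrow> ennreal" and g :: "'b \<Rightarrow> ennreal"
  assumes h: "h ` A \<subseteq> B"
    and fib: "\<And>b F. b \<in> B \<Longrightarrow> finite F \<Longrightarrow> F \<subseteq> {a\<in>A. h a = b} \<Longrightarrow> sum f F \<le> g b"
  shows "infsum f A \<le> infsum g B"
proof (rule infsum_ennreal_le)
  fix F assume F: "finite F" "F \<subseteq> A"
  have "sum f F = (\<Sum>b\<in>h ` F. sum f {a\<in>F. h a = b})"
    using F by (simp add: sum.image_gen)
  also have "\<dots> \<le> (\<Sum>b\<in>h ` F. g b)"
    using F h by (intro sum_mono fib) auto
  also have "\<dots> \<le> infsum g B"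
    using F h by (intro sum_le_infsum_ennreal) auto
  finally show "sum f F \<le> infsum g B" .
qed

lemma infsum_ennreal_fibres_card_le:
  fixes f :: "'a \<Rightarrow> ennreal" and g :: "'b \<Rightarrow> ennreal"
  assumes h: "h ` A \<subseteq> B"
    and fib: "\<And>b. b \<in> B \<Longrightarrow> finite {a\<in>A. h a = b} \<and> card {a\<in>A. h a = b} \<le> K"
    and le: "\<And>a. a \<in> A \<Longrightarrow> f a \<le> c * g (h a)"
  shows "infsum f A \<le> of_nat K * c * infsum g B"
proof -
  have "infsum f A \<le> infsum (\<lambda>b. (of_nat K * c) * g b) B"
  proof (rule infsum_ennreal_fibres_le[OF h])
    fix b F assume b: "b \<in> B" "finite F" "F \<subseteq> {a\<in>A. h a = b}"
    have "sum f F \<le> (\<Sum>a\<in>F. c * g b)"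
      using b le by (intro sum_mono) auto
    also have "\<dots> = of_nat (card F) * (c * g b)" by simp
    also have "card F \<le> K"
      using b fib[OF b(1)] by (meson card_mono order_trans)
    then have "of_nat (card F) * (c * g b) \<le> of_nat K * (c * g b)"
      by (intro mult_right_mono) auto
    finally show "sum f F \<le> of_nat K * c * g b" by (simp add: mult.assoc)
  qed
  then show ?thesis by (simp add: infsum_ennreal_cmult)
qed

text \<open>Opposite direction to the fibre bounds: each \<open>b\<close> is charged to its own
  finite family \<open>L b\<close>, and disjointness prevents double counting.\<close>

lemma infsum_ennreal_ge_disjoint:
  fixes f :: "'a \<Rightarrow> ennreal" and g :: "'b \<Rightarrow> ennreal"
  assumes L: "\<And>b. b \<in> B \<Longrightarrow> finite (L b) \<and> L b \<subseteq> A"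
    and dis: "\<And>b b'. b \<in> B \<Longrightarrow> b' \<in> B \<Longrightarrow> b \<noteq> b' \<Longrightarrow> L b \<inter> L b' = {}"
    and le: "\<And>b. b \<in> B \<Longrightarrow> g b \<le> sum f (L b)"
  shows "infsum g B \<le> infsum f A"
proof (rule infsum_ennreal_le)
  fix F assume F: "finite F" "F \<subseteq> B"
  have "sum g F \<le> (\<Sum>b\<in>F. sum f (L b))"
    using F le by (intro sum_mono) auto
  also have "\<dots> = sum f (\<Union>b\<in>F. L b)"
    using F L dis by (subst sum.UNION_disjoint) (auto simp: subset_iff)
  also have "\<dots> \<le> infsum f A"
    using F L by (intro sum_le_infsum_ennreal) auto
  finally show "sum g F \<le> infsum f A" .
qed

section \<open>Existence of the connective constant\<close>

definition saws :: "('v \<Rightarrow> 'v \<Rightarrow> bool) \<Rightarrow> 'v \<Rightarrow> nat \<Rightarrow> 'v list set" where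
  "saws E v n = {p. length p = Suc n \<and> hd p = v \<and> distinct p \<and> successively E p}"

lemma saw_count_eq: "saw_count E v n = card (saws E v n)"
  by (simp add: saw_count_def saws_def)

text \<open>Loop erasure: a step back onto the path built so far cuts the path at the vertex that is
  revisited.\<close>

lemma rtrancl_imp_saw:
  assumes "(u, v) \<in> {(a, b). E a b}\<^sup>*"
  shows "\<exists>n. \<exists>p\<in>saws E u n. last p = v"
  using assms
proof (induction rule: rtrancl_induct)
  case base
  have "[u] \<in> saws E u 0" by (simp add: saws_def)
  then show ?case by force
next
  case (step y z)
  then obtain n p where p: "p \<in> saws E u n" "last p = y" by blast
  show ?case
  proof (cases "z \<in> set p")
    case False
    then have "p @ [z] \<in> saws E u (Suc n)"
      using p step(2) by (auto simp: saws_def successively_append_iff hd_append)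
    then show ?thesis by force
  next
    case True
    then obtain a b where ab: "p = a @ z # b" by (meson split_list)
    have "a @ [z] \<in> saws E u (length a)"
      using p ab by (cases a) (auto simp: saws_def successively_append_iff successively_Cons hd_append)
    then show ?thesis by force
  qed
qed

text \<open>The factor \<open>2 * m + 1\<close> will count the terms of a convolution; its
  \<open>m\<close>-th root disappears in the limit.\<close>

lemma root_linear_tendsto: "K > 0 \<Longrightarrow> (\<lambda>m. root m (K * real (2 * m + 1))) \<longlonglongrightarrow> 1"
proof -
  assume K: "K > 0"
  have up: "(\<lambda>m. root m (3 * K) * root m (real m)) \<longlonglongrightarrow> 1 * 1"
    using K by (intro tendsto_mult LIMSEQ_root_const LIMSEQ_root) auto
  have lo: "(\<lambda>m. root m K) \<longlonglongrightarrow> 1" using K by (intro LIMSEQ_root_const)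
  show ?thesis
  proof (rule tendsto_sandwich[OF _ _ lo up[simplified]])
    show "\<forall>\<^sub>F m in sequentially. root m K \<le> root m (K * real (2 * m + 1))"
      using eventually_gt_at_top[of 0] by eventually_elim (use K in \<open>auto intro!: real_root_le_mono\<close>)
    show "\<forall>\<^sub>F m in sequentially. root m (K * real (2 * m + 1)) \<le> root m (3 * K) * root m (real m)"
      using eventually_gt_at_top[of 0]
    proof eventually_elim
      case (elim m)
      have "K * real (2 * m + 1) \<le> K * (3 * real m)" using K elim by (intro mult_left_mono) auto
      then show ?case using elim by (auto simp flip: real_root_mult simp: ac_simps intro!: real_root_le_mono)
    qed
  qed
qed

section \<open>Walk counts in a locally finite quasi-transitive graph\<close>

locale qt_graph =
  fixes V :: "'v set" and E :: "'v \<Rightarrow> 'v \<Rightarrow> bool" and W :: "'v set"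
  assumes simple: "simple_graph V E" and inf: "infinite V" and conn: "connected_graph V E"
    and dom: "fund_domain V E W" and locfin: "\<And>v. v \<in> V \<Longrightarrow> finite {u. E v u}"
begin

lemma E_V: "E u v \<Longrightarrow> u \<in> V" "E u v \<Longrightarrow> v \<in> V" and E_sym: "E u v \<Longrightarrow> E v u"
  and E_irrefl: "\<not> E u u"
  using simple by (auto simp: simple_graph_def)

lemma W_fin: "finite W" and W_V: "W \<subseteq> V"
  using dom by (auto simp: fund_domain_def)

lemma W_ne: "W \<noteq> {}"
  using dom inf by (auto simp: fund_domain_def)

abbreviation c :: "'v \<Rightarrow> nat \<Rightarrow> nat" where "c v n \<equiv> saw_count E v n"

lemma saws_V: "p \<in> saws E v n \<Longrightarrow> v \<in> V \<Longrightarrow> set p \<subseteq> V"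
proof (induction n arbitrary: p v)
  case 0
  then show ?case by (auto simp: saws_def length_Suc_conv)
next
  case (Suc n)
  then obtain w q where p: "p = v # w # q" by (auto simp: saws_def length_Suc_conv)
  then have "w # q \<in> saws E w n" "w \<in> V" using Suc.prems E_V by (auto simp: saws_def)
  then show ?case using Suc.IH[of "w # q" w] Suc.prems p by auto
qed

lemma finite_saws: "v \<in> V \<Longrightarrow> finite (saws E v n)"
proof (induction n arbitrary: v)
  case 0
  have "saws E v 0 \<subseteq> {[v]}" by (auto simp: saws_def length_Suc_conv)
  then show ?case by (rule finite_subset) auto
next
  case (Suc n)
  have "saws E v (Suc n) \<subseteq> (\<Union>u\<in>{u. E v u}. Cons v ` saws E u n)"
  proof
    fix p assume "p \<in> saws E v (Suc n)"
    then obtain w q where p: "p = v # w # q" "E v w" "w # q \<in> saws E w n"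
      by (auto simp: saws_def length_Suc_conv)
    then show "p \<in> (\<Union>u\<in>{u. E v u}. Cons v ` saws E u n)" by auto
  qed
  moreover have "finite (\<Union>u\<in>{u. E v u}. Cons v ` saws E u n)"
    using Suc locfin E_V by auto
  ultimately show ?case by (rule finite_subset)
qed

lemma saws_take: "p \<in> saws E v n \<Longrightarrow> m \<le> n \<Longrightarrow> take (Suc m) p \<in> saws E v m"
  using successively_append_iff[of E "take (Suc m) p" "drop (Suc m) p"]
  by (auto simp: saws_def)

lemma saws_drop: "p \<in> saws E v n \<Longrightarrow> m \<le> n \<Longrightarrow> drop m p \<in> saws E (p ! m) (n - m)"
  using successively_append_iff[of E "take m p" "drop m p"]
  by (auto simp: saws_def hd_drop_conv_nth)

text \<open>If no walk had \<open>n\<close> steps, every vertex would be the end of one of the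
  finitely many shorter self-avoiding walks from \<open>v\<close>, and \<open>V\<close> would be
  finite.\<close>

lemma c_pos: assumes v: "v \<in> V" shows "c v n \<ge> 1"
proof (rule ccontr)
  assume "\<not> c v n \<ge> 1"
  then have e: "saws E v n = {}" using finite_saws[OF v] by (simp add: saw_count_eq not_le card_eq_0_iff)
  have "V \<subseteq> (\<Union>k<n. last ` saws E v k)"
  proof
    fix u assume "u \<in> V"
    then obtain k p where p: "p \<in> saws E v k" "last p = u"
      using conn v rtrancl_imp_saw[of v u E] by (auto simp: connected_graph_def)
    have "k < n"
      using saws_take[OF p(1), of n] e by (cases "k < n") auto
    then show "u \<in> (\<Union>k<n. last ` saws E v k)" using p by auto
  qed
  moreover have "finite (\<Union>k<n. last ` saws E v k)" using finite_saws[OF v] by auto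
  ultimately show False using inf finite_subset by blast
qed

text \<open>The maximum over the finite domain is the maximum over all vertices, because
  automorphisms carry walks into walks from \<open>W\<close>. Being uniform in the start vertex
  makes this sequence submultiplicative.\<close>

definition s :: "nat \<Rightarrow> nat" where "s n = Max ((\<lambda>w. c w n) ` W)"

lemma saws_aut:
  assumes f: "aut V E f" and v: "v \<in> V"
  shows "c v n \<le> c (f v) n"
proof -
  have fV: "f v \<in> V" using f v by (auto simp: aut_def bij_betw_def)
  have inj: "inj_on f V" using f by (auto simp: aut_def bij_betw_def)
  have "inj_on (map f) (saws E v n)"
    using saws_V v by (intro inj_on_mapI inj_on_subset[OF inj]) blast
  moreover have "map f ` saws E v n \<subseteq> saws E (f v) n"
  proof
    fix q assume "q \<in> map f ` saws E v n"
    then obtain p where p: "p \<in> saws E v n" "q = map f p" by auto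
    have pV: "set p \<subseteq> V" using saws_V p v by blast
    have "successively (\<lambda>x y. E (f x) (f y)) p"
      by (rule successively_mono[of E]) (use p pV f in \<open>auto simp: saws_def aut_def\<close>)
    then show "q \<in> saws E (f v) n"
      using p pV inj inj_on_subset
      by (auto simp: saws_def distinct_map successively_map) (metis hd_map length_0_conv nat.simps(3))
  qed
  ultimately show ?thesis
    unfolding saw_count_eq by (intro card_inj_on_le finite_saws fV)
qed

lemma c_le_s: assumes "v \<in> V" shows "c v n \<le> s n"
proof -
  obtain f where f: "aut V E f" "f v \<in> W" using dom assms by (auto simp: fund_domain_def)
  have "c v n \<le> c (f v) n" by (rule saws_aut) (use f assms in auto)
  also have "\<dots> \<le> s n" unfolding s_def using f W_fin by (intro Max_ge) auto
  finally show ?thesis .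
qed

lemma s_attained: obtains u where "u \<in> W" "c u n = s n"
proof -
  have "s n \<in> (\<lambda>w. c w n) ` W" unfolding s_def using W_fin W_ne by (intro Max_in) auto
  then show ?thesis using that by auto
qed

lemma s_pos: "s n \<ge> 1"
  using s_attained c_pos W_V by (metis subsetD)

text \<open>Cutting a walk after \<open>m\<close> steps is injective. The second piece starts at an
  uncontrolled vertex, hence the factor \<open>s n\<close>.\<close>

lemma c_submult: assumes v: "v \<in> V" shows "c v (m + n) \<le> c v m * s n"
proof -
  let ?S = "Sigma (saws E v m) (\<lambda>p. saws E (last p) n)"
  have lV: "last p \<in> V" if "p \<in> saws E v m" for p
    using saws_V[OF that v] that last_in_set[of p] by (cases p) (auto simp: saws_def)
  have fin: "finite ?S" using lV finite_saws v by auto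
  let ?f = "\<lambda>p. (take (Suc m) p, drop m p)"
  have "inj_on ?f (saws E v (m + n))"
  proof (rule inj_onI)
    fix p q :: "'v list" assume *: "?f p = ?f q"
    then have "drop (Suc m) p = drop (Suc m) q" by (metis drop_Suc prod.inject tl_drop)
    with * show "p = q" by (metis append_take_drop_id prod.inject)
  qed
  moreover have "?f ` saws E v (m + n) \<subseteq> ?S"
  proof
    fix x assume "x \<in> ?f ` saws E v (m + n)"
    then obtain p where p: "p \<in> saws E v (m + n)" "x = ?f p" by auto
    have "last (take (Suc m) p) = p ! m"
      using p by (auto simp: saws_def take_Suc_conv_app_nth)
    then show "x \<in> ?S" using saws_take[OF p(1), of m] saws_drop[OF p(1), of m] p by auto
  qed
  ultimately have "card (saws E v (m + n)) \<le> card ?S" by (intro card_inj_on_le fin)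
  also have "\<dots> = (\<Sum>p\<in>saws E v m. c (last p) n)"
    using lV finite_saws v by (subst card_SigmaI) (auto simp: saw_count_eq)
  also have "\<dots> \<le> (\<Sum>p\<in>saws E v m. s n)" using lV by (intro sum_mono c_le_s) auto
  finally show ?thesis by (simp add: saw_count_eq)
qed

lemma s_submult: "s (m + n) \<le> s m * s n"
proof -
  obtain u where u: "u \<in> W" "c u (m + n) = s (m + n)" by (rule s_attained)
  have "u \<in> V" using u W_V by auto
  then have "c u (m + n) \<le> c u m * s n" "c u m \<le> s m" by (auto intro: c_submult c_le_s)
  then show ?thesis using u by (metis mult_le_mono1 order_trans)
qed

text \<open>Cut a walk from \<open>u\<close> at the first point of a path from \<open>v\<close> to \<open>u\<close> that lies on it:
  both pieces become self-avoiding walks from \<open>v\<close>.\<close>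

lemma c_change_start:
  assumes P: "P \<in> saws E v d" "last P = u" and v: "v \<in> V"
  shows "c u n \<le> (\<Sum>i\<le>d. \<Sum>k\<le>n. c v (i + k) * c v (i + (n - k)))"
proof -
  \<comment> \<open>Inverse of the cut: drop the \<open>i\<close> vertices of the common approach
    from both walks, reverse the first remainder, and glue at the shared vertex, which
    \<open>tl\<close> removes from the second.\<close>
  let ?g = "\<lambda>i (l1, l2). rev (drop i l1) @ tl (drop i l2)"
  let ?I = "{..d} \<times> {..n}"
  let ?B = "\<lambda>(i, k). ?g i ` (saws E v (i + k) \<times> saws E v (i + (n - k)))"
  have fin: "finite (?B ik)" for ik using finite_saws[OF v] by (cases ik) auto
  have sub: "saws E u n \<subseteq> (\<Union>ik\<in>?I. ?B ik)"
  proof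
    fix p assume p: "p \<in> saws E u n"
    have lP: "length P = Suc d" and lp: "length p = Suc n" using P p by (auto simp: saws_def)
    \<comment> \<open>\<open>P\<close> ends at \<open>u\<close>, where \<open>p\<close> starts, so
      \<open>P\<close> does meet \<open>p\<close>.\<close>
    have ex: "P ! d \<in> set p"
      using P p lP lp hd_in_set[of p] last_conv_nth[of P] by (force simp: saws_def)
    define i where "i = (LEAST i. P ! i \<in> set p)"
    have i: "P ! i \<in> set p" "i \<le> d" unfolding i_def using ex by (auto intro: LeastI Least_le)
    have imin: "P ! j \<notin> set p" if "j < i" for j using that not_less_Least unfolding i_def by blast
    obtain k where k: "k \<le> n" "p ! k = P ! i"
      using i(1) lp by (auto simp: in_set_conv_nth less_Suc_eq_le)
    have disj: "set (take i P) \<inter> set p = {}"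
      using imin by (fastforce simp: in_set_conv_nth[of _ "take i P"])
    have tP: "take (Suc i) P = take i P @ [P ! i]" using i lP by (simp add: take_Suc_conv_app_nth)
    have sP: "successively E (take i P @ [P ! i])" "distinct (take i P)" "take i P \<noteq> [] \<longrightarrow> hd (take i P) = v"
      and hP: "i = 0 \<longrightarrow> P ! i = v"
      using saws_take[OF P(1) i(2)] P(1) by (auto simp: tP saws_def hd_conv_nth)
    have tk: "take (Suc k) p = take k p @ [P ! i]" using k lp by (simp add: take_Suc_conv_app_nth)
    have dk: "drop k p = P ! i # drop (Suc k) p" using k lp by (metis Cons_nth_drop_Suc less_Suc_eq_le)
    have pE: "successively E p" "distinct p" using p by (auto simp: saws_def)
    have t1: "successively E (take (Suc k) p)" "successively E (drop k p)"
      using pE successively_append_iff[of E "take (Suc k) p" "drop (Suc k) p"]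
        successively_append_iff[of E "take k p" "drop k p"] by auto
    have t2: "successively E (rev (take (Suc k) p))"
      using t1(1) by (subst successively_rev) (rule successively_mono[of E], auto intro: E_sym)
    let ?l1 = "take i P @ rev (take (Suc k) p)" and ?l2 = "take i P @ drop k p"
    have ss: "set (take (Suc k) p) \<subseteq> set p" "set (drop k p) \<subseteq> set p"
      by (auto dest: in_set_takeD in_set_dropD)
    have join: "take i P = [] \<or> E (last (take i P)) (P ! i)"
      using sP(1) by (auto simp: successively_append_iff)
    have l1: "?l1 \<in> saws E v (i + k)"
    proof -
      have "hd ?l1 = v" using sP(3) hP lP by (cases "take i P = []") (auto simp: tk)
      moreover have "successively E ?l1"
        using sP(1) t2 join by (auto simp: successively_append_iff tk)
      moreover have "distinct ?l1" using sP(2) pE disj ss(1) by auto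
      ultimately show ?thesis using lP lp i k by (auto simp: saws_def)
    qed
    have l2: "?l2 \<in> saws E v (i + (n - k))"
    proof -
      have "hd ?l2 = v" using sP(3) hP lP by (cases "take i P = []") (auto simp: dk)
      moreover have "successively E ?l2"
        using sP(1) t1 join by (auto simp: successively_append_iff dk)
      moreover have "distinct ?l2" using sP(2) pE disj ss(2) by auto
      ultimately show ?thesis using lP lp i k by (auto simp: saws_def)
    qed
    have "length (take i P) = i" using lP i by simp
    then have "?g i (?l1, ?l2) = take (Suc k) p @ tl (drop k p)" by simp
    also have "\<dots> = p" by (simp only: dk list.sel append_take_drop_id)
    finally have "p \<in> ?B (i, k)"
      using l1 l2 by (auto intro!: image_eqI[where x = "(?l1, ?l2)"])
    then show "p \<in> (\<Union>ik\<in>?I. ?B ik)" using i k by blast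
  qed
  have "c u n \<le> card (\<Union>ik\<in>?I. ?B ik)"
    unfolding saw_count_eq using fin by (intro card_mono sub) auto
  also have "\<dots> \<le> (\<Sum>ik\<in>?I. card (?B ik))" by (intro card_UN_le) auto
  also have "\<dots> \<le> (\<Sum>(i,k)\<in>?I. c v (i + k) * c v (i + (n - k)))"
  proof (intro sum_mono)
    fix ik assume "ik \<in> ?I"
    obtain i k where "ik = (i,k)" by (cases ik)
    moreover have "card (?g i ` (saws E v (i + k) \<times> saws E v (i + (n - k))))
       \<le> card (saws E v (i + k) \<times> saws E v (i + (n - k)))"
      using finite_saws[OF v] by (intro card_image_le) auto
    ultimately show "card (?B ik) \<le> (case ik of (i,k) \<Rightarrow> c v (i + k) * c v (i + (n - k)))"
      by (simp add: card_cartesian_product saw_count_eq)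
  qed
  also have "\<dots> = (\<Sum>i\<le>d. \<Sum>k\<le>n. c v (i + k) * c v (i + (n - k)))"
    by (rule sum.cartesian_product[symmetric])
  finally show ?thesis .
qed

section \<open>Fekete bounds for the maximal count and the limit at each vertex\<close>

text \<open>The Fekete limit of the submultiplicative \<open>s\<close>, taken as an infimum: this
  yields the lower bound \<open>mu_power_le_s\<close> without any limit.\<close>

definition mu :: real where "mu = Inf ((\<lambda>n. root n (real (s n))) ` {1..})"

lemma root_s_ge_1: "n \<ge> 1 \<Longrightarrow> root n (real (s n)) \<ge> 1"
  using s_pos[of n] by simp

lemma mu_le_root: "n \<ge> 1 \<Longrightarrow> mu \<le> root n (real (s n))"
  unfolding mu_def by (intro cInf_lower bdd_belowI[of _ 1]) (auto intro: root_s_ge_1)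

lemma mu_ge_1: "mu \<ge> 1"
  unfolding mu_def by (intro cInf_greatest) (auto intro: root_s_ge_1)

lemma mu_power_le_s: "mu ^ n \<le> real (s n)"
proof (cases "n = 0")
  case True
  then show ?thesis using s_pos[of 0] by simp
next
  case False
  then have "mu ^ n \<le> root n (real (s n)) ^ n"
    using mu_le_root[of n] mu_ge_1 by (intro power_mono) auto
  then show ?thesis using False by simp
qed

text \<open>Upper half of Fekete's lemma: some \<open>m\<close> satisfies
  \<open>s m \<le> l ^ m\<close>, and blocks of \<open>m\<close> steps are split off until fewer
  than \<open>m\<close> remain.\<close>

lemma s_growth:
  assumes "mu < l"
  obtains C where "C > 0" "\<And>n. real (s n) \<le> C * l ^ n"
proof -
  have l1: "l > 0" using assms mu_ge_1 by simp
  obtain m where m: "m \<ge> 1" "root m (real (s m)) < l"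
    using assms unfolding mu_def by (subst (asm) cInf_less_iff) (auto intro!: bdd_belowI[of _ 1] root_s_ge_1)
  have sm: "real (s m) \<le> l ^ m"
  proof -
    have "root m (real (s m)) ^ m \<le> l ^ m" using m by (intro power_mono) auto
    then show ?thesis using m by simp
  qed
  \<comment> \<open>\<open>C\<close> dominates \<open>s r / l ^ r\<close> for each possible
    remainder \<open>r < m\<close>.\<close>
  define C where "C = (\<Sum>r<m. real (s r) / l ^ r)"
  have C: "real (s r) \<le> C * l ^ r" if "r < m" for r
  proof -
    have "real (s r) / l ^ r \<le> C" unfolding C_def using l1 that by (intro member_le_sum) auto
    then show ?thesis using l1 by (simp add: field_simps)
  qed
  have "C > 0"
    using C[of 0] s_pos[of 0] m by auto
  moreover have "real (s n) \<le> C * l ^ n" for n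
  proof (induction n rule: less_induct)
    case (less n)
    show ?case
    proof (cases "n < m")
      case True then show ?thesis by (rule C)
    next
      case False
      have "real (s n) \<le> real (s m) * real (s (n - m))"
        using s_submult[of m "n - m"] False by (simp flip: of_nat_mult)
      also have "\<dots> \<le> l ^ m * (C * l ^ (n - m))"
        using False m l1 by (intro mult_mono sm less) auto
      also have "\<dots> = C * l ^ n" using False by (simp add: power_add[symmetric])
      finally show ?thesis .
    qed
  qed
  ultimately show ?thesis using that by blast
qed

text \<open>Compares the best start vertex in \<open>W\<close>, which may vary with
  \<open>n\<close>, with the fixed \<open>v\<close>. A single \<open>B\<close> suffices because
  \<open>W\<close> is finite and each of its vertices has a connecting path from \<open>v\<close>
  that does not depend on \<open>n\<close>.\<close>

lemma s_le_convolution: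
  assumes v: "v \<in> V"
  obtains B where "B > 0" "\<And>n. s n \<le> B * (\<Sum>k\<le>n. c v k * c v (n - k))"
proof -
  have "\<forall>u\<in>W. \<exists>d. \<exists>P\<in>saws E v d. last P = u"
    using conn v W_V rtrancl_imp_saw[of v _ E] by (auto simp: connected_graph_def)
  then obtain d where d: "\<And>u. u \<in> W \<Longrightarrow> \<exists>P\<in>saws E v (d u). last P = u" by metis
  \<comment> \<open>Each of the two walks from \<open>v\<close> carries \<open>i\<close> extra
    steps; submultiplicativity removes them at the price of one factor \<open>s i\<close> per
    walk.\<close>
  define B where "B = (\<Sum>u\<in>W. \<Sum>i\<le>d u. s i * s i)"
  have le: "c u n \<le> B * (\<Sum>k\<le>n. c v k * c v (n - k))" if u: "u \<in> W" for u n
  proof -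
    obtain P where P: "P \<in> saws E v (d u)" "last P = u" using d u by blast
    have "c u n \<le> (\<Sum>i\<le>d u. \<Sum>k\<le>n. c v (i + k) * c v (i + (n - k)))"
      by (rule c_change_start[OF P v])
    also have "\<dots> \<le> (\<Sum>i\<le>d u. \<Sum>k\<le>n. (s i * s i) * (c v k * c v (n - k)))"
    proof (intro sum_mono)
      fix i k
      have "c v (k + i) * c v ((n - k) + i) \<le> (c v k * s i) * (c v (n - k) * s i)"
        by (intro mult_le_mono c_submult v)
      then show "c v (i + k) * c v (i + (n - k)) \<le> (s i * s i) * (c v k * c v (n - k))"
        by (simp add: ac_simps)
    qed
    also have "\<dots> = (\<Sum>i\<le>d u. s i * s i) * (\<Sum>k\<le>n. c v k * c v (n - k))"
      by (simp add: sum_product)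
    also have "\<dots> \<le> B * (\<Sum>k\<le>n. c v k * c v (n - k))"
      unfolding B_def using u W_fin by (intro mult_le_mono1 member_le_sum) auto
    finally show ?thesis .
  qed
  have bd: "s n \<le> B * (\<Sum>k\<le>n. c v k * c v (n - k))" for n
    by (rule s_attained[of n]) (use le in metis)
  moreover have "B > 0" using bd[of 0] s_pos[of 0] by (cases B) auto
  ultimately show ?thesis using that by blast
qed

text \<open>In each term of the convolution at \<open>2 * m\<close>, one of the two indices is at
  least \<open>m\<close>. That factor is cut after \<open>m\<close> steps, producing
  \<open>c v m\<close>; all other pieces, of total length \<open>m\<close>, are bounded by powers of
  \<open>l\<close>. Together with \<open>mu ^ (2 * m) \<le> s (2 * m)\<close> this bounds
  \<open>c v m\<close> from below by roughly \<open>(mu * mu / l) ^ m\<close>.\<close>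

lemma c_lower:
  assumes v: "v \<in> V" and l: "mu < l"
  obtains K where "K > 0" "\<And>m. mu ^ (2 * m) \<le> K * real (2 * m + 1) * l ^ m * real (c v m)"
proof -
  have l0: "l > 0" using mu_ge_1 l by simp
  obtain C where C: "C > 0" "\<And>n. real (s n) \<le> C * l ^ n" using s_growth[OF l] by blast
  obtain B where B: "B > 0" "\<And>n. s n \<le> B * (\<Sum>k\<le>n. c v k * c v (n - k))"
    using s_le_convolution[OF v] by blast
  have half: "real (c v k) * real (c v (2 * m - k)) \<le> C * C * l ^ m * real (c v m)"
    if k: "m \<le> k" "k \<le> 2 * m" for k m
  proof -
    have "real (c v k) \<le> real (c v m) * real (s (k - m))"
      using c_submult[OF v, of m "k - m"] k by (simp flip: of_nat_mult)
    also have "\<dots> \<le> real (c v m) * (C * l ^ (k - m))" by (intro mult_left_mono C) auto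
    finally have 1: "real (c v k) \<le> real (c v m) * (C * l ^ (k - m))" .
    have 2: "real (c v (2 * m - k)) \<le> C * l ^ (2 * m - k)"
      using c_le_s[OF v, of "2 * m - k"] C(2)[of "2 * m - k"] by linarith
    have "real (c v k) * real (c v (2 * m - k)) \<le> (real (c v m) * (C * l ^ (k - m))) * (C * l ^ (2 * m - k))"
      using 1 2 C l0 by (intro mult_mono) auto
    also have "\<dots> = C * C * (l ^ (k - m) * l ^ (2 * m - k)) * real (c v m)" by simp
    also have "l ^ (k - m) * l ^ (2 * m - k) = l ^ m"
      using k by (simp flip: power_add)
    finally show ?thesis by simp
  qed
  have all: "real (c v k) * real (c v (2 * m - k)) \<le> C * C * l ^ m * real (c v m)"
    if k: "k \<le> 2 * m" for k m
  proof (cases "m \<le> k")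
    case True then show ?thesis using half k by blast
  next
    case False
    then show ?thesis using half[of m "2 * m - k"] k by (simp add: mult.commute)
  qed
  have "mu ^ (2 * m) \<le> (real B * C * C) * real (2 * m + 1) * l ^ m * real (c v m)" for m
  proof -
    have "mu ^ (2 * m) \<le> real (s (2 * m))" by (rule mu_power_le_s)
    also have "\<dots> \<le> real B * (\<Sum>k\<le>2 * m. real (c v k) * real (c v (2 * m - k)))"
      using B(2)[of "2 * m"] by (simp flip: of_nat_mult of_nat_sum)
    also have "\<dots> \<le> real B * (\<Sum>k\<le>2 * m. C * C * l ^ m * real (c v m))"
      by (intro mult_left_mono sum_mono all) auto
    also have "\<dots> = (real B * C * C) * real (2 * m + 1) * l ^ m * real (c v m)" by simp
    finally show ?thesis .
  qed
  moreover have "real B * C * C > 0" using B C by simp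
  ultimately show ?thesis using that by blast
qed

theorem root_c_tendsto:
  assumes v: "v \<in> V"
  shows "(\<lambda>n. root n (real (c v n))) \<longlonglongrightarrow> mu"
proof (rule order_tendstoI)
  fix a assume a: "a > mu"
  obtain l where l: "mu < l" "l < a" using a dense by blast
  have l0: "l > 0" using mu_ge_1 l by simp
  obtain C where C: "C > 0" "\<And>n. real (s n) \<le> C * l ^ n" using s_growth[OF l(1)] by blast
  have "(\<lambda>n. root n C * l) \<longlonglongrightarrow> 1 * l" using C by (intro tendsto_intros LIMSEQ_root_const)
  then have "\<forall>\<^sub>F n in sequentially. root n C * l < a" using l by (intro order_tendstoD) auto
  then show "\<forall>\<^sub>F n in sequentially. root n (real (c v n)) < a"
    using eventually_gt_at_top[of 0]
  proof eventually_elim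
    case (elim n)
    have "real (c v n) \<le> C * l ^ n" using c_le_s[OF v, of n] C(2)[of n] by linarith
    then have "root n (real (c v n)) \<le> root n (C * l ^ n)" using elim by simp
    also have "\<dots> = root n C * l" using elim l0 by (simp add: real_root_mult real_root_power_cancel)
    finally show ?case using elim by simp
  qed
next
  fix a assume a: "a < mu"
  \<comment> \<open>The lower bound tends to \<open>mu * mu / l\<close>, so \<open>l > mu\<close>
    must satisfy \<open>a * l < mu * mu\<close>; for positive \<open>a\<close> the midpoint of
    \<open>mu\<close> and \<open>mu * mu / a\<close> does.\<close>
  define l where "l = (if a \<le> 0 then mu + 1 else (mu + mu * mu / a) / 2)"
  have l: "mu < l" "a * l < mu * mu"
  proof -
    have "mu < l \<and> a * l < mu * mu"
    proof (cases "a \<le> 0")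
      case True
      have "a * (mu + 1) \<le> 0" using True mu_ge_1 by (intro mult_nonpos_nonneg) auto
      moreover have "mu * mu > 0" using mu_ge_1 by simp
      ultimately show ?thesis using True by (simp add: l_def)
    next
      case False
      then have "a * mu < mu * mu" using a mu_ge_1 by simp
      then show ?thesis using False by (simp add: l_def field_simps)
    qed
    then show "mu < l" "a * l < mu * mu" by auto
  qed
  have l0: "l > 0" using mu_ge_1 l by simp
  obtain K where K: "K > 0" "\<And>m. mu ^ (2 * m) \<le> K * real (2 * m + 1) * l ^ m * real (c v m)"
    using c_lower[OF v l(1)] by blast
  have "(\<lambda>m. mu * mu / (root m (K * real (2 * m + 1)) * l)) \<longlonglongrightarrow> mu * mu / (1 * l)"
    using l0 by (intro tendsto_intros root_linear_tendsto K) auto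
  moreover have "a < mu * mu / (1 * l)" using l l0 by (simp add: field_simps)
  ultimately have "\<forall>\<^sub>F m in sequentially. a < mu * mu / (root m (K * real (2 * m + 1)) * l)"
    by (rule order_tendstoD)
  then show "\<forall>\<^sub>F n in sequentially. a < root n (real (c v n))"
    using eventually_gt_at_top[of 0]
  proof eventually_elim
    case (elim m)
    have "root m (mu ^ (2 * m)) \<le> root m (K * real (2 * m + 1) * l ^ m * real (c v m))"
      using elim K(2)[of m] by (intro real_root_le_mono) auto
    also have "\<dots> = root m (K * real (2 * m + 1)) * l * root m (real (c v m))"
      using elim l0 by (simp only: real_root_mult) (simp add: real_root_power_cancel)
    also have "root m (mu ^ (2 * m)) = mu * mu"
    proof -
      have "mu ^ (2 * m) = (mu * mu) ^ m" by (simp add: power_mult power2_eq_square)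
      then show ?thesis using elim mu_ge_1 real_root_power_cancel[of m "mu * mu"] by simp
    qed
    finally have "mu * mu / (root m (K * real (2 * m + 1)) * l) \<le> root m (real (c v m))"
      using elim K l0 by (simp add: divide_le_eq mult.commute mult.left_commute)
    then show ?case using elim by simp
  qed
qed

lemma conn_const_eq: "conn_const V E = mu"
proof -
  obtain v where v: "v \<in> V" using inf by (metis finite.emptyI ex_in_conv)
  show ?thesis unfolding conn_const_def
  proof (rule the_equality)
    show "\<forall>v\<in>V. (\<lambda>n. root n (real (c v n))) \<longlonglongrightarrow> mu" using root_c_tendsto by blast
    show "m = mu" if "\<forall>v\<in>V. (\<lambda>n. root n (real (c v n))) \<longlonglongrightarrow> m" for m
      using that v root_c_tendsto LIMSEQ_unique by blast
  qed
qed

end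

section \<open>Mid-edge walks and the radius of convergence\<close>

lemma edge_set_D:
  assumes "simple_graph V E" "e \<in> edge_set E" "v \<in> e" "w \<in> e" "v \<noteq> w"
  shows "e = {v, w}" "E v w"
  using assms by (auto simp: edge_set_def simple_graph_def)

lemma edge_setI: "E u v \<Longrightarrow> {u, v} \<in> edge_set E"
  by (auto simp: edge_set_def)

lemma edge_set_obtain:
  assumes "simple_graph V E" "e \<in> edge_set E" "v \<in> e"
  obtains w where "e = {v, w}" "E v w" "v \<noteq> w"
  using assms by (fastforce simp: edge_set_def simple_graph_def)

section \<open>Mid-edge walks as vertex lists with the mid-edges interleaved\<close>

fun ilv :: "'v list \<Rightarrow> 'v pos list" where
  "ilv [] = []"
| "ilv [v] = [Vx v]"
| "ilv (u # v # vs) = Vx u # Md {u, v} # ilv (v # vs)"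

definition vxs :: "'v pos list \<Rightarrow> 'v list" where
  "vxs p = concat (map (\<lambda>x. case x of Vx v \<Rightarrow> [v] | Md e \<Rightarrow> []) p)"

lemma vxs_simps [simp]:
  "vxs [] = []" "vxs (Vx v # p) = v # vxs p" "vxs (Md e # p) = vxs p" "vxs (p @ q) = vxs p @ vxs q"
  by (auto simp: vxs_def)

lemma wlen_simps [simp]:
  "wlen [] = 0" "wlen (Vx v # p) = Suc (wlen p)" "wlen (Md e # p) = wlen p"
  "wlen (p @ q) = wlen p + wlen q"
  by (auto simp: wlen_def)

lemma length_vxs: "length (vxs p) = wlen p"
proof (induction p)
  case (Cons a p) then show ?case by (cases a) auto
qed simp

lemma vxs_ilv [simp]: "vxs (ilv vs) = vs"
  by (induction vs rule: ilv.induct) auto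

lemma wlen_ilv [simp]: "wlen (ilv vs) = length vs"
  by (metis length_vxs vxs_ilv)

lemma ilv_inj: "ilv vs = ilv ws \<longleftrightarrow> vs = ws"
  by (metis vxs_ilv)

lemma ilv_Nil_iff [simp]: "ilv vs = [] \<longleftrightarrow> vs = []"
  by (metis vxs_ilv vxs_simps(1) ilv.simps(1))

lemma hd_ilv [simp]: "vs \<noteq> [] \<Longrightarrow> hd (ilv vs) = Vx (hd vs)"
  by (induction vs rule: ilv.induct) auto

lemma last_ilv [simp]: "vs \<noteq> [] \<Longrightarrow> last (ilv vs) = Vx (last vs)"
  by (induction vs rule: ilv.induct) auto

lemma Vx_in_ilv [simp]: "Vx v \<in> set (ilv vs) \<longleftrightarrow> v \<in> set vs"
  by (induction vs rule: ilv.induct) auto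

lemma Md_in_ilv: "Md e \<in> set (ilv vs) \<Longrightarrow> e \<subseteq> set vs \<and> e \<noteq> {}"
  by (induction vs rule: ilv.induct) auto

lemma distinct_ilv: "distinct vs \<Longrightarrow> distinct (ilv vs)"
  by (induction vs rule: ilv.induct) (auto dest!: Md_in_ilv)

lemma successively_ilv: "successively E vs \<Longrightarrow> successively (step_ok E) (ilv vs)"
  by (induction vs rule: ilv.induct) (auto simp: successively_Cons intro: edge_setI)

text \<open>Normal form. As no vertex is repeated, a mid-edge between two vertices of the walk is
  the edge joining them, so the vertex list determines everything except a possible final half-step
  \<open>t\<close>.\<close>

lemma mid_walk_from_vertex:
  assumes G: "simple_graph V E"
    and "successively (step_ok E) p" "distinct p" "p \<noteq> []" "hd p = Vx v"
  obtains vs t where "vs \<noteq> []" "hd vs = v" "distinct vs" "successively E vs" "p = ilv vs @ t"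
    "t = [] \<or> (\<exists>f. t = [Md f] \<and> f \<in> edge_set E \<and> last vs \<in> f)"
proof -
  have "\<exists>vs t. vs \<noteq> [] \<and> hd vs = v \<and> distinct vs \<and> successively E vs \<and> p = ilv vs @ t \<and>
    (t = [] \<or> (\<exists>f. t = [Md f] \<and> f \<in> edge_set E \<and> last vs \<in> f))"
    using assms(2-)
  proof (induction "length p" arbitrary: p v rule: less_induct)
    case less
    then obtain q where p: "p = Vx v # q" by (cases p) auto
    show ?case
    proof (cases q)
      case Nil
      then show ?thesis using p by (intro exI[of _ "[v]"] exI[of _ "[]"]) auto
    next
      case (Cons x r)
      then obtain f where x: "x = Md f" using less p by (cases x) auto
      have f: "f \<in> edge_set E" "v \<in> f" using less p Cons x by auto
      show ?thesis
      proof (cases r)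
        case Nil
        then show ?thesis using p Cons x f by (intro exI[of _ "[v]"] exI[of _ "[Md f]"]) auto
      next
        case (Cons y r')
        then obtain w where y: "y = Vx w" using less p \<open>q = x # r\<close> x by (cases y) auto
        have w: "w \<in> f" "w \<noteq> v" using less p \<open>q = x # r\<close> x Cons y by auto
        have fe: "f = {v, w}" "E v w" using edge_set_D[OF G f(1,2) w(1)] w(2) by auto
        have r: "length r < length p" "successively (step_ok E) r" "distinct r" "r \<noteq> []" "hd r = Vx w"
          using less.prems p \<open>q = x # r\<close> x Cons y by auto
        obtain vs t where vs: "vs \<noteq> []" "hd vs = w" "distinct vs" "successively E vs" "r = ilv vs @ t"
          "t = [] \<or> (\<exists>f. t = [Md f] \<and> f \<in> edge_set E \<and> last vs \<in> f)"
          using less(1)[OF r] by blast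
        have "v \<notin> set vs" using less.prems(2) p \<open>q = x # r\<close> vs(5) by auto
        moreover have "p = ilv (v # vs) @ t"
          using vs p \<open>q = x # r\<close> x fe by (cases vs) auto
        ultimately show ?thesis using vs fe
          by (intro exI[of _ "v # vs"] exI[of _ t]) (auto simp: successively_Cons)
      qed
    qed
  qed
  then show ?thesis using that by blast
qed

lemma Yfun_0: "Yfun E W x 0 = (\<Sum>\<^sub>\<infinity>p\<in>Sig E W. ennreal (x ^ wlen p))"
  unfolding Yfun_def by (intro infsum_cong) simp

section \<open>The series \<open>Y\<close> with \<open>y = 0\<close> has radius of convergence
  \<open>1 / mu\<close>\<close>

context qt_graph begin

lemma finite_inc_edges: "finite (inc_edges E W)"
proof -
  have "inc_edges E W \<subseteq> (\<Union>w\<in>W. (\<lambda>u. {w, u}) ` {u. E w u})"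
  proof
    fix e assume "e \<in> inc_edges E W"
    then obtain w where w: "e \<in> edge_set E" "w \<in> W" "w \<in> e" by (auto simp: inc_edges_def)
    then obtain u where "e = {w, u}" "E w u" using edge_set_obtain[OF simple] by metis
    then show "e \<in> (\<Union>w\<in>W. (\<lambda>u. {w, u}) ` {u. E w u})" using w by auto
  qed
  moreover have "finite \<dots>" using W_fin W_V locfin by auto
  ultimately show ?thesis by (rule finite_subset)
qed

lemma edge_V: "e \<in> edge_set E \<Longrightarrow> e \<subseteq> V"
  by (auto simp: edge_set_def dest: E_V)

lemma edge_finite: "e \<in> edge_set E \<Longrightarrow> finite e"
  by (auto simp: edge_set_def)

lemma card_nbrs: assumes "v \<in> V" shows "card {u. E v u} \<le> s 1"
proof -
  have "(\<lambda>u. [v, u]) ` {u. E v u} \<subseteq> saws E v 1" using E_irrefl by (auto simp: saws_def)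
  then have "card {u. E v u} \<le> card (saws E v 1)"
    using finite_saws[OF assms] by (intro card_inj_on_le[of "\<lambda>u. [v, u]"]) (auto simp: inj_on_def)
  then show ?thesis using c_le_s[OF assms, of 1] by (simp add: saw_count_eq)
qed

text \<open>By the normal form, a walk is given by its first mid-edge, an ordinary walk from an end
  of it, and one of at most \<open>s 1 + 1\<close> endings. Visiting \<open>n\<close> vertices means
  \<open>n - 1\<close> steps.\<close>

lemma Sig_count:
  obtains K where "\<And>n. finite {p \<in> Sig E W. wlen p = n}"
    "\<And>n. card {p \<in> Sig E W. wlen p = n} \<le> K * s (n - 1)"
proof -
  let ?X = "inc_edges E W" let ?U = "\<Union>?X"
  have U: "finite ?U" "?U \<subseteq> V" using finite_inc_edges edge_finite edge_V by (auto simp: inc_edges_def)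
  note finite_inc_edges [simp]
  let ?T = "\<lambda>v. insert [] ((\<lambda>u. [Md {v, u}]) ` {u. E v u})"
  have T: "finite (?T v)" "card (?T v) \<le> Suc (s 1)" if "v \<in> V" for v
  proof -
    show "finite (?T v)" using locfin that by auto
    have "card (?T v) \<le> Suc (card ((\<lambda>u. [Md {v, u}]) ` {u. E v u}))" by (simp add: card_insert_le_m1)
    also have "\<dots> \<le> Suc (card {u. E v u})" using locfin[OF that] by (simp add: card_image_le)
    also have "\<dots> \<le> Suc (s 1)" using card_nbrs[OF that] by simp
    finally show "card (?T v) \<le> Suc (s 1)" .
  qed
  \<comment> \<open>The first summand pays for \<open>n = 0\<close>, where \<open>n - 1\<close>
    truncates to \<open>0\<close> and the walks are the bare mid-edges of \<open>?X\<close>.\<close>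
  define K where "K = card ?X + card ?X * (card ?U * Suc (s 1))"
  let ?D = "\<lambda>n. \<Union>e\<in>?X. \<Union>u\<in>?U. \<Union>vs\<in>saws E u n. (\<lambda>t. Md e # ilv vs @ t) ` ?T (last vs)"
  have lV: "last vs \<in> V" if "vs \<in> saws E u n" "u \<in> V" for vs u n
    using saws_V[OF that] that last_in_set[of vs] by (cases vs) (auto simp: saws_def)
  have finD: "finite (?D n)" for n
  proof (intro finite_UN_I finite_imageI)
    show "finite ?X" "finite ?U" by fact+
    show "finite (saws E u n)" if "u \<in> ?U" for u by (rule finite_saws[OF subsetD[OF U(2) that]])
    show "finite (?T (last vs))" if "u \<in> ?U" "vs \<in> saws E u n" for u vs
      by (rule T(1), rule lV[OF that(2)], rule subsetD[OF U(2) that(1)])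
  qed
  have "finite {p \<in> Sig E W. wlen p = n} \<and> card {p \<in> Sig E W. wlen p = n} \<le> K * s (n - 1)" for n
  proof (cases n)
    case 0
    have sub: "{p \<in> Sig E W. wlen p = n} \<subseteq> (\<lambda>e. [Md e]) ` ?X"
    proof
      fix p assume p: "p \<in> {p \<in> Sig E W. wlen p = n}"
      then obtain e q where e: "p = Md e # q" "e \<in> ?X" by (cases p) (auto simp: Sig_def mid_saw_def)
      have "q = []"
      proof (cases q)
        case (Cons x r)
        then show ?thesis using p e 0 by (cases x) (auto simp: Sig_def mid_saw_def)
      qed simp
      then show "p \<in> (\<lambda>e. [Md e]) ` ?X" using e by auto
    qed
    have "card {p \<in> Sig E W. wlen p = n} \<le> card ((\<lambda>e. [Md e]) ` ?X)"
      using finite_inc_edges by (intro card_mono sub) auto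
    also have "\<dots> \<le> card ?X" by (rule card_image_le[OF finite_inc_edges])
    also have "\<dots> \<le> K" by (simp add: K_def)
    also have "\<dots> \<le> K * s (n - 1)" using s_pos by simp
    finally show ?thesis using finite_subset[OF sub] finite_inc_edges by auto
  next
    case (Suc m)
    have sub: "{p \<in> Sig E W. wlen p = n} \<subseteq> ?D m"
    proof
      fix p assume p: "p \<in> {p \<in> Sig E W. wlen p = n}"
      then obtain e q where e: "p = Md e # q" "e \<in> ?X" by (cases p) (auto simp: Sig_def mid_saw_def)
      then have "q \<noteq> []" using p Suc by auto
      then obtain u r where q: "q = Vx u # r" "u \<in> e"
      proof (cases q)
        case (Cons y r)
        then show ?thesis using p e that by (cases y) (auto simp: Sig_def mid_saw_def)
      qed simp
      obtain vs t where vs: "vs \<noteq> []" "hd vs = u" "distinct vs" "successively E vs" "q = ilv vs @ t"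
        "t = [] \<or> (\<exists>f. t = [Md f] \<and> f \<in> edge_set E \<and> last vs \<in> f)"
        by (rule mid_walk_from_vertex[OF simple, of q u]) (use p e q in \<open>auto simp: Sig_def mid_saw_def successively_Cons\<close>)
      have "wlen q = length vs" using vs by auto
      then have l: "length vs = Suc m" using p e Suc by simp
      have "vs \<in> saws E u m" using vs l by (auto simp: saws_def)
      moreover have "t \<in> ?T (last vs)" using vs(6) by (auto elim!: edge_set_obtain[OF simple])
      ultimately show "p \<in> ?D m" using e q vs(5) by fast
    qed
    have "card (?D m) \<le> (\<Sum>e\<in>?X. \<Sum>u\<in>?U. \<Sum>vs\<in>saws E u m. card ((\<lambda>t. Md e # ilv vs @ t) ` ?T (last vs)))"
      by (intro order_trans[OF card_UN_le] sum_mono) (use U finite_saws in \<open>auto simp: subset_iff\<close>)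
    also have "\<dots> \<le> (\<Sum>e\<in>?X. \<Sum>u\<in>?U. \<Sum>vs\<in>saws E u m. Suc (s 1))"
    proof (intro sum_mono)
      fix e u vs assume u: "u \<in> ?U" "vs \<in> saws E u m"
      have "last vs \<in> V" by (rule lV[OF u(2) subsetD[OF U(2) u(1)]])
      then show "card ((\<lambda>t. Md e # ilv vs @ t) ` ?T (last vs)) \<le> Suc (s 1)"
        by (intro order_trans[OF card_image_le[OF T(1)] T(2)])
    qed
    also have "\<dots> = (\<Sum>e\<in>?X. \<Sum>u\<in>?U. c u m * Suc (s 1))" by (simp add: saw_count_eq)
    also have "\<dots> \<le> (\<Sum>e\<in>?X. \<Sum>u\<in>?U. s m * Suc (s 1))"
      using U by (intro sum_mono mult_le_mono1 c_le_s) auto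
    also have "\<dots> \<le> K * s (n - 1)" unfolding K_def Suc by (simp add: algebra_simps)
    finally have "card (?D m) \<le> K * s (n - 1)" .
    then show ?thesis using sub finD[of m] by (meson card_mono finite_subset order_trans)
  qed
  then show ?thesis using that by blast
qed

lemma Yfun_finite_below:
  assumes x: "0 < x" "x < 1 / mu"
  shows "Yfun E W x 0 < \<infinity>"
proof -
  have m0: "mu > 0" using mu_ge_1 by simp
  have "mu < 1 / x" using x m0 by (simp add: field_simps)
  then obtain l where l: "mu < l" "l < 1 / x" using dense by blast
  have l0: "l > 0" using l m0 by simp
  have lx: "l * x < 1" using l x by (simp add: field_simps)
  obtain C where C: "C > 0" "\<And>n. real (s n) \<le> C * l ^ n" using s_growth[OF l(1)] by blast
  obtain K where K: "\<And>n. finite {p \<in> Sig E W. wlen p = n}"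
    "\<And>n. card {p \<in> Sig E W. wlen p = n} \<le> K * s (n - 1)" using Sig_count by blast
  \<comment> \<open>The summand \<open>1 / l\<close> compensates for the exponent
    \<open>n - 1\<close>, and the summand \<open>1\<close> covers \<open>n = 0\<close>; what remains
    is geometric with ratio \<open>l * x < 1\<close>.\<close>
  let ?b = "\<lambda>n. real K * (C * (1 + 1 / l)) * (l * x) ^ n"
  have sl: "real (s (n - 1)) \<le> C * (1 + 1 / l) * l ^ n" for n
  proof (cases n)
    case 0
    then show ?thesis using C(2)[of 0] C(1) l0 by (simp add: distrib_left add_increasing2)
  next
    case (Suc m)
    have "real (s (n - 1)) \<le> C * l ^ m" using C Suc by simp
    also have "\<dots> \<le> C * (1 + 1 / l) * l ^ n" using C l0 Suc by (simp add: field_simps)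
    finally show ?thesis .
  qed
  have "Yfun E W x 0 \<le> infsum (\<lambda>n. ennreal (?b n)) UNIV"
    unfolding Yfun_0
  proof (rule infsum_ennreal_fibres_le[where h = wlen])
    fix n F assume F: "finite F" "F \<subseteq> {p \<in> Sig E W. wlen p = n}"
    have "(\<Sum>p\<in>F. ennreal (x ^ wlen p)) = (\<Sum>p\<in>F. ennreal (x ^ n))"
      using F by (intro sum.cong) auto
    also have "\<dots> = ennreal (real (card F) * x ^ n)"
      using x by (simp add: ennreal_mult ennreal_of_nat_eq_real_of_nat)
    also have "\<dots> \<le> ennreal (?b n)"
    proof (intro ennreal_leI)
      have "card F \<le> K * s (n - 1)" using F K by (meson card_mono order_trans)
      then have "real (card F) \<le> real K * real (s (n - 1))" by (simp flip: of_nat_mult)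
      also have "\<dots> \<le> real K * (C * (1 + 1 / l) * l ^ n)" by (intro mult_left_mono sl) auto
      finally have "real (card F) * x ^ n \<le> real K * (C * (1 + 1 / l) * l ^ n) * x ^ n"
        using x by (intro mult_right_mono) auto
      then show "real (card F) * x ^ n \<le> ?b n" by (simp add: power_mult_distrib ac_simps)
    qed
    finally show "(\<Sum>p\<in>F. ennreal (x ^ wlen p)) \<le> ennreal (?b n)" .
  qed auto
  also have "\<dots> \<le> ennreal (\<Sum>n. ?b n)"
  proof (rule infsum_ennreal_le)
    fix F :: "nat set" assume F: "finite F"
    have nn: "?b n \<ge> 0" for n using C l0 x by simp
    have "summable ?b" using lx l0 x by (intro summable_mult summable_geometric) auto
    then have "sum ?b F \<le> (\<Sum>n. ?b n)" using F nn by (intro sum_le_suminf) auto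
    then show "(\<Sum>n\<in>F. ennreal (?b n)) \<le> ennreal (\<Sum>n. ?b n)"
      using nn by (subst sum_ennreal) (auto intro: ennreal_leI)
  qed
  finally show ?thesis by (simp add: le_less_trans)
qed

text \<open>Deleting the first vertex of an interleaved walk from \<open>w\<close> leaves a walk
  that starts at a mid-edge at \<open>w\<close> and visits \<open>n\<close> vertices. Hence
  \<open>Y\<close> dominates each \<open>c w n * x ^ n\<close>, and these are unbounded.\<close>

lemma Yfun_infinite_above:
  assumes x: "x > 1 / mu"
  shows "Yfun E W x 0 = \<infinity>"
proof -
  have m0: "mu > 0" using mu_ge_1 by simp
  have x0: "x > 0" using x m0 by (meson divide_pos_pos less_trans zero_less_one)
  obtain w where w: "w \<in> W" using W_ne by blast
  have wV: "w \<in> V" using w W_V by auto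
  have ge: "ennreal (real (c w n) * x ^ n) \<le> Yfun E W x 0" if n: "n \<ge> 1" for n
  proof -
    let ?f = "\<lambda>vs. tl (ilv vs)"
    have vx: "w # vxs (?f vs) = vs \<and> ?f vs \<in> Sig E W" if vsS: "vs \<in> saws E w n" for vs
    proof -
      obtain u us where vs: "vs = w # u # us"
        using vsS n by (cases vs; cases "tl vs") (auto simp: saws_def)
      have d: "distinct (ilv vs)" "successively (step_ok E) (ilv vs)"
        using vsS by (auto simp: saws_def intro: distinct_ilv successively_ilv)
      have "{w, u} \<in> inc_edges E W" using w vsS vs by (auto simp: inc_edges_def saws_def intro: edge_setI)
      then show ?thesis using d vs by (auto simp: Sig_def mid_saw_def successively_Cons)
    qed
    have inj: "inj_on ?f (saws E w n)" using vx by (intro inj_on_inverseI[where g = "\<lambda>p. w # vxs p"]) auto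
    have wl: "wlen (?f vs) = n" if "vs \<in> saws E w n" for vs
    proof -
      have "length (w # vxs (?f vs)) = length vs"
        by (simp only: vx[OF that, THEN conjunct1])
      then show ?thesis using that length_vxs[of "?f vs"] by (simp add: saws_def)
    qed
    have "ennreal (real (c w n) * x ^ n) = (\<Sum>vs\<in>saws E w n. ennreal (x ^ n))"
      using x0 by (simp add: ennreal_mult ennreal_of_nat_eq_real_of_nat saw_count_eq)
    also have "\<dots> = (\<Sum>p\<in>?f ` saws E w n. ennreal (x ^ wlen p))"
      using wl by (subst sum.reindex[OF inj]) auto
    also have "\<dots> \<le> Yfun E W x 0" unfolding Yfun_0
      using finite_saws[OF wV] vx by (intro sum_le_infsum_ennreal) auto
    finally show ?thesis .
  qed
  have "1 / x < mu" using x x0 m0 by (simp add: field_simps)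
  then obtain r where r: "1 / x < r" "r < mu" using dense by blast
  have r0: "r > 0" using r x0 by (meson divide_pos_pos less_trans zero_less_one)
  have rx: "r * x > 1" using r x0 by (simp add: field_simps)
  have ev: "\<forall>\<^sub>F n in sequentially. r < root n (real (c w n))"
    using order_tendstoD(1)[OF root_c_tendsto[OF wV] r(2)] .
  show ?thesis
  proof (rule ccontr)
    assume "Yfun E W x 0 \<noteq> \<infinity>"
    then obtain B where B: "Yfun E W x 0 = ennreal B" "B \<ge> 0"
      by (metis ennreal_cases infinity_ennreal_def)
    have "filterlim (\<lambda>n. (r * x) ^ n) at_top sequentially"
      using rx by (intro filterlim_at_infinity_imp_filterlim_at_top filterlim_realpow_sequentially_gt1) auto
    then have "\<forall>\<^sub>F n in sequentially. (r * x) ^ n > B" by (simp add: filterlim_at_top_dense)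
    then have "\<forall>\<^sub>F n in sequentially. False"
      using ev eventually_gt_at_top[of 0]
    proof eventually_elim
      case (elim n)
      have "r ^ n \<le> root n (real (c w n)) ^ n" using elim r0 by (intro power_mono) auto
      then have "r ^ n \<le> real (c w n)" using elim by simp
      then have "(r * x) ^ n \<le> real (c w n) * x ^ n"
        using x0 by (simp add: power_mult_distrib mult_right_mono)
      moreover have "real (c w n) * x ^ n \<le> B" using ge[of n] elim B by simp
      ultimately show False using elim by simp
    qed
    then show False by simp
  qed
qed

end

section \<open>The transformed graph\<close>

text \<open>Walks with a mid-edge at both ends, generated by one full vertex passage at a time, so
  that inductions match the recursion of \<open>lifts\<close>.\<close>

inductive mid_to_mid :: "('v \<Rightarrow> 'v \<Rightarrow> bool) \<Rightarrow> 'v pos list \<Rightarrow> bool" for E where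
  single: "e \<in> edge_set E \<Longrightarrow> mid_to_mid E [Md e]"
| step: "mid_to_mid E (Md f # p) \<Longrightarrow> e \<in> edge_set E \<Longrightarrow> v \<in> e \<Longrightarrow> v \<in> f \<Longrightarrow>
    Md e \<notin> set (Md f # p) \<Longrightarrow> Vx v \<notin> set (Md f # p) \<Longrightarrow> mid_to_mid E (Md e # Vx v # Md f # p)"

lemma mid_to_mid_edges: "mid_to_mid E p \<Longrightarrow> Md e \<in> set p \<Longrightarrow> e \<in> edge_set E"
  by (induction rule: mid_to_mid.induct) auto

lemma mid_to_mid_D:
  "mid_to_mid E p \<Longrightarrow> mid_saw E p \<and> (\<exists>e\<in>edge_set E. hd p = Md e) \<and> (\<exists>f\<in>edge_set E. last p = Md f)"
proof (induction rule: mid_to_mid.induct)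
  case (step f p e v)
  have "f \<in> edge_set E" using mid_to_mid_edges[OF step(1)] by auto
  then show ?case using step by (auto simp: mid_saw_def)
qed (auto simp: mid_saw_def)

lemma mid_to_midI:
  "mid_saw E p \<Longrightarrow> hd p = Md e \<Longrightarrow> e \<in> edge_set E \<Longrightarrow> last p = Md f \<Longrightarrow> mid_to_mid E p"
proof (induction "length p" arbitrary: p e rule: less_induct)
  case less
  then obtain q where p: "p = Md e # q" by (cases p) (auto simp: mid_saw_def)
  show ?case
  proof (cases q)
    case Nil then show ?thesis using p less by (auto intro: single)
  next
    case (Cons x r)
    obtain v where x: "x = Vx v" "v \<in> e" using less p Cons by (cases x) (auto simp: mid_saw_def)
    have "r \<noteq> []" using less.prems(4) p Cons x by auto
    then obtain y r' where r: "r = y # r'" by (cases r) auto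
    obtain g where y: "y = Md g" "v \<in> g" "g \<in> edge_set E"
      using less.prems(1) p Cons x r by (cases y) (auto simp: mid_saw_def)
    have m: "mid_saw E r" using less.prems(1) p Cons r by (auto simp: mid_saw_def)
    have "length r < length p" "hd r = Md g" "last r = Md f" using p Cons r y less.prems by auto
    then have "mid_to_mid E r" using less.hyps[of r g] m y by auto
    then show ?thesis using p Cons r x y less.prems(1,3) by (auto simp: mid_saw_def intro!: step)
  qed
qed

text \<open>Supplies the two edges that a visit to \<open>v\<close> uses; they are what gets counted
  against the degree 3.\<close>

lemma mid_to_mid_nbrs:
  assumes "mid_to_mid E p" "Vx v \<in> set p"
  shows "\<exists>A e f B. p = A @ Md e # Vx v # Md f # B \<and> v \<in> e \<and> v \<in> f"
  using assms
proof (induction rule: mid_to_mid.induct)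
  case (step f p e u)
  show ?case
  proof (cases "u = v")
    case True
    then have "Md e # Vx u # Md f # p = [] @ Md e # Vx v # Md f # p \<and> v \<in> e \<and> v \<in> f" using step by auto
    then show ?thesis by blast
  next
    case False
    then obtain A e' f' B where "Md f # p = A @ Md e' # Vx v # Md f' # B" "v \<in> e'" "v \<in> f'"
      using step by auto
    then have "Md e # Vx u # Md f # p = (Md e # Vx u # A) @ Md e' # Vx v # Md f' # B \<and> v \<in> e' \<and> v \<in> f'" by simp
    then show ?thesis by blast
  qed
qed auto

text \<open>Collapses gadgets: positions inside the gadget at \<open>v\<close> go to the vertex \<open>v\<close>, and an edge joining two
  gadgets goes to the mid-edge of the edge of the original graph that it comes from.\<close>

definition hpos :: "('v \<times> 'g) pos \<Rightarrow> 'v pos" where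
  "hpos x = (case x of Vx y \<Rightarrow> Vx (fst y) | Md e \<Rightarrow>
     (if is_singleton (fst ` e) then Vx (the_elem (fst ` e)) else Md (fst ` e)))"

text \<open>\<open>remdups_adj\<close> contracts the run of equal positions produced by one passage
  through a gadget to a single vertex.\<close>

definition gproj :: "('v \<times> 'g) pos list \<Rightarrow> 'v pos list" where
  "gproj q = remdups_adj (map hpos q)"

lemma hpos_Vx [simp]: "hpos (Vx y) = Vx (fst y)"
  by (simp add: hpos_def)

lemma hpos_block: "x \<in> set (ilv (map (Pair v) vs)) \<Longrightarrow> hpos x = Vx v"
proof (induction vs rule: ilv.induct)
  case (3 a b vs)
  then show ?case by (auto simp: hpos_def is_singleton_def)
qed auto

lemma remdups_adj_const_append:
  "xs \<noteq> [] \<Longrightarrow> (\<And>x. x \<in> set xs \<Longrightarrow> x = a) \<Longrightarrow> ys \<noteq> [] \<Longrightarrow> hd ys \<noteq> a \<Longrightarrow>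
   remdups_adj (xs @ ys) = a # remdups_adj ys"
proof (induction xs)
  case (Cons x xs)
  show ?case
  proof (cases xs)
    case Nil
    then show ?thesis using Cons.prems by (cases ys) auto
  next
    case (Cons b bs)
    have "remdups_adj (xs @ ys) = a # remdups_adj ys" using Cons Cons.prems Cons.IH by auto
    moreover have "x = a" "b = a" using Cons.prems Cons by auto
    ultimately show ?thesis using Cons by simp
  qed
qed simp

lemma gproj_block:
  assumes "vs \<noteq> []" "hpos x = Md e" "q \<noteq> []" "hpos (hd q) = Md f"
  shows "gproj (x # ilv (map (Pair v) vs) @ q) = Md e # Vx v # gproj q"
proof -
  let ?b = "map hpos (ilv (map (Pair v) vs))"
  have b: "remdups_adj (?b @ map hpos q) = Vx v # remdups_adj (map hpos q)"
    using assms hpos_block by (intro remdups_adj_const_append) (auto simp: hd_map)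
  have "?b \<noteq> []" using assms by simp
  then obtain z zs where z: "?b = z # zs" by (cases ?b) auto
  have "z \<in> set ?b" using z by simp
  then have zv: "z = Vx v" using hpos_block[of _ v vs] by auto
  have "gproj (x # ilv (map (Pair v) vs) @ q) = remdups_adj (Md e # ?b @ map hpos q)"
    using assms by (simp add: gproj_def)
  also have "\<dots> = Md e # remdups_adj (?b @ map hpos q)" using z zv by simp
  finally show ?thesis using b by (simp add: gproj_def)
qed

lemma set_gproj: "set (gproj q) = hpos ` set q"
  by (simp add: gproj_def)

section \<open>The transformed graph, its connecting edges and ports\<close>

locale local_transf =
  fixes V0 :: "'v set" and E0 :: "'v \<Rightarrow> 'v \<Rightarrow> bool"
    and Gv :: "'g set" and Ge :: "'g \<Rightarrow> 'g \<Rightarrow> bool" and w1 w2 w3 :: 'g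
    and \<sigma> :: "'v \<Rightarrow> 'v \<Rightarrow> 'g" and W0 :: "'v set"
  assumes G0: "simple_graph V0 E0" "infinite V0" "connected_graph V0 E0" "cubic V0 E0"
    and gad: "gadget Gv Ge w1 w2 w3"
    and att: "\<And>v. v \<in> V0 \<Longrightarrow> bij_betw (\<sigma> v) {u. E0 v u} {w1, w2, w3}"
    and lift: "\<And>\<alpha>. aut V0 E0 \<alpha> \<Longrightarrow>
                 (\<exists>\<beta>. aut (phi_V V0 Gv) (phi_E V0 E0 Ge \<sigma>) \<beta> \<and>
                      (\<forall>x\<in>phi_V V0 Gv. fst (\<beta> x) = \<alpha> (fst x)))"
    and G1conn: "connected_graph (phi_V V0 Gv) (phi_E V0 E0 Ge \<sigma>)"
    and W0: "fund_domain V0 E0 W0"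
begin

abbreviation "V1 \<equiv> phi_V V0 Gv"
abbreviation "E1 \<equiv> phi_E V0 E0 Ge \<sigma>"
abbreviation "W1 \<equiv> W0 \<times> Gv"
abbreviation "ports \<equiv> {w1, w2, w3}"

lemma E0_V: "E0 u v \<Longrightarrow> u \<in> V0" "E0 u v \<Longrightarrow> v \<in> V0" and E0_sym: "E0 u v \<Longrightarrow> E0 v u"
  and E0_irrefl: "\<not> E0 u u"
  using G0 by (auto simp: simple_graph_def)

lemma gadget_facts: "finite Gv" "simple_graph Gv Ge" "connected_graph Gv Ge" "ports \<subseteq> Gv"
  "w1 \<noteq> w2" "w1 \<noteq> w3" "w2 \<noteq> w3"
  using gad by (auto simp: gadget_def)

lemma sigma_port: "E0 v u \<Longrightarrow> \<sigma> v u \<in> ports"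
  using att[of v] E0_V by (auto simp: bij_betw_def)

lemma sigma_Gv: "E0 v u \<Longrightarrow> \<sigma> v u \<in> Gv"
  using sigma_port gadget_facts by blast

lemma sigma_inj: "E0 v u \<Longrightarrow> E0 v u' \<Longrightarrow> \<sigma> v u = \<sigma> v u' \<Longrightarrow> u = u'"
  using att[of v] E0_V(1)[of v u] by (auto simp: bij_betw_def inj_on_def)

lemma E1_cases:
  assumes "E1 x y"
  obtains v a b where "x = (v, a)" "y = (v, b)" "v \<in> V0" "Ge a b"
    | u v where "E0 u v" "x = (u, \<sigma> u v)" "y = (v, \<sigma> v u)"
  using assms by (cases x; cases y) (auto simp: phi_E_def)

lemma simple1: "simple_graph V1 E1"
  unfolding simple_graph_def
proof (intro conjI allI impI)
  have Ge: "Ge a b \<Longrightarrow> a \<in> Gv \<and> b \<in> Gv \<and> Ge b a" "\<not> Ge a a" for a b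
    using gadget_facts(2) by (auto simp: simple_graph_def)
  show "x \<in> V1" "y \<in> V1" if "E1 x y" for x y
    using that Ge by (auto elim!: E1_cases simp: phi_V_def dest: E0_V sigma_Gv E0_sym)
  show "E1 y x" if "E1 x y" for x y
    using that Ge by (auto simp: phi_E_def dest: E0_sym)
  show "\<not> E1 x x" for x using Ge E0_irrefl by (auto simp: phi_E_def)
qed

text \<open>A lift of an automorphism that moves \<open>fst x\<close> into \<open>W0\<close> moves
  \<open>x\<close> into a gadget over \<open>W0\<close>.\<close>

lemma fund_domain1: "fund_domain V1 E1 W1"
  unfolding fund_domain_def
proof (intro conjI ballI)
  show "finite W1" using W0 gadget_facts by (auto simp: fund_domain_def)
  show "W1 \<subseteq> V1" using W0 by (auto simp: fund_domain_def phi_V_def)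
  fix x assume x: "x \<in> V1"
  then have "fst x \<in> V0" by (auto simp: phi_V_def)
  then obtain \<alpha> where a: "aut V0 E0 \<alpha>" "\<alpha> (fst x) \<in> W0" using W0 by (auto simp: fund_domain_def)
  obtain \<beta> where b: "aut V1 E1 \<beta>" "\<forall>x\<in>V1. fst (\<beta> x) = \<alpha> (fst x)" using lift[OF a(1)] by blast
  have "\<beta> x \<in> V1" using b x by (auto simp: aut_def bij_betw_def)
  then have "\<beta> x \<in> W1" using a b x by (cases "\<beta> x") (force simp: phi_V_def)
  then show "\<exists>f. aut V1 E1 f \<and> f x \<in> W1" using b(1) by (intro exI[of _ \<beta>] conjI)
qed

lemma locfin1: "finite {y. E1 x y}"
proof -
  have "{y. E1 x y} \<subseteq> ({fst x} \<times> Gv) \<union> (\<lambda>v. (v, \<sigma> v (fst x))) ` {v. E0 (fst x) v}"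
    using gadget_facts(2) by (auto elim!: E1_cases simp: simple_graph_def)
  moreover have "finite {v. E0 (fst x) v}"
  proof (cases "fst x \<in> V0")
    case True then show ?thesis using G0 by (auto simp: cubic_def)
  next
    case False
    then have "{v. E0 (fst x) v} = {}" using E0_V by auto
    then show ?thesis by simp
  qed
  ultimately show ?thesis using gadget_facts(1) by (meson finite.emptyI finite_SigmaI finite_Un finite_imageI finite_insert finite_subset)
qed

sublocale G0: qt_graph V0 E0 W0
  using G0 W0 by unfold_locales (auto simp: cubic_def)

sublocale G1: qt_graph V1 E1 W1
proof
  have "w1 \<in> Gv" using gadget_facts by auto
  then have "Gv \<noteq> {}" by auto
  then show "infinite V1" using G0(2) by (auto simp: phi_V_def finite_cartesian_product_iff)
qed (use simple1 fund_domain1 locfin1 G1conn in auto)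

text \<open>The connecting edge of \<open>G1\<close> that \<open>e\<close> becomes, written as a set
  comprehension so that neither end of \<open>e\<close> has to be chosen as the first.\<close>

definition hat :: "'v set \<Rightarrow> ('v \<times> 'g) set" where
  "hat e = {(u, \<sigma> u v) | u v. e = {u, v}}"

text \<open>\<open>\<sigma>\<close> indexed by an edge at \<open>v\<close> instead of a neighbour,
  because mid-edge walks record edges.\<close>

definition port :: "'v \<Rightarrow> 'v set \<Rightarrow> 'g" where
  "port v e = \<sigma> v (THE u. e = {v, u})"

lemma port_eq: "port v {v, u} = \<sigma> v u"
proof -
  have "(THE u'. {v, u} = {v, u'}) = u" by (rule the_equality) (auto simp: doubleton_eq_iff)
  then show ?thesis by (simp add: port_def)
qed

lemma hat_eq: "hat {u, v} = {(u, \<sigma> u v), (v, \<sigma> v u)}"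
  by (auto simp: hat_def doubleton_eq_iff)

lemma fst_hat: "e \<in> edge_set E0 \<Longrightarrow> fst ` hat e = e"
  by (auto simp: edge_set_def hat_eq)

lemma in_hat:
  assumes "e \<in> edge_set E0"
  shows "(v, a) \<in> hat e \<longleftrightarrow> v \<in> e \<and> a = port v e"
proof -
  obtain x y where e: "e = {x, y}" "E0 x y" using assms by (auto simp: edge_set_def)
  have "x \<noteq> y" using e E0_irrefl by auto
  moreover have "port x e = \<sigma> x y" "port y e = \<sigma> y x"
    using port_eq[of x y] port_eq[of y x] e by (auto simp: insert_commute)
  ultimately show ?thesis by (auto simp: e(1) hat_eq)
qed

lemma port_port:
  assumes "e \<in> edge_set E0" "v \<in> e"
  shows "port v e \<in> ports"
proof -
  obtain u where "e = {v, u}" "E0 v u" using assms edge_set_obtain[OF G0(1)] by metis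
  then show ?thesis using sigma_port by (simp add: port_eq)
qed

text \<open>Guarantees that passing a vertex by two different edges crosses its gadget between two
  different ports, where the path sum is \<open>gf\<close>.\<close>

lemma port_inj:
  assumes "e \<in> edge_set E0" "f \<in> edge_set E0" "v \<in> e" "v \<in> f" "e \<noteq> f"
  shows "port v e \<noteq> port v f"
proof -
  obtain a b where "e = {v, a}" "E0 v a" "f = {v, b}" "E0 v b"
    using assms edge_set_obtain[OF G0(1)] by metis
  then show ?thesis using sigma_inj assms(5) by (auto simp: port_eq)
qed

lemma hat_edge:
  assumes "e \<in> edge_set E0"
  shows "hat e \<in> edge_set E1"
proof -
  obtain x y where e: "e = {x, y}" "E0 x y" using assms by (auto simp: edge_set_def)
  then have "E1 (x, \<sigma> x y) (y, \<sigma> y x)" by (simp add: phi_E_def)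
  then show ?thesis unfolding e(1) hat_eq by (rule edge_setI)
qed

lemma hpos_hat: "e \<in> edge_set E0 \<Longrightarrow> hpos (Md (hat e)) = Md e"
  using E0_irrefl by (auto simp: hpos_def fst_hat) (auto simp: edge_set_def is_singleton_def doubleton_eq_iff)

text \<open>An edge inside a gadget projects to one vertex and so to a \<open>Vx\<close>; only
  connecting edges keep a mid-edge as image.\<close>

lemma hpos_edge:
  assumes "\<epsilon> \<in> edge_set E1" "hpos (Md \<epsilon>) = Md e"
  shows "e \<in> edge_set E0" "\<epsilon> = hat e"
proof -
  obtain x y where xy: "\<epsilon> = {x, y}" "E1 x y" using assms by (auto simp: edge_set_def)
  have "e \<in> edge_set E0 \<and> \<epsilon> = hat e"
    using xy(2)
  proof (cases rule: E1_cases)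
    case (1 v a b)
    then have "is_singleton (fst ` \<epsilon>)" using xy by (auto simp: is_singleton_def)
    then show ?thesis using assms(2) by (simp add: hpos_def)
  next
    case (2 u v)
    then have "\<epsilon> = hat {u, v}" "{u, v} \<in> edge_set E0" using xy by (auto simp: hat_eq intro: edge_setI)
    then show ?thesis using assms(2) hpos_hat by auto
  qed
  then show "e \<in> edge_set E0" "\<epsilon> = hat e" by auto
qed

section \<open>Self-avoiding paths of the gadget between two ports\<close>

definition gpaths :: "'g \<Rightarrow> 'g \<Rightarrow> 'g list set" where
  "gpaths a b = {vs. vs \<noteq> [] \<and> hd vs = a \<and> last vs = b \<and> distinct vs \<and> successively Ge vs \<and> set vs \<subseteq> Gv}"

definition gf :: "real \<Rightarrow> real" where
  "gf x = (\<Sum>vs\<in>gpaths w1 w2. x ^ length vs)"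

lemma finite_gpaths: "finite (gpaths a b)"
proof -
  have "gpaths a b \<subseteq> {xs. set xs \<subseteq> Gv \<and> distinct xs}" by (auto simp: gpaths_def)
  then show ?thesis using finite_subset_distinct[OF gadget_facts(1)] by (rule finite_subset)
qed

lemma gpaths_rev: "(\<Sum>vs\<in>gpaths a b. (x::real) ^ length vs) = (\<Sum>vs\<in>gpaths b a. x ^ length vs)"
proof (rule sum.reindex_bij_witness[of _ rev rev])
  have "successively Ge (rev vs)" if "successively Ge vs" for vs
    using that gadget_facts(2) by (subst successively_rev) (rule successively_mono[of Ge], auto simp: simple_graph_def)
  then show "rev vs \<in> gpaths b a" if "vs \<in> gpaths a b" for vs a b
    using that by (auto simp: gpaths_def hd_rev last_rev)
  then show "rev vs \<in> gpaths a b" if "vs \<in> gpaths b a" for vs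
    using that by blast
qed auto

text \<open>An automorphism maps paths injectively to paths of the same length. The inverse
  automorphism later turns this into an equality.\<close>

lemma gpaths_aut_le:
  assumes f: "aut Gv Ge f" and x: "(x::real) > 0"
  shows "(\<Sum>vs\<in>gpaths a b. x ^ length vs) \<le> (\<Sum>vs\<in>gpaths (f a) (f b). x ^ length vs)"
proof -
  have inj: "inj_on f Gv" and im: "f ` Gv = Gv" using f by (auto simp: aut_def bij_betw_def)
  have i: "inj_on (map f) (gpaths a b)"
    by (intro inj_on_mapI inj_on_subset[OF inj]) (auto simp: gpaths_def)
  have sub: "map f ` gpaths a b \<subseteq> gpaths (f a) (f b)"
  proof
    fix ws assume "ws \<in> map f ` gpaths a b"
    then obtain vs where vs: "vs \<in> gpaths a b" "ws = map f vs" by auto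
    have sG: "set vs \<subseteq> Gv" using vs by (auto simp: gpaths_def)
    have "successively (\<lambda>x y. Ge (f x) (f y)) vs"
      by (rule successively_mono[of Ge]) (use vs sG f in \<open>auto simp: gpaths_def aut_def\<close>)
    moreover have "set (map f vs) \<subseteq> Gv" using sG im by auto
    ultimately show "ws \<in> gpaths (f a) (f b)"
      using vs inj sG by (auto simp: gpaths_def hd_map last_map distinct_map successively_map inj_on_subset)
  qed
  have "(\<Sum>vs\<in>gpaths a b. x ^ length vs) = (\<Sum>vs\<in>map f ` gpaths a b. x ^ length vs)"
    by (subst sum.reindex[OF i]) auto
  also have "\<dots> \<le> (\<Sum>vs\<in>gpaths (f a) (f b). x ^ length vs)"
    using x by (intro sum_mono2 finite_gpaths sub) auto
  finally show ?thesis .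
qed

end

section \<open>Lifting walks through the gadgets\<close>

lemma aut_inv_into: assumes "aut V E f" shows "aut V E (inv_into V f)"
proof -
  have b: "bij_betw f V V" using assms by (simp add: aut_def)
  have "E (inv_into V f u) (inv_into V f v) = E u v" if "u \<in> V" "v \<in> V" for u v
  proof -
    have i: "inv_into V f u \<in> V" "inv_into V f v \<in> V"
      using that b by (auto simp: bij_betw_def inv_into_into)
    have "f (inv_into V f u) = u" "f (inv_into V f v) = v"
      using that b by (auto simp: bij_betw_inv_into_right)
    then show ?thesis using assms i by (metis aut_def)
  qed
  then show ?thesis using bij_betw_inv_into[OF b] by (simp add: aut_def)
qed

text \<open>In both decompositions the prefix is the longest initial segment satisfying
  \<open>P\<close>. This makes the boundary between a gadget passage and the rest of a walk
  unique.\<close>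

lemma append_eq_by_pred:
  assumes "a @ b = c @ d" "\<And>x. x \<in> set a \<union> set c \<Longrightarrow> P x" "b \<noteq> []" "d \<noteq> []" "\<not> P (hd b)" "\<not> P (hd d)"
  shows "a = c \<and> b = d"
proof -
  have "takeWhile P (a @ b) = a" using assms(2-) by (cases b) auto
  moreover have "takeWhile P (c @ d) = c" using assms(2-) by (cases d) auto
  ultimately show ?thesis using assms(1) by auto
qed

text \<open>A step into or out of a mid-edge certifies that it is an edge, but a one-point walk has
  no steps; hence the condition on the start.\<close>

lemma mid_saw_edges:
  assumes "mid_saw E p" "hd p = Md e" "e \<in> edge_set E" "Md f \<in> set p"
  shows "f \<in> edge_set E"
proof -
  obtain A B where p: "p = A @ Md f # B" using split_list[OF assms(4)] by blast
  show ?thesis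
  proof (cases A rule: rev_cases)
    case Nil then show ?thesis using p assms by simp
  next
    case (snoc A' x)
    have "step_ok E x (Md f)" using assms(1) p snoc by (auto simp: mid_saw_def successively_append_iff)
    then show ?thesis by (cases x) auto
  qed
qed

context local_transf begin

abbreviation gsum :: "real \<Rightarrow> 'g \<Rightarrow> 'g \<Rightarrow> real" where
  "gsum x a b \<equiv> (\<Sum>vs\<in>gpaths a b. x ^ length vs)"

lemma gpaths_aut:
  assumes f: "aut Gv Ge f" and x: "x > 0" and ab: "a \<in> Gv" "b \<in> Gv"
  shows "gsum x (f a) (f b) = gsum x a b"
proof (rule antisym)
  show "gsum x a b \<le> gsum x (f a) (f b)" by (rule gpaths_aut_le[OF f x])
  have "inv_into Gv f (f c) = c" if "c \<in> Gv" for c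
    using f that by (auto simp: aut_def bij_betw_def)
  then show "gsum x (f a) (f b) \<le> gsum x a b"
    using gpaths_aut_le[OF aut_inv_into[OF f] x, of "f a" "f b"] ab by simp
qed

lemma port_aut:
  assumes "a \<in> ports" "b \<in> ports" "x > 0"
  obtains f where "f a = b" "f ` ports = ports" "inj_on f ports"
    "\<And>c d. c \<in> ports \<Longrightarrow> d \<in> ports \<Longrightarrow> gsum x (f c) (f d) = gsum x c d"
proof -
  obtain f where f: "aut Gv Ge f" "f ` ports = ports" "f a = b"
    using gad assms unfolding gadget_def by blast
  have "inj_on f ports" using f(1) by (intro inj_on_subset[OF _ gadget_facts(4)]) (simp add: aut_def bij_betw_def)
  moreover have "gsum x (f c) (f d) = gsum x c d" if "c \<in> ports" "d \<in> ports" for c d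
    by (rule gpaths_aut[OF f(1) assms(3)]) (use that gadget_facts(4) in auto)
  ultimately show ?thesis using that[of f] f by simp
qed

text \<open>A transitive group on three ports contains a 3-cycle or two transpositions; reversing a
  path takes care of the order of the two ports.\<close>

lemma gsum_ports:
  assumes x: "x > 0" and ab: "a \<in> ports" "b \<in> ports" "a \<noteq> b"
  shows "gsum x a b = gf x"
proof -
  let ?S = "gsum x"
  note d = gadget_facts(5-7)
  have sym: "?S a b = ?S b a" for a b by (rule gpaths_rev)
  obtain f where f: "f w1 = w2" "f ` ports = ports" "inj_on f ports"
    "\<And>c d. c \<in> ports \<Longrightarrow> d \<in> ports \<Longrightarrow> ?S (f c) (f d) = ?S c d"
    using port_aut[of w1 w2] x by blast
  obtain h where h: "h w1 = w3" "h ` ports = ports" "inj_on h ports"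
    "\<And>c d. c \<in> ports \<Longrightarrow> d \<in> ports \<Longrightarrow> ?S (h c) (h d) = ?S c d"
    using port_aut[of w1 w3] x by blast
  have fc: "f w2 = w1 \<and> f w3 = w3 \<or> f w2 = w3 \<and> f w3 = w1"
    using f(1-3) d by (auto simp: inj_on_def)
  have hc: "h w2 = w2 \<and> h w3 = w1 \<or> h w2 = w1 \<and> h w3 = w2"
    using h(1-3) d by (auto simp: inj_on_def)
  have F: "?S (f w1) (f w2) = ?S w1 w2" "?S (f w1) (f w3) = ?S w1 w3" "?S (f w2) (f w3) = ?S w2 w3"
    by (auto intro!: f(4))
  have H: "?S (h w1) (h w2) = ?S w1 w2" "?S (h w1) (h w3) = ?S w1 w3" "?S (h w2) (h w3) = ?S w2 w3"
    by (auto intro!: h(4))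
  have "?S w1 w2 = ?S w1 w3 \<and> ?S w1 w2 = ?S w2 w3"
    using fc
  proof
    assume "f w2 = w3 \<and> f w3 = w1"
    then show ?thesis using F f(1) sym[of w2 w1] sym[of w3 w1] by simp
  next
    \<comment> \<open>The transposition of \<open>w1\<close> and \<open>w2\<close> only gives
      \<open>?S w1 w3 = ?S w2 w3\<close>; \<open>h\<close>, which moves \<open>w1\<close> to
      \<open>w3\<close>, ties in \<open>?S w1 w2\<close> whether it is a transposition or a
      3-cycle.\<close>
    assume 1: "f w2 = w1 \<and> f w3 = w3"
    show ?thesis using hc
    proof
      assume "h w2 = w2 \<and> h w3 = w1"
      then show ?thesis using 1 F f(1) H h(1) sym[of w3 w2] by simp
    next
      assume "h w2 = w1 \<and> h w3 = w2"
      then show ?thesis using 1 F f(1) H h(1) sym[of w3 w2] sym[of w3 w1] by simp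
    qed
  qed
  then show ?thesis using ab sym[of w2 w1] sym[of w3 w1] sym[of w3 w2] by (auto simp: gf_def)
qed

text \<open>Connectedness of the gadget provides a path, which makes \<open>gf\<close>
  positive.\<close>

lemma gpaths_nonempty: assumes "a \<in> Gv" "b \<in> Gv" shows "gpaths a b \<noteq> {}"
proof -
  obtain n p where p: "p \<in> saws Ge a n" "last p = b"
    using gadget_facts(3) assms rtrancl_imp_saw[of a b Ge] by (auto simp: connected_graph_def)
  have "set p \<subseteq> Gv"
    using p(1) assms(1)
  proof (induction p arbitrary: a n)
    case (Cons y p)
    show ?case
    proof (cases p)
      case (Cons z r)
      then have "p \<in> saws Ge z (n - 1)" "z \<in> Gv"
        using Cons.prems gadget_facts(2) by (auto simp: saws_def simple_graph_def)
      then show ?thesis using Cons.IH Cons.prems by (auto simp: saws_def)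
    qed (use Cons.prems in \<open>auto simp: saws_def\<close>)
  qed simp
  then have "p \<in> gpaths a b" using p by (auto simp: gpaths_def saws_def)
  then show ?thesis by blast
qed

lemma gf_pos: "x > 0 \<Longrightarrow> gf x > 0"
  unfolding gf_def using finite_gpaths gpaths_nonempty[of w1 w2] gadget_facts(4)
  by (intro sum_pos) auto

text \<open>All ways to replace each vertex by a gadget path from the port where it is entered to
  the port where it is left. Lists of any other shape get no lift.\<close>

fun lifts :: "'v pos list \<Rightarrow> ('v \<times> 'g) pos list set" where
  "lifts [Md e] = {[Md (hat e)]}"
| "lifts (Md e # Vx v # Md f # p) =
     (\<lambda>(vs, q). Md (hat e) # ilv (map (Pair v) vs) @ q) ` (gpaths (port v e) (port v f) \<times> lifts (Md f # p))"
| "lifts _ = {}"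

lemma lifts_Cons:
  "q \<in> lifts (Md e # p) \<Longrightarrow> \<exists>q'. q = Md (hat e) # q'"
  by (induction "Md e # p" rule: lifts.induct) auto

lemma lifts_gproj:
  assumes "mid_to_mid E0 p" "q \<in> lifts p"
  shows "gproj q = p"
  using assms
proof (induction arbitrary: q rule: mid_to_mid.induct)
  case (single e)
  then show ?case by (simp add: gproj_def hpos_hat)
next
  case (step f p e v)
  then obtain vs r where r: "vs \<in> gpaths (port v e) (port v f)" "r \<in> lifts (Md f # p)"
    "q = Md (hat e) # ilv (map (Pair v) vs) @ r" by auto
  have f: "f \<in> edge_set E0" using mid_to_mid_edges[OF step(1)] by simp
  obtain r' where r': "r = Md (hat f) # r'" using lifts_Cons r(2) by blast
  show ?case unfolding r(3)
    by (subst gproj_block[where e = e and f = f])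
       (use r r' f step.IH[OF r(2)] step.hyps(2) in \<open>auto simp: hpos_hat gpaths_def\<close>)
qed

text \<open>A passage visits at least one vertex, and at most \<open>card Gv\<close> because it is
  self-avoiding.\<close>

lemma lifts_bounds:
  assumes "mid_to_mid E0 p" "q \<in> lifts p"
  shows "wlen p \<le> wlen q \<and> wlen q \<le> card Gv * wlen p \<and>
    (\<exists>f\<in>edge_set E0. last p = Md f \<and> last q = Md (hat f))"
  using assms
proof (induction arbitrary: q rule: mid_to_mid.induct)
  case (step f p e v)
  then obtain vs r where r: "vs \<in> gpaths (port v e) (port v f)" "r \<in> lifts (Md f # p)"
    "q = Md (hat e) # ilv (map (Pair v) vs) @ r" by auto
  have "length vs \<ge> 1" using r(1) by (cases vs) (auto simp: gpaths_def)
  moreover have "length vs \<le> card Gv"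
    using r(1) gadget_facts(1) by (auto simp: gpaths_def distinct_card[symmetric] intro: card_mono)
  moreover have "r \<noteq> []" using lifts_Cons r(2) by blast
  ultimately show ?case using step.IH[OF r(2)] r(3) by auto
qed auto

text \<open>Self-avoidance across different pieces is read off from \<open>hpos\<close>: positions
  with different images differ. Only within one gadget is distinctness of the path itself
  used.\<close>

lemma lifts_mid_saw:
  assumes "mid_to_mid E0 p" "q \<in> lifts p"
  shows "mid_saw E1 q"
  using assms
proof (induction arbitrary: q rule: mid_to_mid.induct)
  case (single e)
  then show ?case by (simp add: mid_saw_def)
next
  case (step f p e v)
  then obtain vs r where r: "vs \<in> gpaths (port v e) (port v f)" "r \<in> lifts (Md f # p)"
    "q = Md (hat e) # ilv (map (Pair v) vs) @ r" by auto
  have f: "f \<in> edge_set E0" using mid_to_mid_edges[OF step(1)] by simp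
  obtain r' where r': "r = Md (hat f) # r'" using lifts_Cons r(2) by blast
  have v: "v \<in> V0" using step.hyps G0.edge_V by blast
  let ?b = "ilv (map (Pair v) vs)"
  have set_r: "hpos ` set r = set (Md f # p)"
    using lifts_gproj[OF step(1) r(2)] set_gproj[of r] by simp
  have h: "hpos (Md (hat e)) = Md e" using step.hyps(2) by (rule hpos_hat)
  have d1: "Md (hat e) \<notin> set r" using set_r h step.hyps(5) by (metis imageI)
  have d2: "set ?b \<inter> set r = {}" using set_r hpos_block[of _ v vs] step.hyps(6) by (metis disjoint_iff imageI)
  have d3: "Md (hat e) \<notin> set ?b" using hpos_block[of "Md (hat e)" v vs] h by auto
  have d4: "distinct ?b" using r(1) by (intro distinct_ilv) (auto simp: gpaths_def distinct_map inj_on_def)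
  have m: "mid_saw E1 r" by (rule step.IH[OF r(2)])
  have vs: "vs \<noteq> []" "hd vs = port v e" "last vs = port v f" using r(1) by (auto simp: gpaths_def)
  have s1: "successively (step_ok E1) ?b"
    using r(1) v by (intro successively_ilv) (auto simp: gpaths_def successively_map phi_E_def elim: successively_mono)
  have s2: "step_ok E1 (Md (hat e)) (hd ?b)"
    using vs step.hyps(2,3) hat_edge in_hat by (simp add: hd_map)
  have s3: "step_ok E1 (last ?b) (hd r)"
    using vs r' f step.hyps(4) hat_edge in_hat by (simp add: last_map)
  show ?case unfolding r(3) mid_saw_def
    using d1 d2 d3 d4 m s1 s2 s3 vs by (auto simp: mid_saw_def successively_Cons successively_append_iff hd_append)
qed

text \<open>The choices at different vertices are independent, so the sum factorises, with one
  factor \<open>gf x\<close> per vertex whatever the ports are.\<close>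

lemma lifts_sum:
  assumes "mid_to_mid E0 p" and x: "x > 0"
  shows "finite (lifts p) \<and> (\<Sum>q\<in>lifts p. x ^ wlen q) = gf x ^ wlen p"
  using assms(1)
proof (induction rule: mid_to_mid.induct)
  case (step f p e v)
  let ?F = "\<lambda>(vs, q). Md (hat e) # ilv (map (Pair v) vs) @ q"
  let ?G = "gpaths (port v e) (port v f)"
  have f: "f \<in> edge_set E0" using mid_to_mid_edges[OF step(1)] by simp
  have inj: "inj_on ?F (?G \<times> lifts (Md f # p))"
  proof (rule inj_onI, clarify)
    fix vs q vs' q'
    assume q: "q \<in> lifts (Md f # p)" "q' \<in> lifts (Md f # p)"
      and eq: "ilv (map (Pair v) vs) @ q = ilv (map (Pair v) vs') @ q'"
    obtain r r' where r: "q = Md (hat f) # r" "q' = Md (hat f) # r'" using q lifts_Cons by meson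
    \<comment> \<open>The passage is the longest initial run collapsing to \<open>Vx v\<close>,
      since the next position is a connecting edge.\<close>
    have "ilv (map (Pair v) vs) = ilv (map (Pair v) vs') \<and> q = q'"
      by (rule append_eq_by_pred[OF eq, where P = "\<lambda>x. hpos x = Vx v"])
         (use r f in \<open>auto simp: hpos_block hpos_hat\<close>)
    then show "vs = vs' \<and> q = q'" by (auto simp: ilv_inj inj_map_eq_map inj_def)
  qed
  have ef: "e \<noteq> f" using step.hyps by auto
  have "(\<Sum>q\<in>lifts (Md e # Vx v # Md f # p). x ^ wlen q)
      = (\<Sum>z\<in>?G \<times> lifts (Md f # p). x ^ wlen (?F z))"
    by (simp add: sum.reindex[OF inj] del: wlen_simps) 
  also have "\<dots> = (\<Sum>(vs, q)\<in>?G \<times> lifts (Md f # p). x ^ length vs * x ^ wlen q)"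
    by (intro sum.cong) (auto simp: power_add)
  also have "\<dots> = (\<Sum>vs\<in>?G. x ^ length vs) * (\<Sum>q\<in>lifts (Md f # p). x ^ wlen q)"
    by (simp add: sum_product sum.cartesian_product)
  also have "(\<Sum>vs\<in>?G. x ^ length vs) = gf x"
    using step.hyps f ef by (intro gsum_ports x port_port port_inj) auto
  finally show ?case using step.IH finite_gpaths by simp
qed auto

text \<open>Leaving a gadget takes a connecting edge, and these are excluded by the condition on
  \<open>hpos\<close>.\<close>

lemma internal_walk:
  assumes "successively E1 us" "us \<noteq> []" "fst (hd us) = v" "hd us \<in> V1"
    "\<And>\<epsilon>. Md \<epsilon> \<in> set (ilv us) \<Longrightarrow> is_Vx (hpos (Md \<epsilon>))"
  shows "us = map (Pair v) (map snd us) \<and> successively Ge (map snd us) \<and> set (map snd us) \<subseteq> Gv"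
  using assms
proof (induction us rule: ilv.induct)
  case (2 x)
  then show ?case by (cases x) (auto simp: phi_V_def)
next
  case (3 x y us)
  have E: "E1 x y" using "3.prems"(1) by simp
  have nc: "is_Vx (hpos (Md {x, y}))" using "3.prems"(5) by simp
  obtain a b where ab: "x = (v, a)" "y = (v, b)" "Ge a b"
    using E
  proof (cases rule: E1_cases)
    case (1 v' a b)
    then show ?thesis using that "3.prems"(3) by auto
  next
    case (2 u w)
    then have "hpos (Md {x, y}) = Md {u, w}"
      using hpos_hat[of "{u, w}"] edge_setI[of E0 u w] by (simp add: hat_eq)
    then show ?thesis using nc by simp
  qed
  have "y \<in> V1" using E G1.E_V by blast
  then have "y # us = map (Pair v) (map snd (y # us)) \<and> successively Ge (map snd (y # us)) \<and> set (map snd (y # us)) \<subseteq> Gv"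
    using "3.prems" ab by (intro "3.IH") auto
  moreover have "a \<in> Gv" using "3.prems"(4) ab by (auto simp: phi_V_def)
  ultimately show ?case using ab by simp
qed simp

lemma cubic_edges:
  assumes "v \<in> e1" "v \<in> e2" "v \<in> e3" "v \<in> e4"
    and "e1 \<in> edge_set E0" "e2 \<in> edge_set E0" "e3 \<in> edge_set E0" "e4 \<in> edge_set E0"
  shows "\<not> distinct [e1, e2, e3, e4]"
proof
  assume d: "distinct [e1, e2, e3, e4]"
  obtain a1 where a1: "e1 = {v, a1}" "E0 v a1" using assms edge_set_obtain[OF G0(1)] by metis
  obtain a2 where a2: "e2 = {v, a2}" "E0 v a2" using assms edge_set_obtain[OF G0(1)] by metis
  obtain a3 where a3: "e3 = {v, a3}" "E0 v a3" using assms edge_set_obtain[OF G0(1)] by metis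
  obtain a4 where a4: "e4 = {v, a4}" "E0 v a4" using assms edge_set_obtain[OF G0(1)] by metis
  have "card {a1, a2, a3, a4} = 4" using d a1 a2 a3 a4 by auto
  moreover have "card {a1, a2, a3, a4} \<le> card {u. E0 v u}"
    using a1 a2 a3 a4 G0(4) E0_V(1)[OF a1(2)] by (intro card_mono) (auto simp: cubic_def)
  moreover have "card {u. E0 v u} = 3" using G0(4) E0_V(1)[OF a1(2)] by (simp add: cubic_def)
  ultimately show False by simp
qed

text \<open>A gadget entered a second time would need four distinct connecting edges: two around each of
  its two passages.\<close>

lemma mid_saw_is_lift:
  assumes "mid_saw E1 q" "hd q = Md (hat e)" "e \<in> edge_set E0" "last q = Md (hat f)" "f \<in> edge_set E0"
  shows "\<exists>p. mid_to_mid E0 p \<and> q \<in> lifts p \<and> hd p = Md e \<and> last p = Md f"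
  using assms(1-3) assms(4)
proof (induction "length q" arbitrary: q e rule: less_induct)
  case less
  note m = less.prems(1)
  have hat_eqD: "a = b" if "hat a = hat b" "a \<in> edge_set E0" "b \<in> edge_set E0" for a b
    using that fst_hat by metis
  obtain r where q: "q = Md (hat e) # r" using less.prems by (cases q) (auto simp: mid_saw_def)
  show ?case
  proof (cases r)
    case Nil
    then have "f = e" using q less.prems assms(5) hat_eqD by auto
    then show ?thesis using q Nil less.prems(3) by (intro exI[of _ "[Md e]"]) (auto intro: single)
  next
    case (Cons x0 r0)
    obtain x where x0: "x0 = Vx x" "x \<in> hat e" using m q Cons by (cases x0) (auto simp: mid_saw_def)
    obtain v a where x: "x = (v, a)" by (cases x)
    have va: "v \<in> e" "a = port v e" using x0 x in_hat[OF less.prems(3)] by auto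
    let ?nc = "\<lambda>y. is_Vx (hpos y)"
    \<comment> \<open>\<open>P\<close> is the first passage, up to the next connecting edge; the
      rest \<open>q'\<close> starts with that edge and is a lift by induction.\<close>
    define P where "P = takeWhile ?nc r"
    define q' where "q' = dropWhile ?nc r"
    have r: "r = P @ q'" by (simp add: P_def q'_def)
    have "last r = Md (hat f)" using less.prems(4) q Cons by simp
    then have "\<not> ?nc (last r)" using hpos_hat[OF assms(5)] by simp
    then have "\<exists>y\<in>set r. \<not> ?nc y" using Cons by (intro bexI[of _ "last r"]) auto
    then have q'ne: "q' \<noteq> []" unfolding q'_def by (simp add: dropWhile_eq_Nil_conv)
    have Pne: "P \<noteq> []" "hd P = Vx (v, a)" using Cons x0 x by (auto simp: P_def)
    have Pnc: "\<And>y. y \<in> set P \<Longrightarrow> ?nc y" unfolding P_def by (auto dest: set_takeWhileD)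
    have hq': "\<not> ?nc (hd q')" using q'ne unfolding q'_def by (rule hd_dropWhile)
    have mr: "distinct r" "successively (step_ok E1) P" "successively (step_ok E1) q'"
      "step_ok E1 (last P) (hd q')"
      using m Pne q'ne by (auto simp: q r mid_saw_def successively_Cons successively_append_iff)
    obtain \<epsilon> where eps: "hd q' = Md \<epsilon>" using hq' by (cases "hd q'") auto
    obtain y where y: "last P = Vx y" "y \<in> \<epsilon>" "\<epsilon> \<in> edge_set E1"
      using mr(4) eps by (cases "last P") auto
    obtain g where g: "hpos (Md \<epsilon>) = Md g" using hq' eps by (cases "hpos (Md \<epsilon>)") auto
    have gE: "g \<in> edge_set E0" "\<epsilon> = hat g" using hpos_edge[OF y(3) g] by auto
    have vV: "v \<in> V0" using va less.prems(3) G0.edge_V by blast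
    obtain us t where us: "us \<noteq> []" "hd us = (v, a)" "distinct us" "successively E1 us" "P = ilv us @ t"
      "t = [] \<or> (\<exists>f. t = [Md f] \<and> f \<in> edge_set E1 \<and> last us \<in> f)"
      by (rule mid_walk_from_vertex[OF simple1 mr(2) _ Pne]) (use mr(1) r in auto)
    have t: "t = []" using us(6) y(1) us(5) by auto
    have aG: "a \<in> Gv" using va(2) port_port[OF less.prems(3) va(1)] gadget_facts(4) by auto
    define vs where "vs = map snd us"
    have vs: "us = map (Pair v) vs" "successively Ge vs" "set vs \<subseteq> Gv"
      using internal_walk[OF us(4,1), of v] us(2) Pnc us(5) vV aG unfolding vs_def by (auto simp: phi_V_def)
    have lus: "last us = y" using y(1) us t by simp
    have yg: "y = (v, port v g)" "v \<in> g"
    proof -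
      have "fst y = v" using lus vs(1) us(1) by (auto simp: last_map)
      then have "y = (v, snd y)" by auto
      then show "y = (v, port v g)" "v \<in> g" using in_hat[OF gE(1), of v "snd y"] y(2) gE(2) by auto
    qed
    have gp: "vs \<in> gpaths (port v e) (port v g)"
    proof -
      have "vs \<noteq> []" using us(1) vs(1) by auto
      moreover have "hd vs = a" "last vs = port v g"
        using us(2) lus yg(1) calculation unfolding vs(1) by (auto simp: hd_map last_map)
      moreover have "distinct vs" using us(3) vs(1) by (simp add: distinct_map)
      ultimately show ?thesis using vs va by (auto simp: gpaths_def)
    qed
    have mq': "mid_saw E1 q'" using mr q'ne r by (auto simp: mid_saw_def)
    have "length q' < length q" using q r by simp
    moreover have "last q' = Md (hat f)" using less.prems(4) q r q'ne by simp
    moreover have hdq': "hd q' = Md (hat g)" using eps gE by simp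
    ultimately obtain p' where p': "mid_to_mid E0 p'" "q' \<in> lifts p'" "hd p' = Md g" "last p' = Md f"
      using less.hyps[of q' g] mq' gE(1) by blast
    have p'ne: "p' \<noteq> []" using mid_to_mid_D[OF p'(1)] by (auto simp: mid_saw_def)
    then obtain r' where r': "p' = Md g # r'" using p'(3) by (cases p') auto
    have sp: "set p' = hpos ` set q'" using lifts_gproj[OF p'(1,2)] set_gproj[of q'] by simp
    have dp: "distinct p'" using mid_to_mid_D[OF p'(1)] by (simp add: mid_saw_def)
    have dq: "distinct q" using m by (simp add: mid_saw_def)
    have e_notin: "Md e \<notin> set p'"
    proof
      assume "Md e \<in> set p'"
      then obtain z where z: "z \<in> set q'" "hpos z = Md e" using sp by auto
      obtain \<zeta> where zz: "z = Md \<zeta>" using z(2) by (cases z) auto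
      have "\<zeta> \<in> edge_set E1"
        using mid_saw_edges[OF mq' hdq' hat_edge[OF gE(1)]] z zz by blast
      then have "\<zeta> = hat e" using hpos_edge z zz by blast
      then show False using dq q r z zz by auto
    qed
    have v_notin: "Vx v \<notin> set p'"
    proof
      assume vp: "Vx v \<in> set p'"
      obtain A e1 e2 B where AB: "p' = A @ Md e1 # Vx v # Md e2 # B" "v \<in> e1" "v \<in> e2"
        using mid_to_mid_nbrs[OF p'(1) vp] by (elim exE conjE) (rule that)
      have e12: "e1 \<in> edge_set E0" "e2 \<in> edge_set E0"
        using mid_to_mid_edges[OF p'(1)] AB(1) by auto
      \<comment> \<open>\<open>e\<close> and \<open>g\<close> enclose the first passage,
        \<open>e1\<close> and \<open>e2\<close> the supposed second one. At degree 3 two of them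
        coincide, and self-avoidance leaves only coincidences of \<open>g\<close> with
        \<open>e1\<close> or \<open>e2\<close>.\<close>
      have "e \<noteq> g" using e_notin r' by auto
      moreover have "e \<noteq> e1" "e \<noteq> e2" using e_notin AB(1) by auto
      moreover have "e1 \<noteq> e2" using dp AB(1) by auto
      moreover have "\<not> distinct [e, g, e1, e2]"
        using va(1) yg(2) AB(2,3) less.prems(3) gE(1) e12 by (rule cubic_edges)
      ultimately have "g = e1 \<or> g = e2" by auto
      moreover have "g \<noteq> e2" using dp AB(1) r' by (cases A) auto
      ultimately have ge1: "g = e1" by blast
      have "A = []" using dp AB(1) r' ge1 by (cases A) auto
      then have "p' = Md g # Vx v # Md e2 # B" using AB(1) ge1 by simp
      then obtain ws z where ws: "ws \<in> gpaths (port v g) (port v e2)"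
        "q' = Md (hat g) # ilv (map (Pair v) ws) @ z" using p'(2) by auto
      \<comment> \<open>With \<open>g = e1\<close> the walk would turn back along \<open>g\<close>
        at once and re-enter the gadget through the very port vertex where \<open>P\<close>
        ended.\<close>
      have "Vx (v, port v g) \<in> set q'"
        using ws hd_in_set[of ws] by (auto simp: gpaths_def)
      moreover have "Vx (v, port v g) \<in> set P" using y(1) yg(1) Pne(1) last_in_set by metis
      ultimately show False using mr(1) r by auto
    qed
    have "mid_to_mid E0 (Md e # Vx v # p')"
      unfolding r' by (rule mid_to_mid.step) (use p'(1) r' less.prems(3) va(1) yg(2) e_notin v_notin in auto)
    moreover have "q = Md (hat e) # ilv (map (Pair v) vs) @ q'" using q r us(5) t vs(1) by simp
    then have "q \<in> lifts (Md e # Vx v # p')"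
      unfolding r' using gp p'(2) r' by auto
    ultimately show ?thesis using p'(4) p'ne by (intro exI[of _ "Md e # Vx v # p'"]) auto
  qed
qed

end

section \<open>Comparison of the generating functions\<close>

text \<open>Common weight for both exponents: \<open>Y\<close> uses arbitrary \<open>y\<close>, and
  \<open>y = 0\<close> gives the terms of \<open>Z\<close>.\<close>

definition wt :: "real \<Rightarrow> real \<Rightarrow> nat \<Rightarrow> real" where
  "wt x y n = x ^ n / (if n = 0 then 1 else real n powr y)"

lemma wt_max: "wt x y n = x ^ n * real (max 1 n) powr (- y)"
  by (auto simp: wt_def powr_minus divide_inverse max_def)

lemma wt_nonneg: "x \<ge> 0 \<Longrightarrow> wt x y n \<ge> 0"
  by (simp add: wt_max)

text \<open>Comparability in both directions is required because the sign of \<open>z\<close> is not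
  fixed.\<close>

lemma powr_compare:
  fixes a b K z :: real
  assumes "a > 0" "b > 0" "a \<le> K * b" "b \<le> K * a" "K \<ge> 1"
  shows "a powr z \<le> K powr \<bar>z\<bar> * b powr z"
proof (cases "z \<ge> 0")
  case True
  have "a powr z \<le> (K * b) powr z" using assms True by (intro powr_mono2) auto
  then show ?thesis using assms True by (simp add: powr_mult)
next
  case False
  have "a powr z \<le> (b / K) powr z" using assms False by (intro powr_mono2') (auto simp: field_simps)
  also have "\<dots> = K powr \<bar>z\<bar> * b powr z"
    using assms False by (simp add: powr_divide powr_minus field_simps)
  finally show ?thesis .
qed

lemma max_1_powr_compare:
  assumes "m \<le> n" "n \<le> K * max 1 m" "K \<ge> 1"
  shows "real (max 1 n) powr z \<le> real K powr \<bar>z\<bar> * real (max 1 m) powr z"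
    and "real (max 1 m) powr z \<le> real K powr \<bar>z\<bar> * real (max 1 n) powr z"
proof -
  have 1: "max 1 n \<le> K * max 1 m" using assms by (auto simp: max_def split: if_splits)
  have "max 1 m \<le> 1 * max 1 n" using assms by auto
  also have "\<dots> \<le> K * max 1 n" using assms by (intro mult_le_mono1)
  finally have 2: "max 1 m \<le> K * max 1 n" .
  have "real (max 1 n) \<le> real K * real (max 1 m)" "real (max 1 m) \<le> real K * real (max 1 n)"
    using 1 2 by (simp_all only: of_nat_le_iff flip: of_nat_mult)
  then show "real (max 1 n) powr z \<le> real K powr \<bar>z\<bar> * real (max 1 m) powr z"
    and "real (max 1 m) powr z \<le> real K powr \<bar>z\<bar> * real (max 1 n) powr z"
    using assms by (auto intro!: powr_compare simp del: of_nat_max)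
qed

lemma card_short_lists:
  assumes "finite S" "card S \<le> k"
  shows "finite {xs. set xs \<subseteq> S \<and> length xs \<le> k} \<and>
    card {xs. set xs \<subseteq> S \<and> length xs \<le> k} \<le> (\<Sum>i\<le>k. k ^ i)"
  using assms card_lists_length_le[OF assms(1), of k] finite_lists_length_le[OF assms(1), of k]
  by (auto intro!: sum_mono power_mono)

context local_transf begin

text \<open>\<open>T\<close> is the set of admissible final edges: all of them for \<open>\<gamma>\<close>, the translates of the initial
  ones for \<open>\<eta>\<close>.\<close>

definition M0 :: "'v set set \<Rightarrow> 'v pos list set" where
  "M0 T = {p \<in> Sig E0 W0. \<exists>f\<in>T. last p = Md f}"

definition M1 :: "'v set set \<Rightarrow> ('v \<times> 'g) pos list set" where
  "M1 T = {q. mid_saw E1 q \<and> (\<exists>e\<in>inc_edges E0 W0. hd q = Md (hat e)) \<and> (\<exists>f\<in>T. last q = Md (hat f))}"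

lemma M0_mid_to_mid: "p \<in> M0 T \<Longrightarrow> mid_to_mid E0 p"
  by (auto simp: M0_def Sig_def inc_edges_def intro: mid_to_midI)

lemma lifts_M1:
  assumes p: "p \<in> M0 T" and q: "q \<in> lifts p"
  shows "q \<in> M1 T"
proof -
  note m = M0_mid_to_mid[OF p]
  obtain e where e: "e \<in> inc_edges E0 W0" "hd p = Md e" using p by (auto simp: M0_def Sig_def)
  obtain p' where p': "p = Md e # p'" using e p by (cases p) (auto simp: M0_def Sig_def mid_saw_def)
  obtain q' where "q = Md (hat e) # q'" using lifts_Cons q p' by blast
  moreover obtain f where "last p = Md f" "last q = Md (hat f)" using lifts_bounds[OF m q] by blast
  ultimately show ?thesis using p e lifts_mid_saw[OF m q] by (auto simp: M0_def M1_def)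
qed

lemma M1_lifts:
  assumes T: "T \<subseteq> edge_set E0" and q: "q \<in> M1 T"
  shows "gproj q \<in> M0 T" "q \<in> lifts (gproj q)"
proof -
  obtain e f where ef: "mid_saw E1 q" "hd q = Md (hat e)" "e \<in> inc_edges E0 W0" "last q = Md (hat f)" "f \<in> T"
    using q by (auto simp: M1_def)
  have "e \<in> edge_set E0" "f \<in> edge_set E0" using ef T by (auto simp: inc_edges_def)
  then obtain p where p: "mid_to_mid E0 p" "q \<in> lifts p" "hd p = Md e" "last p = Md f"
    using mid_saw_is_lift[OF ef(1,2) _ ef(4)] by blast
  have gp: "gproj q = p" by (rule lifts_gproj[OF p(1,2)])
  show "q \<in> lifts (gproj q)" using p(2) gp by simp
  show "gproj q \<in> M0 T"
    using gp p ef mid_to_mid_D[OF p(1)] by (auto simp: M0_def Sig_def)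
qed

lemma card_Gv_ge_1: "card Gv \<ge> 1"
  using gadget_facts(1,4) by (auto simp: Suc_le_eq card_gt_0_iff)

lemma wlen_lifts:
  assumes "p \<in> M0 T" "q \<in> lifts p"
  shows "wlen p \<le> wlen q" "wlen q \<le> card Gv * max 1 (wlen p)"
proof -
  have b: "wlen p \<le> wlen q \<and> wlen q \<le> card Gv * wlen p"
    using lifts_bounds[OF M0_mid_to_mid[OF assms(1)] assms(2)] by blast
  have "card Gv * wlen p \<le> card Gv * max 1 (wlen p)" by (intro mult_le_mono2) auto
  then show "wlen p \<le> wlen q" "wlen q \<le> card Gv * max 1 (wlen p)" using b by linarith+
qed

text \<open>The fibre of \<open>gproj\<close> over \<open>p\<close> consists of lifts of
  \<open>p\<close>, whose powers of \<open>x\<close> add up to \<open>gf x ^ wlen p\<close>. Lengths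
  differ by a ratio of at most \<open>card Gv\<close>, which costs the factor in front.\<close>

lemma sum_M1_le:
  assumes T: "T \<subseteq> edge_set E0" and x: "x > 0"
  shows "(\<Sum>\<^sub>\<infinity>q\<in>M1 T. ennreal (wt x y (wlen q)))
    \<le> ennreal (real (card Gv) powr \<bar>y\<bar>) * (\<Sum>\<^sub>\<infinity>p\<in>M0 T. ennreal (wt (gf x) y (wlen p)))"
proof -
  let ?D = "real (card Gv) powr \<bar>y\<bar>"
  have "(\<Sum>\<^sub>\<infinity>q\<in>M1 T. ennreal (wt x y (wlen q)))
    \<le> (\<Sum>\<^sub>\<infinity>p\<in>M0 T. ennreal ?D * ennreal (wt (gf x) y (wlen p)))"
  proof (rule infsum_ennreal_fibres_le[where h = gproj])
    show "gproj ` M1 T \<subseteq> M0 T" using M1_lifts[OF T] by blast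
    fix p F assume p: "p \<in> M0 T" and F: "finite F" "F \<subseteq> {q \<in> M1 T. gproj q = p}"
    have Fl: "F \<subseteq> lifts p" using F M1_lifts[OF T] by blast
    have fin: "finite (lifts p)" and sm: "(\<Sum>q\<in>lifts p. x ^ wlen q) = gf x ^ wlen p"
      using lifts_sum[OF M0_mid_to_mid[OF p] x] by auto
    let ?m = "real (max 1 (wlen p)) powr (- y)"
    have "(\<Sum>q\<in>F. wt x y (wlen q)) \<le> (\<Sum>q\<in>lifts p. wt x y (wlen q))"
      using Fl fin x by (intro sum_mono2) (auto intro: wt_nonneg)
    also have "\<dots> \<le> (\<Sum>q\<in>lifts p. x ^ wlen q * (?D * ?m))"
    proof (intro sum_mono)
      fix q assume q: "q \<in> lifts p"
      have "real (max 1 (wlen q)) powr (- y) \<le> real (card Gv) powr \<bar>- y\<bar> * ?m"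
        using wlen_lifts[OF p q] card_Gv_ge_1 by (rule max_1_powr_compare(1))
      then show "wt x y (wlen q) \<le> x ^ wlen q * (?D * ?m)"
        unfolding wt_max using x by (intro mult_left_mono) auto
    qed
    also have "\<dots> = ?D * wt (gf x) y (wlen p)"
      by (simp add: sum_distrib_right[symmetric] sm wt_max)
    finally have "(\<Sum>q\<in>F. wt x y (wlen q)) \<le> ?D * wt (gf x) y (wlen p)" .
    then show "(\<Sum>q\<in>F. ennreal (wt x y (wlen q))) \<le> ennreal ?D * ennreal (wt (gf x) y (wlen p))"
      using x gf_pos[OF x] by (simp add: sum_ennreal wt_nonneg ennreal_mult[symmetric] ennreal_leI)
  qed
  then show ?thesis by (simp add: infsum_ennreal_cmult)
qed

text \<open>Lifts of different walks are disjoint because \<open>gproj\<close> recovers the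
  walk.\<close>

lemma sum_M1_ge:
  assumes x: "x > 0"
  shows "(\<Sum>\<^sub>\<infinity>p\<in>M0 T. ennreal (wt (gf x) y (wlen p)))
    \<le> ennreal (real (card Gv) powr \<bar>y\<bar>) * (\<Sum>\<^sub>\<infinity>q\<in>M1 T. ennreal (wt x y (wlen q)))"
proof -
  let ?D = "real (card Gv) powr \<bar>y\<bar>"
  have "(\<Sum>\<^sub>\<infinity>p\<in>M0 T. ennreal (wt (gf x) y (wlen p)))
    \<le> (\<Sum>\<^sub>\<infinity>q\<in>M1 T. ennreal ?D * ennreal (wt x y (wlen q)))"
  proof (rule infsum_ennreal_ge_disjoint[where L = lifts])
    fix p assume p: "p \<in> M0 T"
    have fin: "finite (lifts p)" and sm: "(\<Sum>q\<in>lifts p. x ^ wlen q) = gf x ^ wlen p"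
      using lifts_sum[OF M0_mid_to_mid[OF p] x] by auto
    show "finite (lifts p) \<and> lifts p \<subseteq> M1 T" using fin lifts_M1[OF p] by blast
    let ?m = "real (max 1 (wlen p)) powr (- y)"
    have "wt (gf x) y (wlen p) = (\<Sum>q\<in>lifts p. x ^ wlen q * ?m)"
      by (simp add: sum_distrib_right[symmetric] sm wt_max)
    also have "\<dots> \<le> (\<Sum>q\<in>lifts p. ?D * wt x y (wlen q))"
    proof (intro sum_mono)
      fix q assume q: "q \<in> lifts p"
      have "?m \<le> real (card Gv) powr \<bar>- y\<bar> * real (max 1 (wlen q)) powr (- y)"
        using wlen_lifts[OF p q] card_Gv_ge_1 by (rule max_1_powr_compare(2))
      then have "x ^ wlen q * ?m \<le> x ^ wlen q * (?D * real (max 1 (wlen q)) powr (- y))"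
        using x by (intro mult_left_mono) auto
      then show "x ^ wlen q * ?m \<le> ?D * wt x y (wlen q)" by (simp add: wt_max mult.left_commute)
    qed
    finally have "ennreal (wt (gf x) y (wlen p)) \<le> ennreal (\<Sum>q\<in>lifts p. ?D * wt x y (wlen q))"
      by (rule ennreal_leI)
    also have "\<dots> = (\<Sum>q\<in>lifts p. ennreal ?D * ennreal (wt x y (wlen q)))"
      using x by (simp add: sum_ennreal[symmetric] wt_nonneg ennreal_mult)
    finally show "ennreal (wt (gf x) y (wlen p)) \<le> (\<Sum>q\<in>lifts p. ennreal ?D * ennreal (wt x y (wlen q)))" .
  next
    fix p p' assume pp: "p \<in> M0 T" "p' \<in> M0 T" "p \<noteq> p'"
    show "lifts p \<inter> lifts p' = {}"
      using lifts_gproj[OF M0_mid_to_mid[OF pp(1)]] lifts_gproj[OF M0_mid_to_mid[OF pp(2)]] pp(3) by blast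
  qed
  then show ?thesis by (simp add: infsum_ennreal_cmult)
qed

lemma hat_inc: "e \<in> inc_edges E0 W0 \<Longrightarrow> hat e \<in> inc_edges E1 W1"
proof -
  assume "e \<in> inc_edges E0 W0"
  then obtain w where w: "e \<in> edge_set E0" "w \<in> W0" "w \<in> e" by (auto simp: inc_edges_def)
  have "(w, port w e) \<in> hat e" using w in_hat by blast
  moreover have "(w, port w e) \<in> W1" using w port_port[OF w(1,3)] gadget_facts(4) by auto
  ultimately show ?thesis using hat_edge[OF w(1)] by (auto simp: inc_edges_def)
qed

lemma M1_Sig: "M1 T \<subseteq> Sig E1 W1"
  using hat_inc by (auto simp: M1_def Sig_def)

section \<open>Trimming a walk of the transformed graph to its connecting edges\<close>

definition gpos :: "'v \<Rightarrow> ('v \<times> 'g) pos set" where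
  "gpos v = Vx ` ({v} \<times> Gv) \<union> Md ` Pow ({v} \<times> Gv)"

lemma finite_gpos: "finite (gpos v)"
  using gadget_facts(1) by (auto simp: gpos_def)

lemma card_gpos: "card (gpos v) \<le> card Gv + 2 ^ card Gv"
proof -
  have "card (gpos v) \<le> card (Vx ` ({v} \<times> Gv)) + card (Md ` Pow ({v} \<times> Gv))"
    unfolding gpos_def by (rule card_Un_le)
  also have "\<dots> \<le> card ({v} \<times> Gv) + card (Pow ({v} \<times> Gv))"
    using gadget_facts(1) by (intro add_mono card_image_le) auto
  finally show ?thesis using gadget_facts(1) by (simp add: card_Pow card_cartesian_product)
qed

definition valid_pos :: "('v \<times> 'g) pos \<Rightarrow> bool" where
  "valid_pos x = (case x of Vx y \<Rightarrow> y \<in> V1 | Md \<epsilon> \<Rightarrow> \<epsilon> \<in> edge_set E1)"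

abbreviation inn :: "('v \<times> 'g) pos \<Rightarrow> bool" where
  "inn x \<equiv> is_Vx (hpos x)"

lemma hpos_Md_singleton:
  assumes "inn (Md \<epsilon>)" "y \<in> \<epsilon>"
  shows "fst ` \<epsilon> = {fst y}" "hpos (Md \<epsilon>) = Vx (fst y)"
proof -
  have "is_singleton (fst ` \<epsilon>)" using assms(1) by (auto simp: hpos_def split: if_splits)
  then obtain a where "fst ` \<epsilon> = {a}" by (auto simp: is_singleton_def)
  then show "fst ` \<epsilon> = {fst y}" using assms(2) by auto
  then show "hpos (Md \<epsilon>) = Vx (fst y)" by (simp add: hpos_def)
qed

lemma inn_gpos:
  assumes "valid_pos x" "hpos x = Vx v"
  shows "x \<in> gpos v"
proof (cases x)
  case (Vx y)
  then show ?thesis using assms by (cases y) (auto simp: valid_pos_def gpos_def phi_V_def)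
next
  case (Md \<epsilon>)
  then have e: "\<epsilon> \<in> edge_set E1" using assms by (simp add: valid_pos_def)
  then obtain y where y: "y \<in> \<epsilon>" by (auto simp: edge_set_def)
  have "fst ` \<epsilon> = {v}" using hpos_Md_singleton[OF _ y] assms Md by auto
  moreover have "\<epsilon> \<subseteq> V1" using e by (rule G1.edge_V)
  ultimately have "\<epsilon> \<subseteq> {v} \<times> Gv" by (force simp: phi_V_def)
  then show ?thesis using Md by (simp add: gpos_def)
qed

lemma gpos_Md: "Md \<epsilon> \<in> gpos v \<Longrightarrow> y \<in> \<epsilon> \<Longrightarrow> fst y = v"
  by (auto simp: gpos_def)

lemma step_inn: "step_ok E1 a b \<Longrightarrow> inn a \<Longrightarrow> inn b \<Longrightarrow> hpos a = hpos b"
  by (cases a; cases b) (auto dest: hpos_Md_singleton(2))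

text \<open>Without a connecting edge a walk cannot change gadget, so its projection is
  constant.\<close>

lemma inn_walk_const:
  assumes "successively (step_ok E1) p" "\<forall>x\<in>set p. inn x" "x \<in> set p"
  shows "hpos x = hpos (hd p)"
  using assms
proof (induction p)
  case (Cons a p)
  show ?case
  proof (cases "p = []")
    case False
    then have "hpos a = hpos (hd p)" using Cons.prems by (auto simp: successively_Cons intro!: step_inn)
    then show ?thesis using Cons False by (auto simp: successively_Cons)
  qed (use Cons in auto)
qed simp

lemma mid_saw_valid:
  assumes "mid_saw E1 p" "hd p = Md \<epsilon>" "\<epsilon> \<in> edge_set E1" "x \<in> set p"
  shows "valid_pos x"
proof (cases x)
  case (Md f)
  then show ?thesis using mid_saw_edges[OF assms(1-3)] assms(4) by (simp add: valid_pos_def)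
next
  case (Vx y)
  obtain A B where p: "p = A @ Vx y # B" using split_list assms(4) Vx by metis
  have "A \<noteq> []" using p assms(2) by auto
  then have "step_ok E1 (last A) (Vx y)" using assms(1) p by (auto simp: mid_saw_def successively_append_iff)
  then have "\<exists>e\<in>edge_set E1. y \<in> e" by (cases "last A") auto
  then show ?thesis using Vx G1.edge_V by (auto simp: valid_pos_def)
qed

text \<open>The part of a walk between its first and last edges that join two gadgets.\<close>

definition core :: "('v \<times> 'g) pos list \<Rightarrow> ('v \<times> 'g) pos list" where
  "core p = rev (dropWhile inn (rev (dropWhile inn p)))"

lemma core_split:
  assumes "\<exists>x\<in>set p. \<not> inn x"
  shows "\<exists>A B. p = A @ core p @ B \<and> core p \<noteq> [] \<and> (\<forall>x\<in>set A \<union> set B. inn x) \<and>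
    \<not> inn (hd (core p)) \<and> \<not> inn (last (core p))"
proof -
  define p1 where "p1 = dropWhile inn p"
  define A where "A = takeWhile inn p"
  define B where "B = rev (takeWhile inn (rev p1))"
  have p: "p = A @ p1" by (simp add: A_def p1_def)
  have c: "core p = rev (dropWhile inn (rev p1))" by (simp add: core_def p1_def)
  have "rev p1 = takeWhile inn (rev p1) @ dropWhile inn (rev p1)" by simp
  then have p1: "p1 = core p @ B" unfolding c B_def by (metis rev_append rev_rev_ident)
  have ne: "p1 \<noteq> []" using assms by (simp add: p1_def dropWhile_eq_Nil_conv)
  have h: "\<not> inn (hd p1)" using hd_dropWhile ne unfolding p1_def by metis
  have ne2: "dropWhile inn (rev p1) \<noteq> []" using ne h by (auto simp: dropWhile_eq_Nil_conv)
  then have cne: "core p \<noteq> []" by (simp add: c)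
  have "\<not> inn (hd (dropWhile inn (rev p1)))" using ne2 by (rule hd_dropWhile)
  then have l: "\<not> inn (last (core p))" by (simp add: c last_rev)
  have "hd p1 = hd (core p)" using p1 cne by (metis hd_append2)
  then have "\<not> inn (hd (core p))" using h by simp
  moreover have "\<forall>x\<in>set A \<union> set B. inn x" by (auto simp: A_def B_def dest: set_takeWhileD)
  ultimately show ?thesis using p p1 cne l by metis
qed

lemma not_inn_hat:
  assumes "valid_pos x" "\<not> inn x"
  obtains e where "e \<in> edge_set E0" "x = Md (hat e)"
proof (cases x)
  case (Md \<epsilon>)
  obtain e where e: "hpos (Md \<epsilon>) = Md e" using assms(2) Md by (cases "hpos (Md \<epsilon>)") auto
  have "\<epsilon> \<in> edge_set E1" using assms(1) Md by (simp add: valid_pos_def)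
  then show ?thesis using hpos_edge[OF _ e] that Md by blast
qed (use assms in auto)

text \<open>The removed start \<open>A\<close> lies in the gadget over the \<open>W0\<close>-end of
  the first edge, so the core starts at an edge incident to \<open>W0\<close>. The removed end
  \<open>B\<close> lies in one gadget at an end of the last connecting edge. Hence \<open>A\<close>
  and \<open>B\<close> admit boundedly many choices.\<close>

lemma core_props:
  assumes p: "p \<in> Sig E1 W1" and ex: "\<exists>x\<in>set p. \<not> inn x"
  obtains A B e f where "p = A @ core p @ B" "mid_saw E1 (core p)"
    "e \<in> inc_edges E0 W0" "hd (core p) = Md (hat e)" "f \<in> edge_set E0" "last (core p) = Md (hat f)"
    "set A \<subseteq> (\<Union>v\<in>W0. gpos v)" "distinct A" "distinct B" "B = [] \<or> (\<exists>u\<in>f. set B \<subseteq> gpos u)"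
proof -
  obtain A B where AB: "p = A @ core p @ B" "core p \<noteq> []" "\<forall>x\<in>set A \<union> set B. inn x"
    "\<not> inn (hd (core p))" "\<not> inn (last (core p))" using core_split[OF ex] by blast
  obtain C where C: "C = core p" by blast
  note AB = AB[folded C]
  have m: "mid_saw E1 p" using p by (simp add: Sig_def)
  obtain \<epsilon> where eps: "\<epsilon> \<in> inc_edges E1 W1" "hd p = Md \<epsilon>" using p by (auto simp: Sig_def)
  have epsE: "\<epsilon> \<in> edge_set E1" using eps by (simp add: inc_edges_def)
  obtain w where w: "w \<in> W1" "w \<in> \<epsilon>" using eps by (auto simp: inc_edges_def)
  have val: "\<And>x. x \<in> set p \<Longrightarrow> valid_pos x" using mid_saw_valid[OF m eps(2) epsE] .
  have sC: "set C \<subseteq> set p" "set A \<subseteq> set p" "set B \<subseteq> set p" using AB(1) by auto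
  have "hd C \<in> set p" "last C \<in> set p" using sC(1) AB(2) by auto
  then obtain e f where e: "e \<in> edge_set E0" "hd C = Md (hat e)" and f: "f \<in> edge_set E0" "last C = Md (hat f)"
    using not_inn_hat AB(4,5) val by metis
  have suc: "successively (step_ok E1) A" "successively (step_ok E1) C" "successively (step_ok E1) B"
    "A \<noteq> [] \<Longrightarrow> step_ok E1 (last A) (hd C)" "B \<noteq> [] \<Longrightarrow> step_ok E1 (last C) (hd B)"
    "distinct A" "distinct B" "distinct C"
    using m AB(1,2) by (auto simp: mid_saw_def successively_append_iff)
  have eA: "e \<in> inc_edges E0 W0 \<and> set A \<subseteq> (\<Union>v\<in>W0. gpos v)"
  proof (cases "A = []")
    case True
    then have "hd p = hd C" using AB(1,2) by (metis append_Nil hd_append2)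
    then have "w \<in> hat e" using eps(2) e(2) w by simp
    then have "fst w \<in> e" using fst_hat[OF e(1)] by blast
    then show ?thesis using True e w by (auto simp: inc_edges_def)
  next
    case False
    have hA: "hd A = Md \<epsilon>" using eps(2) AB(1) False by (metis hd_append2)
    have "inn (hd A)" using AB(3) False by simp
    then have hw: "hpos (hd A) = Vx (fst w)" using hpos_Md_singleton(2) w(2) hA by metis
    have all: "hpos x = Vx (fst w)" if "x \<in> set A" for x
      using inn_walk_const[OF suc(1) _ that] AB(3) hw by auto
    have "step_ok E1 (last A) (Md (hat e))" using suc(4)[OF False] e by simp
    then obtain y where y: "last A = Vx y" "y \<in> hat e" by (cases "last A") auto
    have "fst y = fst w" using all[of "last A"] y last_in_set[OF False] by simp
    moreover have "fst y \<in> e" using y fst_hat[OF e(1)] by blast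
    ultimately have "e \<in> inc_edges E0 W0" using e w by (auto simp: inc_edges_def)
    moreover have "set A \<subseteq> gpos (fst w)" using all inn_gpos val sC(2) by blast
    moreover have "fst w \<in> W0" using w by auto
    ultimately show ?thesis by blast
  qed
  have fB: "B = [] \<or> (\<exists>u\<in>f. set B \<subseteq> gpos u)"
  proof (cases "B = []")
    case False
    have "step_ok E1 (Md (hat f)) (hd B)" using suc(5)[OF False] f by simp
    then obtain y where y: "hd B = Vx y" "y \<in> hat f" by (cases "hd B") auto
    have all: "hpos x = Vx (fst y)" if "x \<in> set B" for x
      using inn_walk_const[OF suc(3) _ that] AB(3) y by auto
    have "set B \<subseteq> gpos (fst y)" using all inn_gpos val sC(3) by blast
    moreover have "fst y \<in> f" using y fst_hat[OF f(1)] by blast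
    ultimately show ?thesis by blast
  qed simp
  have mC: "mid_saw E1 C" using suc AB(2) by (simp add: mid_saw_def)
  show ?thesis
    by (rule that[folded C, OF AB(1) mC conjunct1[OF eA] e(2) f conjunct2[OF eA] suc(6,7) fB])
qed

end

lemma wt_shift_le:
  assumes x: "x > 0" and "m \<le> n" "n \<le> m + L"
  shows "wt x y n \<le> max 1 x ^ L * real (1 + L) powr \<bar>y\<bar> * wt x y m"
proof -
  obtain a where a: "n = m + a" "a \<le> L" using assms by (metis add_le_cancel_left le_iff_add)
  have "x ^ a \<le> max 1 x ^ a" using x by (intro power_mono) auto
  also have "\<dots> \<le> max 1 x ^ L" using a by (intro power_increasing) auto
  finally have 1: "x ^ n \<le> max 1 x ^ L * x ^ m" using a x by (simp add: power_add mult.commute)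
  have "n \<le> max 1 m + L" using assms by simp
  also have "\<dots> \<le> (1 + L) * max 1 m" by (auto simp: max_def)
  finally have "n \<le> (1 + L) * max 1 m" .
  then have 2: "real (max 1 n) powr (- y) \<le> real (1 + L) powr \<bar>- y\<bar> * real (max 1 m) powr (- y)"
    using assms by (intro max_1_powr_compare) auto
  have "x ^ n * real (max 1 n) powr (- y)
      \<le> (max 1 x ^ L * x ^ m) * (real (1 + L) powr \<bar>- y\<bar> * real (max 1 m) powr (- y))"
    using 1 2 x by (intro mult_mono) auto
  also have "\<dots> = max 1 x ^ L * real (1 + L) powr \<bar>y\<bar> * wt x y m" unfolding wt_max by simp
  finally show ?thesis unfolding wt_max[of x y n] .
qed

lemma wlen_le_length: "wlen p \<le> length p"
  by (simp add: wlen_def)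

lemma Yfun_wt: "Yfun E W x y = (\<Sum>\<^sub>\<infinity>p\<in>Sig E W. ennreal (wt x y (wlen p)))"
  by (simp add: Yfun_def wt_def)

section \<open>The series of the two graphs are finite together\<close>

context local_transf begin

text \<open>Each core is shared by boundedly many walks, and trimming removes boundedly many
  vertices. The constant is chosen before \<open>S\<close> and \<open>T\<close>, since for
  \<open>\<eta>\<close> the final edges in \<open>T\<close> move with the automorphism.\<close>

lemma core_sum_le:
  assumes x: "x > 0"
  shows "\<exists>c::real. \<forall>S T. S \<subseteq> Sig E1 W1 \<longrightarrow> (\<forall>p\<in>S. (\<exists>z\<in>set p. \<not> inn z) \<and> core p \<in> M1 T) \<longrightarrow>
    (\<Sum>\<^sub>\<infinity>p\<in>S. ennreal (wt x y (wlen p))) \<le> ennreal c * (\<Sum>\<^sub>\<infinity>q\<in>M1 T. ennreal (wt x y (wlen q)))"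
proof -
  let ?PW = "\<Union>v\<in>W0. gpos v"
  define a where "a = card ?PW"
  define b where "b = card Gv + 2 ^ card Gv"
  define NA where "NA = (\<Sum>i\<le>a. a ^ i)"
  define NB where "NB = (\<Sum>i\<le>b. b ^ i)"
  have fPW: "finite ?PW" using G0.W_fin finite_gpos by auto
  let ?FA = "{xs. set xs \<subseteq> ?PW \<and> length xs \<le> a}"
  let ?G = "\<lambda>u. {xs. set xs \<subseteq> gpos u \<and> length xs \<le> b}"
  have FA: "finite ?FA" "card ?FA \<le> NA"
    using card_short_lists[OF fPW, of a] by (auto simp: NA_def a_def)
  have G: "finite (?G u)" "card (?G u) \<le> NB" for u
    using card_short_lists[OF finite_gpos, of u b] card_gpos[of u] by (auto simp: NB_def b_def)
  \<comment> \<open>At most \<open>NA\<close> choices for the removed start and \<open>NB\<close>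
    for the removed end in each of the two gadgets joined by the last edge of the core.\<close>
  define K where "K = NA * (2 * NB)"
  define c0 where "c0 = max 1 x ^ (a + b) * real (1 + (a + b)) powr \<bar>y\<bar>"
  have c0: "c0 \<ge> 0" by (simp add: c0_def)
  have "(\<Sum>\<^sub>\<infinity>p\<in>S. ennreal (wt x y (wlen p))) \<le> ennreal (real K * c0) * (\<Sum>\<^sub>\<infinity>q\<in>M1 T. ennreal (wt x y (wlen q)))"
    if S: "S \<subseteq> Sig E1 W1" and cS: "\<forall>p\<in>S. (\<exists>z\<in>set p. \<not> inn z) \<and> core p \<in> M1 T" for S T
  proof -
    have dec: "\<exists>A B f. p = A @ core p @ B \<and> f \<in> edge_set E0 \<and> last (core p) = Md (hat f) \<and>
        A \<in> ?FA \<and> (\<exists>u\<in>f. B \<in> ?G u)" if "p \<in> S" for p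
    proof -
      have pS: "p \<in> Sig E1 W1" "\<exists>z\<in>set p. \<not> inn z" using that S cS by auto
      obtain A B e f where d: "p = A @ core p @ B" "f \<in> edge_set E0" "last (core p) = Md (hat f)"
        "set A \<subseteq> ?PW" "distinct A" "distinct B" "B = [] \<or> (\<exists>u\<in>f. set B \<subseteq> gpos u)"
        by (rule core_props[OF pS]) blast
      have "length A \<le> a" unfolding a_def distinct_card[OF d(5), symmetric] by (rule card_mono[OF fPW d(4)])
      then have A: "A \<in> ?FA" using d(4) by simp
      have Bu: "\<exists>u\<in>f. B \<in> ?G u"
      proof (cases "B = []")
        case True
        have "f \<noteq> {}" using d(2) by (auto simp: edge_set_def)
        then show ?thesis using True by auto
      next
        case False
        then obtain u where u: "u \<in> f" "set B \<subseteq> gpos u" using d(7) by blast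
        have "length B \<le> card (gpos u)" unfolding distinct_card[OF d(6), symmetric] by (rule card_mono[OF finite_gpos u(2)])
        then have "length B \<le> b" using card_gpos[of u] by (simp add: b_def)
        then show ?thesis using u by auto
      qed
      show ?thesis
        by (rule exI[of _ A], rule exI[of _ B], rule exI[of _ f]) (intro conjI d(1-3) A Bu)
    qed
    have "(\<Sum>\<^sub>\<infinity>p\<in>S. ennreal (wt x y (wlen p)))
        \<le> of_nat K * ennreal c0 * (\<Sum>\<^sub>\<infinity>q\<in>M1 T. ennreal (wt x y (wlen q)))"
    proof (rule infsum_ennreal_fibres_card_le[where h = core])
      show "core ` S \<subseteq> M1 T" using cS by blast
      fix p assume p: "p \<in> S"
      obtain A B f where d: "p = A @ core p @ B" "A \<in> ?FA" "\<exists>u\<in>f. B \<in> ?G u"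
        using dec[OF p] by blast
      have "wlen p = wlen A + wlen (core p) + wlen B" using arg_cong[OF d(1), of wlen] by simp
      moreover have "wlen A \<le> a" "wlen B \<le> b"
        using d(2,3) wlen_le_length[of A] wlen_le_length[of B] by auto
      ultimately have "wt x y (wlen p) \<le> c0 * wt x y (wlen (core p))"
        unfolding c0_def using x by (intro wt_shift_le) auto
      then show "ennreal (wt x y (wlen p)) \<le> ennreal c0 * ennreal (wt x y (wlen (core p)))"
        using c0 x by (simp add: ennreal_mult[symmetric] wt_nonneg ennreal_leI)
    next
      fix q assume "q \<in> M1 T"
      show "finite {p \<in> S. core p = q} \<and> card {p \<in> S. core p = q} \<le> K"
      proof (cases "{p \<in> S. core p = q} = {}")
        case True
        then show ?thesis by (simp only: finite.emptyI card.empty) simp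
      next
        case False
        then obtain p0 where "p0 \<in> S" "core p0 = q" by blast
        then obtain f where f: "f \<in> edge_set E0" "last q = Md (hat f)" using dec by blast
        let ?FB = "\<Union>u\<in>f. ?G u"
        have ff: "finite f" "card f \<le> 2"
        proof -
          obtain u v where "f = {u, v}" using f(1) by (auto simp: edge_set_def)
          then show "finite f" "card f \<le> 2" by (auto simp: card_insert_if)
        qed
        have FB: "finite ?FB" using ff G by auto
        have "card ?FB \<le> (\<Sum>u\<in>f. card (?G u))" using ff by (intro card_UN_le)
        also have "\<dots> \<le> (\<Sum>u\<in>f. NB)" using G by (intro sum_mono) auto
        also have "\<dots> \<le> 2 * NB" using ff by simp
        finally have cFB: "card ?FB \<le> 2 * NB" .
        have sub: "{p \<in> S. core p = q} \<subseteq> (\<lambda>(A, B). A @ q @ B) ` (?FA \<times> ?FB)"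
        proof
          fix p assume p: "p \<in> {p \<in> S. core p = q}"
          then have pc: "p \<in> S" "core p = q" by auto
          obtain A B f' where d: "p = A @ q @ B" "f' \<in> edge_set E0" "last q = Md (hat f')" "A \<in> ?FA" "\<exists>u\<in>f'. B \<in> ?G u"
            using dec[OF pc(1)] unfolding pc(2) by (elim exE conjE) (rule that)
          \<comment> \<open>The last edge depends on the core alone, so the removed ends of all
            walks in this fibre come from the same two gadgets.\<close>
          have "f' = f" using d(2,3) f fst_hat by (metis pos.inject(2))
          then have "(A, B) \<in> ?FA \<times> ?FB" using d(4,5) by blast
          then show "p \<in> (\<lambda>(A, B). A @ q @ B) ` (?FA \<times> ?FB)" using d(1) by (intro image_eqI[of _ _ "(A, B)"]) auto
        qed
        have fin: "finite (?FA \<times> ?FB)" using FA FB by (intro finite_cartesian_product)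
        have "card {p \<in> S. core p = q} \<le> card (?FA \<times> ?FB)"
          using card_mono[OF finite_imageI[OF fin] sub] card_image_le[OF fin] by (rule order_trans)
        also have "\<dots> \<le> K" unfolding K_def card_cartesian_product using FA(2) cFB by (rule mult_le_mono)
        finally show ?thesis using finite_subset[OF sub finite_imageI[OF fin]] by blast
      qed
    qed
    also have "of_nat K * ennreal c0 = ennreal (real K * c0)"
      using c0 by (simp add: ennreal_mult ennreal_of_nat_eq_real_of_nat)
    finally show ?thesis .
  qed
  then show ?thesis by blast
qed

lemma core_M1:
  assumes "p \<in> Sig E1 W1" "\<exists>z\<in>set p. \<not> inn z"
  shows "core p \<in> M1 (edge_set E0)"
  by (rule core_props[OF assms]) (auto simp: M1_def)

text \<open>These walks have no core. Each stays in one gadget over \<open>W0\<close>, so together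
  they contribute a finite amount.\<close>

lemma finite_inner: "finite {p \<in> Sig E1 W1. \<forall>z\<in>set p. inn z}"
proof -
  let ?PW = "\<Union>v\<in>W0. gpos v"
  have fPW: "finite ?PW" using G0.W_fin finite_gpos by auto
  have "{p \<in> Sig E1 W1. \<forall>z\<in>set p. inn z} \<subseteq> {p. set p \<subseteq> ?PW \<and> distinct p}"
  proof clarify
    fix p assume p: "p \<in> Sig E1 W1" "\<forall>z\<in>set p. inn z"
    have m: "mid_saw E1 p" using p by (simp add: Sig_def)
    obtain \<epsilon> where eps: "\<epsilon> \<in> inc_edges E1 W1" "hd p = Md \<epsilon>" using p by (auto simp: Sig_def)
    obtain w where w: "w \<in> W1" "w \<in> \<epsilon>" "\<epsilon> \<in> edge_set E1" using eps by (auto simp: inc_edges_def)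
    have "inn (hd p)" using p(2) m by (auto simp: mid_saw_def)
    then have hw: "hpos (hd p) = Vx (fst w)" using hpos_Md_singleton(2) w(2) eps(2) by metis
    have "z \<in> gpos (fst w)" if "z \<in> set p" for z
      using inn_walk_const[OF _ p(2) that] hw m mid_saw_valid[OF m eps(2) w(3) that]
      by (intro inn_gpos) (auto simp: mid_saw_def)
    then show "set p \<subseteq> ?PW \<and> distinct p" using w m by (auto simp: mid_saw_def)
  qed
  then show ?thesis using finite_subset_distinct[OF fPW] by (rule finite_subset)
qed

text \<open>A walk that ends at a vertex is shortened to its last mid-edge. A fibre has at most
  three members: the shortened walk and its extensions to the two ends of that edge.\<close>

lemma Y0_le_M0:
  assumes x: "x > 0"
  shows "\<exists>c::real. Yfun E0 W0 x y \<le> ennreal c * (\<Sum>\<^sub>\<infinity>p\<in>M0 (edge_set E0). ennreal (wt x y (wlen p)))"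
proof -
  define h :: "'v pos list \<Rightarrow> 'v pos list" where "h p = (if is_Vx (last p) then butlast p else p)" for p
  define c0 where "c0 = max 1 x ^ 1 * real (1 + 1) powr \<bar>y\<bar>"
  have c0: "c0 \<ge> 0" by (simp add: c0_def)
  have hp: "h p \<in> M0 (edge_set E0) \<and> wlen (h p) \<le> wlen p \<and> wlen p \<le> wlen (h p) + 1 \<and>
      (p = h p \<or> (\<exists>f u. last (h p) = Md f \<and> u \<in> f \<and> p = h p @ [Vx u]))" if p: "p \<in> Sig E0 W0" for p
  proof -
    have m: "mid_saw E0 p" using p by (simp add: Sig_def)
    obtain e where e: "e \<in> inc_edges E0 W0" "hd p = Md e" using p by (auto simp: Sig_def)
    have eE: "e \<in> edge_set E0" using e by (simp add: inc_edges_def)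
    have ne: "p \<noteq> []" using m by (simp add: mid_saw_def)
    show ?thesis
    proof (cases "last p")
      case (Md f)
      then have "Md f \<in> set p" using ne last_in_set by metis
      then have "f \<in> edge_set E0" using mid_saw_edges[OF m e(2) eE] by blast
      then show ?thesis using Md p by (simp add: h_def M0_def)
    next
      case (Vx u)
      obtain q where q: "p = q @ [Vx u]" using Vx ne by (metis append_butlast_last_id)
      have hq: "h p = q" using q by (simp add: h_def)
      have qne: "q \<noteq> []" using q e(2) by auto
      have st: "step_ok E0 (last q) (Vx u)" and mq: "mid_saw E0 q"
        using m q qne by (auto simp: mid_saw_def successively_append_iff)
      obtain f where f: "last q = Md f" "u \<in> f" "f \<in> edge_set E0" using st by (cases "last q") auto
      have "hd q = Md e" using e(2) q qne by simp
      then have "q \<in> M0 (edge_set E0)" using mq e f by (auto simp: M0_def Sig_def)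
      then show ?thesis unfolding hq using q f by auto
    qed
  qed
  have "Yfun E0 W0 x y \<le> of_nat 3 * ennreal c0 * (\<Sum>\<^sub>\<infinity>p\<in>M0 (edge_set E0). ennreal (wt x y (wlen p)))"
    unfolding Yfun_wt
  proof (rule infsum_ennreal_fibres_card_le[where h = h])
    show "h ` Sig E0 W0 \<subseteq> M0 (edge_set E0)" using hp by blast
    fix p assume p: "p \<in> Sig E0 W0"
    have "wt x y (wlen p) \<le> c0 * wt x y (wlen (h p))"
      unfolding c0_def using x hp[OF p] by (intro wt_shift_le) auto
    then show "ennreal (wt x y (wlen p)) \<le> ennreal c0 * ennreal (wt x y (wlen (h p)))"
      using c0 x by (simp add: ennreal_mult[symmetric] wt_nonneg ennreal_leI)
  next
    fix q assume q: "q \<in> M0 (edge_set E0)"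
    then obtain f where f: "last q = Md f" "f \<in> edge_set E0" by (auto simp: M0_def)
    obtain u v where uv: "f = {u, v}" using f(2) by (auto simp: edge_set_def)
    have sub: "{p \<in> Sig E0 W0. h p = q} \<subseteq> {q, q @ [Vx u], q @ [Vx v]}"
    proof
      fix p assume p: "p \<in> {p \<in> Sig E0 W0. h p = q}"
      then have "p = q \<or> (\<exists>f' u'. last q = Md f' \<and> u' \<in> f' \<and> p = q @ [Vx u'])" using hp[of p] by auto
      then show "p \<in> {q, q @ [Vx u], q @ [Vx v]}" using f uv by auto
    qed
    have "card {p \<in> Sig E0 W0. h p = q} \<le> card {q, q @ [Vx u], q @ [Vx v]}"
      by (intro card_mono sub) auto
    also have "\<dots> \<le> 3" by (auto simp: card_insert_if)
    finally show "finite {p \<in> Sig E0 W0. h p = q} \<and> card {p \<in> Sig E0 W0. h p = q} \<le> 3"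
      using finite_subset[OF sub] by auto
  qed
  also have "of_nat 3 * ennreal c0 = ennreal (3 * c0)"
    using c0 by (simp add: ennreal_mult)
  finally show ?thesis by blast
qed

text \<open>Stated for all \<open>x\<close> and \<open>y\<close>: near the critical point with
  \<open>y = 0\<close> it determines \<open>gf\<close> there, and at the critical point it transfers
  \<open>\<gamma>\<close>.\<close>

theorem Yfun_finite_iff:
  assumes x: "x > 0"
  shows "Yfun E1 W1 x y < \<infinity> \<longleftrightarrow> Yfun E0 W0 (gf x) y < \<infinity>"
proof -
  let ?T = "edge_set E0" let ?D = "ennreal (real (card Gv) powr \<bar>y\<bar>)"
  let ?s0 = "\<Sum>\<^sub>\<infinity>p\<in>M0 ?T. ennreal (wt (gf x) y (wlen p))"
  let ?s1 = "\<Sum>\<^sub>\<infinity>q\<in>M1 ?T. ennreal (wt x y (wlen q))"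
  have g: "gf x > 0" by (rule gf_pos[OF x])
  show ?thesis
  proof
    assume "Yfun E1 W1 x y < \<infinity>"
    moreover have "?s1 \<le> Yfun E1 W1 x y" unfolding Yfun_wt by (rule infsum_ennreal_mono_set[OF M1_Sig])
    ultimately have "?s1 < \<infinity>" by (rule le_less_trans[rotated])
    then have "?D * ?s1 < \<infinity>" by (simp add: ennreal_mult_less_top)
    then have s0: "?s0 < \<infinity>" using sum_M1_ge[OF x] by (rule le_less_trans[rotated])
    obtain c :: real where "Yfun E0 W0 (gf x) y \<le> ennreal c * ?s0" using Y0_le_M0[OF g] by blast
    moreover have "ennreal c * ?s0 < \<infinity>" using s0 by (simp add: ennreal_mult_less_top)
    ultimately show "Yfun E0 W0 (gf x) y < \<infinity>" by (rule le_less_trans)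
  next
    assume "Yfun E0 W0 (gf x) y < \<infinity>"
    moreover have "?s0 \<le> Yfun E0 W0 (gf x) y"
      unfolding Yfun_wt by (rule infsum_ennreal_mono_set) (auto simp: M0_def)
    ultimately have "?s0 < \<infinity>" by (rule le_less_trans[rotated])
    then have "?D * ?s0 < \<infinity>" by (simp add: ennreal_mult_less_top)
    then have s1: "?s1 < \<infinity>" using sum_M1_le[OF order.refl x] by (rule le_less_trans[rotated])
    let ?S = "{p \<in> Sig E1 W1. \<exists>z\<in>set p. \<not> inn z}" and ?I = "{p \<in> Sig E1 W1. \<forall>z\<in>set p. inn z}"
    let ?w = "\<lambda>p::('v \<times> 'g) pos list. ennreal (wt x y (wlen p))"
    obtain c :: real where c0: "\<forall>S T. S \<subseteq> Sig E1 W1 \<longrightarrow> (\<forall>p\<in>S. (\<exists>z\<in>set p. \<not> inn z) \<and> core p \<in> M1 T) \<longrightarrow>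
        infsum ?w S \<le> ennreal c * infsum ?w (M1 T)"
      using core_sum_le[OF x, of y] by (elim exE) (rule that)
    have c: "infsum ?w ?S \<le> ennreal c * ?s1"
      by (rule c0[THEN spec, THEN spec, THEN mp, THEN mp]) (auto intro: core_M1)
    have "ennreal c * ?s1 < \<infinity>" using s1 by (simp add: ennreal_mult_less_top)
    then have S: "infsum ?w ?S < \<infinity>" using c by (rule le_less_trans[rotated])
    have I: "infsum ?w ?I < \<infinity>" using finite_inner by (simp add: sum_ennreal[symmetric])
    have "Sig E1 W1 = ?S \<union> ?I" by blast
    then have "Yfun E1 W1 x y \<le> infsum ?w ?S + infsum ?w ?I"
      unfolding Yfun_wt using infsum_ennreal_Un_le[of ?w ?S ?I] by simp
    also have "\<dots> < \<infinity>" using S I by simp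
    finally show "Yfun E1 W1 x y < \<infinity>" .
  qed
qed

section \<open>The critical points correspond\<close>

lemma isCont_gf: "isCont gf x"
  unfolding gf_def by (intro continuous_intros)

text \<open>Were \<open>gf x1\<close> above \<open>x0\<close>, some \<open>x\<close> slightly below
  \<open>x1\<close> would make the series of \<open>G1\<close> finite and that of \<open>G0\<close>
  infinite; were it below, some \<open>x\<close> slightly above \<open>x1\<close> would give the
  reverse contradiction.\<close>

theorem gf_conn_const: "gf (1 / conn_const V1 E1) = 1 / conn_const V0 E0"
proof -
  define x1 where "x1 = 1 / G1.mu"
  define x0 where "x0 = 1 / G0.mu"
  have x1: "x1 > 0" using G1.mu_ge_1 by (simp add: x1_def)
  have lim: "(gf \<longlongrightarrow> gf x1) (at_left x1)" "(gf \<longlongrightarrow> gf x1) (at_right x1)"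
    using isCont_gf[of x1] by (auto simp: isCont_def filterlim_at_split)
  have "\<not> gf x1 > x0"
  proof
    assume "gf x1 > x0"
    then have "\<forall>\<^sub>F x in at_left x1. x0 < gf x" by (rule order_tendstoD(1)[OF lim(1)])
    moreover have "\<forall>\<^sub>F x in at_left x1. 0 < x \<and> x < x1"
      using eventually_at_left_real[OF x1] by (simp add: eventually_mono)
    ultimately have "\<forall>\<^sub>F x in at_left x1. x0 < gf x \<and> 0 < x \<and> x < x1" by eventually_elim simp
    then obtain x where x: "x0 < gf x" "0 < x" "x < x1" using eventually_happens trivial_limit_at_left_real by blast
    have "Yfun E1 W1 x 0 < \<infinity>" using x G1.Yfun_finite_below by (simp add: x1_def)
    then have "Yfun E0 W0 (gf x) 0 < \<infinity>" using Yfun_finite_iff x by blast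
    then show False using G0.Yfun_infinite_above x by (simp add: x0_def)
  qed
  moreover have "\<not> gf x1 < x0"
  proof
    assume "gf x1 < x0"
    then have "\<forall>\<^sub>F x in at_right x1. gf x < x0" by (rule order_tendstoD(2)[OF lim(2)])
    moreover have "\<forall>\<^sub>F x in at_right x1. x1 < x" by (simp add: eventually_at_right_less)
    ultimately have "\<forall>\<^sub>F x in at_right x1. gf x < x0 \<and> x1 < x" by eventually_elim simp
    then obtain x where x: "gf x < x0" "x1 < x" using eventually_happens trivial_limit_at_right_real by blast
    have x0: "x > 0" using x x1 by simp
    have "Yfun E0 W0 (gf x) 0 < \<infinity>" using x gf_pos[OF x0] G0.Yfun_finite_below by (simp add: x0_def)
    then have "Yfun E1 W1 x 0 < \<infinity>" using Yfun_finite_iff x0 by blast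
    then show False using G1.Yfun_infinite_above x by (simp add: x1_def)
  qed
  ultimately have "gf x1 = x0" by linarith
  then show ?thesis by (simp add: x1_def x0_def G0.conn_const_eq G1.conn_const_eq)
qed

theorem gamma_transfer:
  assumes "gamma_exp V0 E0 W0 g"
  shows "gamma_exp V1 E1 W1 g"
proof -
  have "1 / conn_const V1 E1 > 0" using G1.mu_ge_1 by (simp add: G1.conn_const_eq)
  then have "Yfun E1 W1 (1 / conn_const V1 E1) y < \<infinity> \<longleftrightarrow> Yfun E0 W0 (1 / conn_const V0 E0) y < \<infinity>" for y
    using Yfun_finite_iff[of "1 / conn_const V1 E1" y] by (simp add: gf_conn_const)
  then show ?thesis using assms unfolding gamma_exp_def by (metis infinity_ennreal_def less_irrefl top.not_eq_extremum)
qed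

end

section \<open>Distances and the exponent eta\<close>

lemma wt_0: "wt x 0 n = x ^ n"
  by (simp add: wt_def)

lemma aut_edge:
  assumes "simple_graph V E" "aut V E f" "e \<in> edge_set E"
  shows "f ` e \<in> edge_set E"
proof -
  obtain u v where e: "e = {u, v}" "E u v" using assms(3) by (auto simp: edge_set_def)
  then have "u \<in> V" "v \<in> V" using assms(1) by (auto simp: simple_graph_def)
  then have "E (f u) (f v)" using assms(2) e by (simp add: aut_def)
  then show ?thesis using edge_setI[of E "f u" "f v"] e by simp
qed

lemma gdist_le: "(u, v) \<in> {(a, b). E a b} ^^ n \<Longrightarrow> gdist E u v \<le> n"
  unfolding gdist_def by (rule Least_le)

lemma gdist_relpow:
  assumes "connected_graph V E" "u \<in> V" "v \<in> V"
  shows "(u, v) \<in> {(a, b). E a b} ^^ gdist E u v"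
proof -
  have "(u, v) \<in> {(a, b). E a b}\<^sup>*" using assms by (auto simp: connected_graph_def)
  then have "\<exists>n. (u, v) \<in> {(a, b). E a b} ^^ n" by (rule rtrancl_imp_relpow)
  then show ?thesis unfolding gdist_def by (rule LeastI_ex)
qed

lemma setdist_le: "u \<in> A \<Longrightarrow> v \<in> B \<Longrightarrow> setdist E A B \<le> gdist E u v"
  unfolding setdist_def by (intro cInf_lower) auto

lemma setdist_attained:
  assumes "A \<noteq> {}" "B \<noteq> {}"
  obtains u v where "u \<in> A" "v \<in> B" "setdist E A B = gdist E u v"
proof -
  have "{gdist E u v | u v. u \<in> A \<and> v \<in> B} \<noteq> {}" using assms by auto
  then have "setdist E A B \<in> {gdist E u v | u v. u \<in> A \<and> v \<in> B}"
    unfolding setdist_def by (rule Inf_nat_def1)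
  then show ?thesis using that by blast
qed

lemma successively_relpow:
  "successively E p \<Longrightarrow> p \<noteq> [] \<Longrightarrow> (hd p, last p) \<in> {(a, b). E a b} ^^ (length p - 1)"
proof (induction p rule: induct_list012)
  case (3 x y zs)
  then have "(y, last (y # zs)) \<in> {(a, b). E a b} ^^ length zs" by simp
  then have "(x, last (y # zs)) \<in> {(a, b). E a b} ^^ Suc (length zs)"
    using "3.prems"(1) by (intro relpow_Suc_I2) auto
  then show ?case by simp
qed auto

lemma ennreal_tendsto_0_bound:
  fixes f h :: "nat \<Rightarrow> ennreal" and c :: real
  assumes "h \<longlonglongrightarrow> 0" "\<forall>\<^sub>F k in sequentially. f k \<le> ennreal c * h k"
  shows "f \<longlonglongrightarrow> 0"
proof (rule tendsto_sandwich[OF _ assms(2) tendsto_const])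
  show "(\<lambda>k. ennreal c * h k) \<longlonglongrightarrow> 0"
    using ennreal_tendsto_cmult[of "ennreal c" h 0 sequentially] assms(1) by simp
qed simp

lemma ennreal_tendsto_top_bound:
  fixes f h :: "nat \<Rightarrow> ennreal" and c :: real
  assumes "h \<longlonglongrightarrow> \<infinity>" "\<forall>\<^sub>F k in sequentially. h k \<le> ennreal c * f k" "c \<ge> 0"
  shows "f \<longlonglongrightarrow> \<infinity>"
  unfolding infinity_ennreal_def tendsto_top_iff_ennreal
proof (intro allI impI)
  fix l :: real assume l: "0 \<le> l"
  have "\<forall>\<^sub>F k in sequentially. ennreal (c * l) < h k"
    using assms(1,3) l unfolding infinity_ennreal_def tendsto_top_iff_ennreal by auto
  then show "\<forall>\<^sub>F k in sequentially. ennreal l < f k"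
    using assms(2)
  proof eventually_elim
    case (elim k)
    show ?case
    proof (rule ccontr)
      assume "\<not> ennreal l < f k"
      then have "ennreal c * f k \<le> ennreal c * ennreal l" by (intro mult_left_mono) auto
      then have "ennreal c * f k \<le> ennreal (c * l)" using assms(3) l by (simp add: ennreal_mult)
      then show False using elim by (meson leD order_trans)
    qed
  qed
qed

context local_transf begin

text \<open>Steps inside a gadget disappear and a connecting edge becomes one step, so projection
  never lengthens a walk.\<close>

lemma relpow_project:
  "(x, y) \<in> {(a, b). E1 a b} ^^ m \<Longrightarrow> \<exists>n\<le>m. (fst x, fst y) \<in> {(a, b). E0 a b} ^^ n"
proof (induction m arbitrary: y)
  case 0
  then show ?case by auto
next
  case (Suc m)
  then obtain z where z: "(x, z) \<in> {(a, b). E1 a b} ^^ m" "E1 z y" by auto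
  obtain n where n: "n \<le> m" "(fst x, fst z) \<in> {(a, b). E0 a b} ^^ n" using Suc.IH[OF z(1)] by blast
  show ?case using z(2)
  proof (cases rule: E1_cases)
    case (1 v a b)
    then show ?thesis using n by (intro exI[of _ n]) auto
  next
    case (2 u v)
    then have "(fst x, fst y) \<in> {(a, b). E0 a b} ^^ Suc n" using n by (intro relpow_Suc_I[of _ "fst z"]) auto
    then show ?thesis using n by (intro exI[of _ "Suc n"]) auto
  qed
qed

lemma relpow_gadget:
  assumes "v \<in> V0" "a \<in> Gv" "b \<in> Gv"
  shows "\<exists>m<card Gv. ((v, a), (v, b)) \<in> {(a, b). E1 a b} ^^ m"
proof -
  obtain vs where vs: "vs \<in> gpaths a b" using gpaths_nonempty assms by blast
  have ne: "vs \<noteq> []" using vs by (simp add: gpaths_def)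
  have "successively E1 (map (Pair v) vs)"
    using vs assms(1) by (auto simp: gpaths_def successively_map phi_E_def elim: successively_mono)
  then have "(hd (map (Pair v) vs), last (map (Pair v) vs)) \<in> {(a, b). E1 a b} ^^ (length (map (Pair v) vs) - 1)"
    using ne by (intro successively_relpow) auto
  then have "((v, a), (v, b)) \<in> {(a, b). E1 a b} ^^ (length vs - 1)"
    using vs ne by (simp add: gpaths_def hd_map last_map)
  moreover have "length vs - 1 < card Gv"
  proof -
    have "length vs = card (set vs)" using vs by (simp add: gpaths_def distinct_card)
    also have "\<dots> \<le> card Gv" using vs gadget_facts(1) by (intro card_mono) (auto simp: gpaths_def)
    finally show ?thesis using ne by (cases vs) auto
  qed
  ultimately show ?thesis by blast
qed

lemma relpow_lift:
  assumes "(u, v) \<in> {(a, b). E0 a b} ^^ n" "u \<in> V0" "a \<in> Gv"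
  shows "\<exists>b\<in>Gv. \<exists>m\<le>card Gv * n. ((u, a), (v, b)) \<in> {(a, b). E1 a b} ^^ m"
  using assms(1)
proof (induction n arbitrary: v)
  case 0
  then show ?case using assms(3) by auto
next
  case (Suc n)
  then obtain z where z: "(u, z) \<in> {(a, b). E0 a b} ^^ n" "E0 z v" by auto
  obtain b m where b: "b \<in> Gv" "m \<le> card Gv * n" "((u, a), (z, b)) \<in> {(a, b). E1 a b} ^^ m"
    using Suc.IH[OF z(1)] by blast
  obtain m' where m': "m' < card Gv" "((z, b), (z, \<sigma> z v)) \<in> {(a, b). E1 a b} ^^ m'"
    using relpow_gadget[OF E0_V(1)[OF z(2)] b(1) sigma_Gv[OF z(2)]] by blast
  have "((u, a), (z, \<sigma> z v)) \<in> {(a, b). E1 a b} ^^ (m + m')"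
    using b(3) m'(2) by (auto simp: relpow_add)
  moreover have "E1 (z, \<sigma> z v) (v, \<sigma> v z)" using z(2) by (simp add: phi_E_def)
  ultimately have "((u, a), (v, \<sigma> v z)) \<in> {(a, b). E1 a b} ^^ Suc (m + m')"
    by (intro relpow_Suc_I) auto
  moreover have "\<sigma> v z \<in> Gv" using sigma_Gv[OF E0_sym[OF z(2)]] .
  \<comment> \<open>Fewer than \<open>card Gv\<close> steps across the gadget plus one connecting
    edge: at most \<open>card Gv\<close> per step of the original walk.\<close>
  moreover have "Suc (m + m') \<le> card Gv * Suc n" using b(2) m'(1) by simp
  ultimately show ?case by blast
qed

section \<open>A fixed automorphism together with a lift of it\<close>

context
  fixes \<alpha> :: "'v \<Rightarrow> 'v" and \<beta> :: "'v \<times> 'g \<Rightarrow> 'v \<times> 'g"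
  assumes \<alpha>: "aut V0 E0 \<alpha>" and \<beta>: "aut V1 E1 \<beta>" and over: "\<forall>x\<in>V1. fst (\<beta> x) = \<alpha> (fst x)"
begin

lemma fst_\<beta>: "x \<in> V1 \<Longrightarrow> fst (\<beta> x) = \<alpha> (fst x)"
  using over by blast

lemma W1_V1: "W1 \<subseteq> V1" using G1.W_V .

lemma setdist_lower: "setdist E0 W0 (\<alpha> ` W0) \<le> setdist E1 W1 (\<beta> ` W1)"
proof -
  have ne: "W1 \<noteq> {}" "\<beta> ` W1 \<noteq> {}" using G1.W_ne by auto
  obtain x y where xy: "x \<in> W1" "y \<in> \<beta> ` W1" "setdist E1 W1 (\<beta> ` W1) = gdist E1 x y"
    using setdist_attained[OF ne] by blast
  obtain z where z: "z \<in> W1" "y = \<beta> z" using xy(2) by blast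
  have V: "x \<in> V1" "y \<in> V1" "z \<in> V1" using xy z W1_V1 \<beta> by (auto simp: aut_def bij_betw_def)
  obtain n where n: "n \<le> gdist E1 x y" "(fst x, fst y) \<in> {(a, b). E0 a b} ^^ n"
    using relpow_project[OF gdist_relpow[OF G1conn V(1,2)]] by blast
  have "fst x \<in> W0" "fst y \<in> \<alpha> ` W0" using xy(1) z fst_\<beta>[OF V(3)] by auto
  then have "setdist E0 W0 (\<alpha> ` W0) \<le> gdist E0 (fst x) (fst y)" by (rule setdist_le)
  also have "\<dots> \<le> n" by (rule gdist_le[OF n(2)])
  finally show ?thesis using n(1) xy(3) by simp
qed

lemma setdist_upper: "setdist E1 W1 (\<beta> ` W1) \<le> card Gv * setdist E0 W0 (\<alpha> ` W0)"
proof -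
  have ne: "W0 \<noteq> {}" "\<alpha> ` W0 \<noteq> {}" using G0.W_ne by auto
  obtain u v where uv: "u \<in> W0" "v \<in> \<alpha> ` W0" "setdist E0 W0 (\<alpha> ` W0) = gdist E0 u v"
    using setdist_attained[OF ne] by blast
  obtain w where w: "w \<in> W0" "v = \<alpha> w" using uv(2) by blast
  have V: "u \<in> V0" "v \<in> V0" "w \<in> V0" using uv w G0.W_V \<alpha> by (auto simp: aut_def bij_betw_def)
  have w1: "w1 \<in> Gv" using gadget_facts(4) by simp
  obtain b m where b: "b \<in> Gv" "m \<le> card Gv * gdist E0 u v" "((u, w1), (v, b)) \<in> {(a, b). E1 a b} ^^ m"
    using relpow_lift[OF gdist_relpow[OF G0(3) V(1,2)] V(1) w1] by blast
  have "(v, b) \<in> V1" using V b by (simp add: phi_V_def)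
  then obtain z where z: "z \<in> V1" "\<beta> z = (v, b)" using \<beta> by (metis aut_def bij_betw_def imageE)
  have "\<alpha> (fst z) = \<alpha> w" using fst_\<beta>[OF z(1)] z(2) w(2) by simp
  moreover have "fst z \<in> V0" using z(1) by (auto simp: phi_V_def)
  ultimately have "fst z = w" using \<alpha> V(3) by (auto simp: aut_def bij_betw_def inj_on_def)
  then have "z \<in> W1" using z(1) w(1) by (cases z) (auto simp: phi_V_def)
  then have "(v, b) \<in> \<beta> ` W1" using z(2) by force
  then have "setdist E1 W1 (\<beta> ` W1) \<le> gdist E1 (u, w1) (v, b)" using uv(1) w1 by (intro setdist_le) auto
  also have "\<dots> \<le> m" by (rule gdist_le[OF b(3)])
  finally show ?thesis using b(2) uv(3) by simp
qed

lemma hat_image: assumes e: "e \<in> edge_set E0" shows "hat (\<alpha> ` e) = \<beta> ` hat e"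
proof -
  have ae: "\<alpha> ` e \<in> edge_set E0" by (rule aut_edge[OF G0(1) \<alpha> e])
  have be: "\<beta> ` hat e \<in> edge_set E1" by (rule aut_edge[OF simple1 \<beta> hat_edge[OF e]])
  have "hat e \<subseteq> V1" using hat_edge[OF e] by (rule G1.edge_V)
  then have "fst ` \<beta> ` hat e = \<alpha> ` fst ` hat e" using fst_\<beta> by (force simp: image_image)
  then have f: "fst ` \<beta> ` hat e = \<alpha> ` e" using fst_hat[OF e] by simp
  have "hpos (Md (hat (\<alpha> ` e))) = Md (\<alpha> ` e)" by (rule hpos_hat[OF ae])
  then have "\<not> is_singleton (\<alpha> ` e)" using fst_hat[OF ae] by (auto simp: hpos_def split: if_splits)
  then have "hpos (Md (\<beta> ` hat e)) = Md (\<alpha> ` e)" using f by (simp add: hpos_def)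
  then show ?thesis by (rule hpos_edge(2)[OF be, symmetric])
qed

abbreviation "TT \<equiv> (`) \<alpha> ` inc_edges E0 W0"

lemma TT_edges: "TT \<subseteq> edge_set E0"
  using aut_edge[OF G0(1) \<alpha>] by (auto simp: inc_edges_def)

lemma TT_I: assumes "f \<in> edge_set E0" "\<alpha> w \<in> f" "w \<in> W0" shows "f \<in> TT"
proof -
  obtain u where u: "f = {\<alpha> w, u}" "E0 (\<alpha> w) u" using edge_set_obtain[OF G0(1) assms(1,2)] by blast
  have "u \<in> V0" using u E0_V by blast
  then obtain u' where u': "u' \<in> V0" "u = \<alpha> u'" using \<alpha> by (metis aut_def bij_betw_def imageE)
  have "w \<in> V0" using assms(3) G0.W_V by blast
  then have "E0 w u'" using \<alpha> u u' by (simp add: aut_def)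
  then have "{w, u'} \<in> inc_edges E0 W0" using assms(3) by (auto simp: inc_edges_def intro: edge_setI)
  moreover have "f = \<alpha> ` {w, u'}" using u u' by simp
  ultimately show ?thesis by blast
qed

lemma Zfun0: "Zfun E0 W0 \<alpha> x = (\<Sum>\<^sub>\<infinity>p\<in>M0 TT. ennreal (wt x 0 (wlen p)))"
proof -
  have "{p \<in> Sig E0 W0. \<exists>e\<in>inc_edges E0 W0. last p = Md (\<alpha> ` e)} = M0 TT" by (auto simp: M0_def)
  then show ?thesis by (simp add: Zfun_def wt_0)
qed

definition Z1set :: "('v \<times> 'g) pos list set" where
  "Z1set = {p \<in> Sig E1 W1. \<exists>e\<in>inc_edges E1 W1. last p = Md (\<beta> ` e)}"

lemma Zfun1: "Zfun E1 W1 \<beta> x = (\<Sum>\<^sub>\<infinity>p\<in>Z1set. ennreal (wt x 0 (wlen p)))"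
  by (simp add: Zfun_def wt_0 Z1set_def)

lemma M1_Z1: "M1 TT \<subseteq> Z1set"
proof
  fix q assume q: "q \<in> M1 TT"
  then obtain e where e: "e \<in> inc_edges E0 W0" "last q = Md (hat (\<alpha> ` e))" by (auto simp: M1_def)
  then have "last q = Md (\<beta> ` hat e)" using hat_image by (simp add: inc_edges_def)
  then show "q \<in> Z1set" using q M1_Sig hat_inc[OF e(1)] by (auto simp: Z1set_def)
qed

text \<open>Positive distance rules out walks that stay in one gadget, so a core exists. The last
  connecting edge then touches the translated gadget in which the walk ends.\<close>

lemma Z1_core:
  assumes d: "setdist E0 W0 (\<alpha> ` W0) \<ge> 1" and p: "p \<in> Z1set"
  shows "(\<exists>z\<in>set p. \<not> inn z) \<and> core p \<in> M1 TT"
proof -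
  have pS: "p \<in> Sig E1 W1" using p by (simp add: Z1set_def)
  have m: "mid_saw E1 p" using pS by (simp add: Sig_def)
  have pne: "p \<noteq> []" using m by (simp add: mid_saw_def)
  obtain \<epsilon>' where e': "\<epsilon>' \<in> inc_edges E1 W1" "last p = Md (\<beta> ` \<epsilon>')" using p by (auto simp: Z1set_def)
  obtain w' where w': "w' \<in> W1" "w' \<in> \<epsilon>'" using e' by (auto simp: inc_edges_def)
  have fw': "fst (\<beta> w') = \<alpha> (fst w')" "fst w' \<in> W0" using fst_\<beta> w' W1_V1 by auto
  have ex: "\<exists>z\<in>set p. \<not> inn z"
  proof (rule ccontr)
    assume "\<not> (\<exists>z\<in>set p. \<not> inn z)"
    then have all: "\<forall>z\<in>set p. inn z" by blast
    obtain \<epsilon> where eps: "\<epsilon> \<in> inc_edges E1 W1" "hd p = Md \<epsilon>" using pS by (auto simp: Sig_def)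
    obtain w where w: "w \<in> W1" "w \<in> \<epsilon>" using eps by (auto simp: inc_edges_def)
    have h1: "hpos (hd p) = Vx (fst w)"
      using hpos_Md_singleton(2)[of \<epsilon> w] w(2) eps(2) all pne hd_in_set[of p] by metis
    have h2: "hpos (last p) = Vx (\<alpha> (fst w'))"
      using hpos_Md_singleton(2)[of "\<beta> ` \<epsilon>'" "\<beta> w'"] w'(2) e'(2) all pne last_in_set[of p] fw'(1) by (metis imageI)
    have "hpos (last p) = hpos (hd p)"
      using inn_walk_const[OF _ all last_in_set[OF pne]] m by (simp add: mid_saw_def)
    then have eq: "fst w = \<alpha> (fst w')" using h1 h2 by simp
    have "setdist E0 W0 (\<alpha> ` W0) \<le> gdist E0 (fst w) (\<alpha> (fst w'))"
      using w(1) fw'(2) by (intro setdist_le) auto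
    also have "\<dots> \<le> 0" using eq by (intro gdist_le) simp
    finally show False using d by simp
  qed
  obtain A B e f where c: "p = A @ core p @ B" "mid_saw E1 (core p)"
    "e \<in> inc_edges E0 W0" "hd (core p) = Md (hat e)" "f \<in> edge_set E0" "last (core p) = Md (hat f)"
    "B = [] \<or> (\<exists>u\<in>f. set B \<subseteq> gpos u)"
    by (rule core_props[OF pS ex]) (rule that)
  \<comment> \<open>Either the core already ends at the final edge, or the final edge lies in the
    gadget at an end \<open>u\<close> of \<open>f\<close>; in both cases \<open>\<beta> w'\<close>
    projects into \<open>f\<close>.\<close>
  have "\<alpha> (fst w') \<in> f"
  proof (cases "B = []")
    case True
    have "core p \<noteq> []" using c(2) by (simp add: mid_saw_def)
    then have "last p = last (core p)" using c(1) True by (metis append_Nil2 last_appendR)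
    then have "\<beta> w' \<in> hat f" using e'(2) c(6) w'(2) by auto
    then have "fst (\<beta> w') \<in> f" using fst_hat[OF c(5)] by blast
    then show ?thesis using fw' by simp
  next
    case False
    then obtain u where u: "u \<in> f" "set B \<subseteq> gpos u" using c(7) by blast
    have "last p = last B" using c(1) False by (metis last_appendR append_is_Nil_conv)
    then have "Md (\<beta> ` \<epsilon>') \<in> gpos u" using u(2) False e'(2) last_in_set[of B] by auto
    then have "fst (\<beta> w') = u" using w'(2) by (intro gpos_Md) auto
    then show ?thesis using u(1) fw' by simp
  qed
  then have "f \<in> TT" using TT_I[OF c(5)] fw'(2) by blast
  then show ?thesis using ex c(2,3,4,6) by (auto simp: M1_def)
qed

end

text \<open>A single \<open>c\<close> serves all automorphisms, as a limit along a sequence of them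
  demands. With \<open>y = 0\<close> the length factor \<open>card Gv powr 0\<close> is 1, so the
  loss comes only from trimming to the core.\<close>

lemma Zfun_compare:
  assumes x: "x > 0"
  obtains c :: real where "c \<ge> 0"
    "\<And>\<alpha> \<beta>. aut V0 E0 \<alpha> \<Longrightarrow> aut V1 E1 \<beta> \<Longrightarrow> \<forall>x\<in>V1. fst (\<beta> x) = \<alpha> (fst x) \<Longrightarrow>
      Zfun E0 W0 \<alpha> (gf x) \<le> Zfun E1 W1 \<beta> x"
    "\<And>\<alpha> \<beta>. aut V0 E0 \<alpha> \<Longrightarrow> aut V1 E1 \<beta> \<Longrightarrow> \<forall>x\<in>V1. fst (\<beta> x) = \<alpha> (fst x) \<Longrightarrow>
      setdist E0 W0 (\<alpha> ` W0) \<ge> 1 \<Longrightarrow> Zfun E1 W1 \<beta> x \<le> ennreal c * Zfun E0 W0 \<alpha> (gf x)"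
proof -
  let ?w = "\<lambda>p::('v \<times> 'g) pos list. ennreal (wt x 0 (wlen p))"
  obtain c :: real where c0: "\<forall>S T. S \<subseteq> Sig E1 W1 \<longrightarrow> (\<forall>p\<in>S. (\<exists>z\<in>set p. \<not> inn z) \<and> core p \<in> M1 T) \<longrightarrow>
        infsum ?w S \<le> ennreal c * infsum ?w (M1 T)"
    using core_sum_le[OF x, of 0] by (elim exE) (rule that)
  have D: "ennreal (real (card Gv) powr \<bar>0\<bar>) = 1" using card_Gv_ge_1 by simp
  show ?thesis
  \<comment> \<open>The constant obtained above has no known sign; \<open>ennreal\<close> maps
    negative numbers to zero, so passing to \<open>max 0 c\<close> preserves the bound.\<close>
  proof (rule that[of "max 0 c"])
    fix \<alpha> :: "'v \<Rightarrow> 'v" and \<beta> :: "'v \<times> 'g \<Rightarrow> 'v \<times> 'g"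
    assume ab: "aut V0 E0 \<alpha>" "aut V1 E1 \<beta>" "\<forall>x\<in>V1. fst (\<beta> x) = \<alpha> (fst x)"
    let ?T = "(`) \<alpha> ` inc_edges E0 W0"
    have "Zfun E0 W0 \<alpha> (gf x) \<le> infsum ?w (M1 ?T)"
      unfolding Zfun0[OF ab] using sum_M1_ge[OF x, where T = ?T and y = 0] by (simp only: D mult_1)
    also have "\<dots> \<le> Zfun E1 W1 \<beta> x"
      unfolding Zfun1[OF ab] by (rule infsum_ennreal_mono_set[OF M1_Z1[OF ab]])
    finally show "Zfun E0 W0 \<alpha> (gf x) \<le> Zfun E1 W1 \<beta> x" .
    assume d: "setdist E0 W0 (\<alpha> ` W0) \<ge> 1"
    have "Zfun E1 W1 \<beta> x \<le> ennreal c * infsum ?w (M1 ?T)"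
      unfolding Zfun1[OF ab]
      by (rule c0[THEN spec, THEN spec, THEN mp, THEN mp])
         (use Z1_core[OF ab d] Z1set_def[OF ab] in auto)
    also have "\<dots> \<le> ennreal (max 0 c) * Zfun E0 W0 \<alpha> (gf x)"
    proof (rule mult_mono)
      show "infsum ?w (M1 ?T) \<le> Zfun E0 W0 \<alpha> (gf x)"
        unfolding Zfun0[OF ab] using sum_M1_le[OF TT_edges[OF ab] x, where y = 0] by (simp only: D mult_1)
    qed (auto intro: ennreal_leI)
    finally show "Zfun E1 W1 \<beta> x \<le> ennreal (max 0 c) * Zfun E0 W0 \<alpha> (gf x)" .
  qed simp
qed

text \<open>A sequence of automorphisms of \<open>G0\<close> is lifted term by term. Distances agree
  up to the factor \<open>card Gv\<close> and the sums \<open>Z\<close> up to constants, so both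
  limits for the lifted sequence pass down.\<close>

theorem eta_transfer:
  assumes eta: "eta_exp V1 E1 W1 \<eta>"
  shows "eta_exp V0 E0 W0 \<eta>"
  unfolding eta_exp_def
proof (rule allI, rule impI)
  fix \<alpha> :: "nat \<Rightarrow> 'v \<Rightarrow> 'v"
  assume H: "(\<forall>k. aut V0 E0 (\<alpha> k)) \<and> filterlim (\<lambda>k. real (setdist E0 W0 (\<alpha> k ` W0))) at_top sequentially"
  have "\<exists>\<beta>. aut V1 E1 \<beta> \<and> (\<forall>x\<in>V1. fst (\<beta> x) = \<alpha> k (fst x))" for k using H lift by blast
  then obtain \<beta> where b: "\<And>k. aut V1 E1 (\<beta> k)" "\<And>k. \<forall>x\<in>V1. fst (\<beta> k x) = \<alpha> k (fst x)" by metis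
  have a: "aut V0 E0 (\<alpha> k)" for k using H by blast
  define d0 where "d0 k = setdist E0 W0 (\<alpha> k ` W0)" for k
  define d1 where "d1 k = setdist E1 W1 (\<beta> k ` W1)" for k
  define x1 where "x1 = 1 / conn_const V1 E1"
  have x1: "x1 > 0" using G1.mu_ge_1 by (simp add: x1_def G1.conn_const_eq)
  have gx: "gf x1 = 1 / conn_const V0 E0" unfolding x1_def by (rule gf_conn_const)
  have lo: "d0 k \<le> d1 k" and up: "d1 k \<le> card Gv * d0 k" for k
    unfolding d0_def d1_def using setdist_lower[OF a b] setdist_upper[OF a b] by auto
  have lim0: "filterlim (\<lambda>k. real (d0 k)) at_top sequentially" using H by (simp add: d0_def)
  have lim1: "filterlim (\<lambda>k. real (d1 k)) at_top sequentially"
    by (rule filterlim_at_top_mono[OF lim0]) (use lo in auto)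
  have ev: "\<forall>\<^sub>F k in sequentially. d0 k \<ge> 1"
  proof -
    have "\<forall>\<^sub>F k in sequentially. real (d0 k) \<ge> 1" using lim0 unfolding filterlim_at_top by blast
    then show ?thesis by eventually_elim simp
  qed
  obtain c :: real where c: "c \<ge> 0"
    "\<And>\<alpha> \<beta>. aut V0 E0 \<alpha> \<Longrightarrow> aut V1 E1 \<beta> \<Longrightarrow> \<forall>x\<in>V1. fst (\<beta> x) = \<alpha> (fst x) \<Longrightarrow>
      Zfun E0 W0 \<alpha> (gf x1) \<le> Zfun E1 W1 \<beta> x1"
    "\<And>\<alpha> \<beta>. aut V0 E0 \<alpha> \<Longrightarrow> aut V1 E1 \<beta> \<Longrightarrow> \<forall>x\<in>V1. fst (\<beta> x) = \<alpha> (fst x) \<Longrightarrow>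
      setdist E0 W0 (\<alpha> ` W0) \<ge> 1 \<Longrightarrow> Zfun E1 W1 \<beta> x1 \<le> ennreal c * Zfun E0 W0 \<alpha> (gf x1)"
    using Zfun_compare[OF x1] by blast
  define z0 where "z0 k = Zfun E0 W0 (\<alpha> k) (gf x1)" for k
  define z1 where "z1 k = Zfun E1 W1 (\<beta> k) x1" for k
  have z01: "z0 k \<le> z1 k" for k unfolding z0_def z1_def by (rule c(2)[OF a b])
  have z10: "z1 k \<le> ennreal c * z0 k" if "d0 k \<ge> 1" for k
    unfolding z0_def z1_def by (rule c(3)[OF a b]) (use that in \<open>simp_all add: d0_def\<close>)
  have pw: "real (d0 k) powr w \<le> real (card Gv) powr \<bar>w\<bar> * real (d1 k) powr w"
    "real (d1 k) powr w \<le> real (card Gv) powr \<bar>w\<bar> * real (d0 k) powr w" if k: "d0 k \<ge> 1" for k w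
  proof -
    have "max 1 (d0 k) = d0 k" "max 1 (d1 k) = d1 k" using k lo[of k] by auto
    then show "real (d0 k) powr w \<le> real (card Gv) powr \<bar>w\<bar> * real (d1 k) powr w"
      "real (d1 k) powr w \<le> real (card Gv) powr \<bar>w\<bar> * real (d0 k) powr w"
      using max_1_powr_compare[of "d0 k" "d1 k" "card Gv" w] lo[of k] up[of k] card_Gv_ge_1 by metis+
  qed
  let ?f0 = "\<lambda>w k. z0 k * ennreal (real (d0 k) powr w)" and ?f1 = "\<lambda>w k. z1 k * ennreal (real (d1 k) powr w)"
  have up0: "\<forall>\<^sub>F k in sequentially. ?f0 w k \<le> ennreal (real (card Gv) powr \<bar>w\<bar>) * ?f1 w k" for w
    using ev
  proof eventually_elim
    case (elim k)
    have "?f0 w k \<le> z1 k * ennreal (real (card Gv) powr \<bar>w\<bar> * real (d1 k) powr w)"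
      using z01 pw(1)[OF elim] by (intro mult_mono ennreal_leI) auto
    then show ?case by (simp add: ennreal_mult ac_simps)
  qed
  have up1: "\<forall>\<^sub>F k in sequentially. ?f1 w k \<le> ennreal (c * real (card Gv) powr \<bar>w\<bar>) * ?f0 w k" for w
    using ev
  proof eventually_elim
    case (elim k)
    have "?f1 w k \<le> (ennreal c * z0 k) * ennreal (real (card Gv) powr \<bar>w\<bar> * real (d0 k) powr w)"
      using z10[OF elim] pw(2)[OF elim] by (intro mult_mono ennreal_leI) auto
    then show ?case using c(1) by (simp add: ennreal_mult ac_simps)
  qed
  have e1: "(\<forall>w::real. ereal w < \<eta> \<longrightarrow> ?f1 w \<longlonglongrightarrow> 0) \<and> (\<forall>w::real. \<eta> < ereal w \<longrightarrow> ?f1 w \<longlonglongrightarrow> \<infinity>)"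
    using eta[unfolded eta_exp_def, THEN spec, THEN mp, of \<beta>] b(1) lim1
    unfolding z1_def d1_def x1_def by blast
  have "?f0 w \<longlonglongrightarrow> 0" if "ereal w < \<eta>" for w
    using e1 that by (intro ennreal_tendsto_0_bound[OF _ up0]) blast
  moreover have "?f0 w \<longlonglongrightarrow> \<infinity>" if "\<eta> < ereal w" for w
    using e1 that c(1) by (intro ennreal_tendsto_top_bound[OF _ up1]) auto
  ultimately show "(\<forall>w::real. ereal w < \<eta> \<longrightarrow>
       ((\<lambda>k. Zfun E0 W0 (\<alpha> k) (1 / conn_const V0 E0) * ennreal (real (setdist E0 W0 (\<alpha> k ` W0)) powr w)) \<longlongrightarrow> 0) sequentially) \<and>
     (\<forall>w::real. \<eta> < ereal w \<longrightarrow>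
       ((\<lambda>k. Zfun E0 W0 (\<alpha> k) (1 / conn_const V0 E0) * ennreal (real (setdist E0 W0 (\<alpha> k ` W0)) powr w)) \<longlongrightarrow> \<infinity>) sequentially)"
    unfolding z0_def d0_def gx by blast
qed

end

theorem theorem3p4:
  fixes V0 :: "'v set" and E0 :: "'v \<Rightarrow> 'v \<Rightarrow> bool"
    and Gv :: "'g set" and Ge :: "'g \<Rightarrow> 'g \<Rightarrow> bool" and w1 w2 w3 :: 'g
    and \<sigma> :: "'v \<Rightarrow> 'v \<Rightarrow> 'g"
    and W0 :: "'v set" and W1 :: "('v \<times> 'g) set" and g :: ereal
  assumes G0: "simple_graph V0 E0" "infinite V0" "connected_graph V0 E0"
              "quasi_transitive V0 E0" "cubic V0 E0"
    and gad: "gadget Gv Ge w1 w2 w3"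
    and att: "\<forall>v\<in>V0. bij_betw (\<sigma> v) {u. E0 v u} {w1, w2, w3}"
    and lift: "\<forall>\<alpha>. aut V0 E0 \<alpha> \<longrightarrow>
                 (\<exists>\<beta>. aut (phi_V V0 Gv) (phi_E V0 E0 Ge \<sigma>) \<beta> \<and>
                      (\<forall>x\<in>phi_V V0 Gv. fst (\<beta> x) = \<alpha> (fst x)))"
    and G1conn: "connected_graph (phi_V V0 Gv) (phi_E V0 E0 Ge \<sigma>)"
    and W0: "min_fund_domain V0 E0 W0"
    and W1: "W1 = W0 \<times> Gv"
    and gam: "gamma_exp V0 E0 W0 g" and fin: "\<bar>g\<bar> \<noteq> \<infinity>"
  shows "gamma_exp (phi_V V0 Gv) (phi_E V0 E0 Ge \<sigma>) W1 g \<and>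
         (\<forall>\<eta>. eta_exp (phi_V V0 Gv) (phi_E V0 E0 Ge \<sigma>) W1 \<eta> \<longrightarrow> eta_exp V0 E0 W0 \<eta>)"
proof -
  interpret local_transf V0 E0 Gv Ge w1 w2 w3 \<sigma> W0
  proof
    show "bij_betw (\<sigma> v) {u. E0 v u} {w1, w2, w3}" if "v \<in> V0" for v using att that by blast
    show "\<exists>\<beta>. aut (phi_V V0 Gv) (phi_E V0 E0 Ge \<sigma>) \<beta> \<and> (\<forall>x\<in>phi_V V0 Gv. fst (\<beta> x) = \<alpha> (fst x))"
      if "aut V0 E0 \<alpha>" for \<alpha> using lift that by blast
    show "fund_domain V0 E0 W0" using W0 by (simp add: min_fund_domain_def)
  qed (rule G0(1) G0(2) G0(3) G0(5) gad G1conn)+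
  show ?thesis unfolding W1 by (intro conjI allI impI gamma_transfer[OF gam] eta_transfer)
qed

end
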